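(* Let $\alpha_k\ge 0$, $k\in\mathbb{N}_0$, with $K:=\sum_{k=1}^\infty \alpha_k<1$. Let $(\varepsilon_n)_{n\in\mathbb{Z}}$ be i.i.d. $\mathrm{Pois}(\alpha_0)$ random variables and let $\xi^{(n,k)}_l\sim\mathrm{Pois}(\alpha_k)$, independently over $n\in\mathbb{Z}$, $k\in\mathbb{N}$, $l\in\mathbb{N}$, and independent of $(\varepsilon_n)$. Then the system of stochastic difference equations $$\varepsilon_n = X_n-\sum_{k=1}^\infty\sum_{l=1}^{X_{n-k}}\xi^{(n,k)}_l,\qquad n\in\mathbb{Z},$$ has an almost surely unique stationary solution $(X_n)_{n\in\mathbb{Z}}$ (that is, a stationary solution exists, and any two stationary solutions with respect to the same $(\varepsilon_n)$ and $(\xi^{(n,k)}_l)$ coincide almost surely), where $X_n\in\mathbb{N}_0$ for all $n\in\mathbb{Z}$ and $$\mathbb{E}X_n=\frac{\alpha_0}{1-K},\qquad n\in\mathbb{Z}.$$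
   Context: All random variables live on a complete probability space $(\Omega,\mathcal{F},\mathbb{P})$. $\mathbb{N}=\{1,2,\dots\}$, $\mathbb{N}_0=\mathbb{N}\cup\{0\}$; $\sum_{l=1}^0 a_l:=0$. "Stationary" means strictly stationary. The inner sums $\sum_{l=1}^{X_{n-k}}\xi^{(n,k)}_l=:\alpha_k\circ X_{n-k}$ are thinnings: in $\alpha\circ Y=\sum_{l=1}^Y\xi_l$ the i.i.d. $\mathrm{Pois}(\alpha)$ counting sequence $(\xi_l)$ is independent of the $\mathbb{N}_0$-valued variable $Y$; correspondingly, for a solution it is understood that for each $n$ the immigration $\varepsilon_n$ and the counting variables $\xi^{(n,k)}_l$, $k,l\in\mathbb{N}$, are independent of the past values $X_{n-1},X_{n-2},\dots$. *)

theory Defs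
  imports "HOL-Probability.Probability"
begin

text \<open>The library's \<open>poisson_pmf\<close> is only specified for positive rates; the Poisson law with
  parameter \<open>0\<close> is the point mass at \<open>0\<close>.\<close>

definition Pois :: "real \<Rightarrow> nat pmf" where
  "Pois r = (if r = 0 then return_pmf 0 else poisson_pmf r)"

definition has_law :: "'a measure \<Rightarrow> ('a \<Rightarrow> nat) \<Rightarrow> nat pmf \<Rightarrow> bool" where
  "has_law M Z p \<longleftrightarrow>
     Z \<in> measurable M (count_space UNIV) \<and> distr M (count_space UNIV) Z = measure_pmf p"

text \<open>Immigrations and counting variables form one family: \<open>Inl n\<close> is the index of \<open>\<epsilon> n\<close>
  and \<open>Inr (n, k, l)\<close> that of \<open>\<xi> n k l\<close>, where only \<open>k, l \<ge> 1\<close> are relevant.\<close>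

type_synonym noise_index = "int + int \<times> nat \<times> nat"

definition noise ::
  "(int \<Rightarrow> 'a \<Rightarrow> nat) \<Rightarrow> (int \<Rightarrow> nat \<Rightarrow> nat \<Rightarrow> 'a \<Rightarrow> nat) \<Rightarrow> noise_index \<Rightarrow> 'a \<Rightarrow> nat" where
  "noise \<epsilon> \<xi> = case_sum \<epsilon> (\<lambda>(n, k, l). \<xi> n k l)"

definition noise_indices_at :: "int \<Rightarrow> noise_index set" where
  "noise_indices_at n = {Inl n} \<union> Inr ` ({n} \<times> {1..} \<times> {1..})"

definition inar_noise ::
  "'a measure \<Rightarrow> (nat \<Rightarrow> real) \<Rightarrow> (int \<Rightarrow> 'a \<Rightarrow> nat) \<Rightarrow> (int \<Rightarrow> nat \<Rightarrow> nat \<Rightarrow> 'a \<Rightarrow> nat) \<Rightarrow> bool" where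
  "inar_noise M \<alpha> \<epsilon> \<xi> \<longleftrightarrow>
     (\<forall>n. has_law M (\<epsilon> n) (Pois (\<alpha> 0))) \<and>
     (\<forall>n. \<forall>k\<ge>1. \<forall>l\<ge>1. has_law M (\<xi> n k l) (Pois (\<alpha> k))) \<and>
     prob_space.indep_vars M (\<lambda>_. count_space UNIV) (noise \<epsilon> \<xi>) (\<Union>n. noise_indices_at n)"

definition generated_events :: "'a measure \<Rightarrow> ('i \<Rightarrow> 'a \<Rightarrow> nat) \<Rightarrow> 'i set \<Rightarrow> 'a set set" where
  "generated_events M Z I =
     sigma_sets (space M) {Z i -` A \<inter> space M | i A. i \<in> I}"

definition strictly_stationary :: "'a measure \<Rightarrow> (int \<Rightarrow> 'a \<Rightarrow> nat) \<Rightarrow> bool" where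
  "strictly_stationary M X \<longleftrightarrow>
     (\<forall>h. distr M (PiM UNIV (\<lambda>_. count_space UNIV)) (\<lambda>\<omega> n. X (n + h) \<omega>) =
          distr M (PiM UNIV (\<lambda>_. count_space UNIV)) (\<lambda>\<omega> n. X n \<omega>))"

definition thinning :: "(nat \<Rightarrow> 'a \<Rightarrow> nat) \<Rightarrow> ('a \<Rightarrow> nat) \<Rightarrow> 'a \<Rightarrow> nat" where
  "thinning \<zeta> Y \<omega> = (\<Sum>l = 1..Y \<omega>. \<zeta> l \<omega>)"

text \<open>\<open>infsum\<close> is \<open>0\<close> for a divergent series, hence the explicit summability requirement.\<close>

definition inar_solution ::
  "'a measure \<Rightarrow> (int \<Rightarrow> 'a \<Rightarrow> nat) \<Rightarrow> (int \<Rightarrow> nat \<Rightarrow> nat \<Rightarrow> 'a \<Rightarrow> nat) \<Rightarrow> (int \<Rightarrow> 'a \<Rightarrow> nat) \<Rightarrow> bool"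
  where
  "inar_solution M \<epsilon> \<xi> X \<longleftrightarrow>
     (\<forall>n. X n \<in> measurable M (count_space UNIV)) \<and>
     (AE \<omega> in M. \<forall>n.
        (\<lambda>k. real (thinning (\<xi> n k) (X (n - int k)) \<omega>)) summable_on {1..} \<and>
        real (\<epsilon> n \<omega>) =
          real (X n \<omega>) - (\<Sum>\<^sub>\<infinity>k\<in>{1..}. real (thinning (\<xi> n k) (X (n - int k)) \<omega>))) \<and>
     (\<forall>n. prob_space.indep_set M
        (generated_events M (noise \<epsilon> \<xi>) (noise_indices_at n)) (generated_events M X {..<n}))"

definition stationary_inar_solution ::
  "'a measure \<Rightarrow> (int \<Rightarrow> 'a \<Rightarrow> nat) \<Rightarrow> (int \<Rightarrow> nat \<Rightarrow> nat \<Rightarrow> 'a \<Rightarrow> nat) \<Rightarrow> (int \<Rightarrow> 'a \<Rightarrow> nat) \<Rightarrow> bool"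
  where
  "stationary_inar_solution M \<epsilon> \<xi> X \<longleftrightarrow>
     inar_solution M \<epsilon> \<xi> X \<and> strictly_stationary M X"

end

theory Submission
  imports Defs
begin

text \<open>
  Picard iteration from zero yields a minimal solution \<open>Z\<close>, a stationary functional of the noise with mean at
  most \<open>\<alpha>\<^sub>0 / (1 - K)\<close>, and \<open>Z \<le> X\<close> almost surely for every solution \<open>X\<close>. If every stationary solution has
  a finite mean, that mean must be \<open>\<alpha>\<^sub>0 / (1 - K)\<close>, and \<open>Z \<le> X\<close> with equal means gives \<open>X = Z\<close>.

  Finiteness of the mean is the difficulty, since integrability is not assumed. Given the past before \<open>r - n\<close>, the number of clusters
  of the branching structure that reach time \<open>r\<close> is of the order of the linear prediction of \<open>X\<^sub>r\<close>;
  as \<open>X\<^sub>r\<close> is finite, the predictions are tight as \<open>n \<rightarrow> \<infinity>\<close>. Hence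
  \<open>H\<^sub>r = E [X\<^sub>r | tail]\<close> is almost surely finite, tight in \<open>r\<close>, and
  satisfies \<open>H\<^sub>r = \<alpha>\<^sub>0 + (\<Sum>k. \<alpha>\<^sub>k H\<^sub>r\<^sub>-\<^sub>k)\<close>. As in the Choquet-Deny theorem, nonnegative solutions of this convolution
  equation are log-convex along every step \<open>a\<close> with \<open>\<alpha>\<^sub>a > 0\<close>: writing \<open>U f = \<alpha>\<^sub>a f (\<cdot> - a)\<close>, both \<open>U\<close> and \<open>1 - U\<close>
  preserve such solutions, so \<open>(U\<^sup>i H)\<^sub>r\<close> is completely monotone in \<open>i\<close>. If \<open>H\<^sub>r\<^sub>-\<^sub>a > H\<^sub>r\<close>, then \<open>H\<close> would
  diverge along \<open>r - n a\<close>, which contradicts tightness. So \<open>H\<^sub>r\<^sub>-\<^sub>a \<le> H\<^sub>r\<close> for all these \<open>a\<close>, and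
  \<open>H\<^sub>r \<le> \<alpha>\<^sub>0 + K H\<^sub>r\<close>.\<close>

section \<open>Completely monotone sequences and convolution equations\<close>

text \<open>Taking expectations gives \<open>E X = \<alpha> 0 + K * E X\<close>, which for
  \<open>K > 0\<close> an infinite mean satisfies as well; integrability must therefore come from
  the mere finiteness of \<open>X\<close>. The link is the Laplace transform: a sum of Poisson
  thinnings replaces the exponent \<open>u\<close> by \<open>1 - exp (- u)\<close> times the
  conditional mean, so \<open>n\<close> steps backwards bound \<open>E exp (- s X)\<close> by the
  transform of a nonlinear prediction. For \<open>s \<le> 1 - K\<close> its weights keep at least
  half of the linear ones, which is the origin of the rate \<open>s / 2\<close>. The tail algebra of
  a solution is not known to be trivial, because a solution is not a priori a function of the noise.
  Hence the tail mean is random: the convolution equation is treated pathwise, while tightness is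
  only a bound for the probability at each single time, uniform in time by stationarity.
  Conditioning on the tail instead of a moving past puts all the means over one algebra, so that the
  equation is exact. Log-convexity is proved from finite differences, without a representing
  measure.\<close>

lemma has_sum_Suc_iff:
  fixes f :: "nat \<Rightarrow> real"
  shows "((\<lambda>k. f (Suc k)) has_sum S) UNIV \<longleftrightarrow> (f has_sum S) {1..}"
proof -
  have "bij_betw Suc UNIV {1..}"
    by (rule bij_betwI[of _ _ _ "\<lambda>k. k - 1"]) auto
  then show ?thesis by (rule has_sum_reindex_bij_betw)
qed

text \<open>Pascal's rule; it is the induction step for all binomial sums below.\<close>

lemma sum_choose_Suc:
  fixes F :: "nat \<Rightarrow> real"
  shows "(\<Sum>i\<le>Suc m. real (Suc m choose i) * F i) = (\<Sum>i\<le>m. real (m choose i) * (F i + F (Suc i)))"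
proof -
  have "(\<Sum>i\<le>Suc m. real (Suc m choose i) * F i)
      = F 0 + (\<Sum>i\<le>m. real (Suc m choose Suc i) * F (Suc i))"
    by (simp add: sum.atMost_Suc_shift del: sum.atMost_Suc binomial_Suc_Suc)
  also have "\<dots> = (F 0 + (\<Sum>i\<le>m. real (m choose Suc i) * F (Suc i))) + (\<Sum>i\<le>m. real (m choose i) * F (Suc i))"
    by (simp add: sum.distrib algebra_simps)
  also have "F 0 + (\<Sum>i\<le>m. real (m choose Suc i) * F (Suc i)) = (\<Sum>i\<le>Suc m. real (m choose i) * F i)"
    by (simp add: sum.atMost_Suc_shift del: sum.atMost_Suc)
  also have "\<dots> = (\<Sum>i\<le>m. real (m choose i) * F i)"
    by simp
  finally show ?thesis by (simp add: sum.distrib algebra_simps)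
qed

text \<open>If \<open>d j i\<close> is the integral of \<open>x^i (1 - x)^j\<close>, these are the
  total mass, the mean and the second factorial moment of a binomial law with \<open>m\<close>
  trials, integrated over the success probability \<open>x\<close>. The recursion alone suffices, so
  no measure has to be constructed.\<close>

lemma completely_monotone_moments:
  fixes d :: "nat \<Rightarrow> nat \<Rightarrow> real"
  assumes "\<And>j i. d j i = d (Suc j) i + d j (Suc i)"
  shows "(\<Sum>i\<le>m. real (m choose i) * d (m - i) i) = d 0 0"
    and "(\<Sum>i\<le>m. real (m choose i) * (real i * d (m - i) i)) = real m * d 0 1"
    and "(\<Sum>i\<le>m. real (m choose i) * (real i * (real i - 1) * d (m - i) i)) = real m * (real m - 1) * d 0 2"
  using assms
proof (induction m arbitrary: d)
  case 0
  { case 1 show ?case by simp }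
  { case 2 show ?case by simp }
  { case 3 show ?case by simp }
next
  case (Suc m)
  \<comment> \<open>Lowering \<open>m\<close> costs the forward difference of the weight
    \<open>h\<close> on the shifted array. For the weights \<open>1\<close>, \<open>i\<close> and
    \<open>i (i - 1)\<close> this difference is \<open>0\<close>, \<open>1\<close> and
    \<open>2 i\<close>, so each moment reduces to the previous one for
    \<open>\<lambda>j i. d j (Suc i)\<close>.\<close>
  have shift: "(\<Sum>i\<le>Suc m. real (Suc m choose i) * (h i * d (Suc m - i) i))
     = (\<Sum>i\<le>m. real (m choose i) * (h i * d (m - i) i + (h (Suc i) - h i) * d (m - i) (Suc i)))"
    if d: "\<And>j i. d j i = d (Suc j) i + d j (Suc i)" for h :: "nat \<Rightarrow> real" and d
    unfolding sum_choose_Suc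
  proof (intro sum.cong refl arg_cong2[where f = "(*)"])
    fix i assume "i \<in> {..m}"
    then have "Suc m - i = Suc (m - i)" by auto
    then show "h i * d (Suc m - i) i + h (Suc i) * d (Suc m - Suc i) (Suc i) =
        h i * d (m - i) i + (h (Suc i) - h i) * d (m - i) (Suc i)"
      using d[of "m - i" i] by (simp add: algebra_simps)
  qed
  { case 1
    show ?case using shift[of d "\<lambda>_. 1", OF 1] Suc.IH(1)[of d, OF 1] by simp }
  { case 2
    have "(\<Sum>i\<le>m. real (m choose i) * d (m - i) (Suc i)) = d 0 1"
      using Suc.IH(1)[of "\<lambda>j i. d j (Suc i)", OF 2] by simp
    then show ?case using shift[of d real, OF 2] Suc.IH(2)[of d, OF 2]
      by (simp add: algebra_simps sum.distrib) }
  { case 3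
    have "(\<Sum>i\<le>m. real (m choose i) * (real i * d (m - i) (Suc i))) = real m * d 0 2"
      using Suc.IH(2)[of "\<lambda>j i. d j (Suc i)", OF 3] by (simp add: numeral_2_eq_2)
    moreover have "(\<Sum>i\<le>m. real (m choose i) * (2 * real i * d (m - i) (Suc i)))
        = 2 * (\<Sum>i\<le>m. real (m choose i) * (real i * d (m - i) (Suc i)))"
      unfolding sum_distrib_left by (intro sum.cong refl) simp
    ultimately have "(\<Sum>i\<le>m. real (m choose i) * (2 * real i * d (m - i) (Suc i))) = 2 * real m * d 0 2"
      by simp
    moreover have "real (Suc i) * (real (Suc i) - 1) - real i * (real i - 1) = 2 * real i" for i
      by (simp add: algebra_simps)
    ultimately have "(\<Sum>i\<le>Suc m. real (Suc m choose i) * (real i * (real i - 1) * d (Suc m - i) i))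
        = real m * (real m - 1) * d 0 2 + 2 * real m * d 0 2"
      unfolding shift[of d "\<lambda>i. real i * (real i - 1)", OF 3]
      using Suc.IH(3)[of d, OF 3] by (simp only: distrib_left sum.distrib)
    then show ?case by (simp add: algebra_simps del: sum.atMost_Suc binomial_Suc_Suc) }
qed

text \<open>\<open>d j i\<close> plays the role of \<open>\<integral> x^i (1 - x)^j d\<mu>\<close>; nonnegativity of a binomial variance gives
  log-convexity up to an error \<open>1/m\<close>.\<close>

lemma completely_monotone_log_convex:
  fixes d :: "nat \<Rightarrow> nat \<Rightarrow> real"
  assumes rec: "\<And>j i. d j i = d (Suc j) i + d j (Suc i)" and nonneg: "\<And>j i. 0 \<le> d j i"
  shows "(d 0 1)\<^sup>2 \<le> d 0 0 * d 0 2"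
proof (cases "d 0 0 = 0")
  case True
  then show ?thesis using rec[of 0 0] nonneg[of 1 0] nonneg[of 0 1] by simp
next
  case False
  define u0 u1 u2 where "u0 = d 0 0" and "u1 = d 0 1" and "u2 = d 0 2"
  have u0: "u0 > 0" using False nonneg[of 0 0] by (simp add: u0_def)
  have key: "real m * (u1\<^sup>2 - u0 * u2) \<le> u0 * u1 - u0 * u2" if "m > 0" for m
  proof -
    note M = completely_monotone_moments[where d = d and m = m, OF rec, folded u0_def u1_def u2_def]
    \<comment> \<open>The square is the deviation of \<open>i\<close> from its mean
      \<open>m u1 / u0\<close>, multiplied by \<open>u0\<close> to avoid the division.\<close>
    have "0 \<le> (\<Sum>i\<le>m. real (m choose i) * d (m - i) i * (u0 * real i - real m * u1)\<^sup>2)"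
      by (intro sum_nonneg mult_nonneg_nonneg nonneg) auto
    also have "\<dots> = (\<Sum>i\<le>m. u0\<^sup>2 * (real (m choose i) * (real i * (real i - 1) * d (m - i) i))
       + (u0\<^sup>2 - 2 * u0 * real m * u1) * (real (m choose i) * (real i * d (m - i) i))
       + (real m)\<^sup>2 * u1\<^sup>2 * (real (m choose i) * d (m - i) i))"
      by (intro sum.cong refl) (simp add: algebra_simps power2_eq_square)
    also have "\<dots> = u0\<^sup>2 * (real m * (real m - 1) * u2) + (u0\<^sup>2 - 2 * u0 * real m * u1) * (real m * u1)
       + (real m)\<^sup>2 * u1\<^sup>2 * u0"
      by (simp only: sum.distrib sum_distrib_left[symmetric] M)
    also have "\<dots> = (u0 * real m) * ((u0 * u1 - u0 * u2) - real m * (u1\<^sup>2 - u0 * u2))"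
      by (simp add: algebra_simps power2_eq_square)
    finally have "0 \<le> (u0 * real m) * ((u0 * u1 - u0 * u2) - real m * (u1\<^sup>2 - u0 * u2))" .
    moreover have "0 < u0 * real m" using u0 that by simp
    ultimately have "0 \<le> (u0 * u1 - u0 * u2) - real m * (u1\<^sup>2 - u0 * u2)"
      using zero_le_mult_iff not_le by blast
    then show ?thesis by simp
  qed
  have "u1\<^sup>2 - u0 * u2 \<le> 0"
  proof (rule ccontr)
    assume "\<not> ?thesis"
    then have pos: "u1\<^sup>2 - u0 * u2 > 0" by simp
    obtain m where "(u0 * u1 - u0 * u2) < real m * (u1\<^sup>2 - u0 * u2)"
      using reals_Archimedean3[OF pos] by blast
    moreover have "real m * (u1\<^sup>2 - u0 * u2) \<le> real (Suc m) * (u1\<^sup>2 - u0 * u2)"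
      using pos by (intro mult_right_mono) auto
    ultimately show False using key[of "Suc m"] by linarith
  qed
  then show ?thesis by (simp add: u0_def u1_def u2_def)
qed

text \<open>The class of nonnegative functions satisfying the equation with some constant
  \<open>g \<ge> 0\<close> is preserved by both operators: \<open>U\<close> multiplies
  \<open>g\<close> by \<open>\<alpha> a\<close>, and \<open>1 - U\<close> multiplies it by
  \<open>1 - \<alpha> a\<close>.\<close>

lemma harmonic_log_convex:
  fixes f :: "int \<Rightarrow> real" and \<alpha> :: "nat \<Rightarrow> real"
  assumes \<alpha>: "\<And>k. 0 \<le> \<alpha> k" and a: "1 \<le> a" "\<alpha> a \<le> 1" "0 < \<alpha> a"
    and f0: "\<And>r. 0 \<le> f r" and g: "0 \<le> g"
    and harm: "\<And>r. ((\<lambda>k. \<alpha> k * f (r - int k)) has_sum (f r - g)) {1..}"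
  shows "(f (r - int a))\<^sup>2 \<le> f r * f (r - 2 * int a)"
proof -
  \<comment> \<open>\<open>d j i r\<close> is \<open>(1 - U)^j U^i f\<close> at \<open>r\<close>;
    differencing in the index \<open>i\<close> is the same as applying \<open>1 - U\<close> (see
    \<open>dU\<close>).\<close>
  define d where "d j = ((\<lambda>e i r. e i r - e (Suc i) r) ^^ j) (\<lambda>i r. \<alpha> a ^ i * f (r - int i * int a))" for j
  have d0: "d 0 i r = \<alpha> a ^ i * f (r - int i * int a)" for i r by (simp add: d_def)
  have dS: "d (Suc j) i r = d j i r - d j (Suc i) r" for i j r by (simp add: d_def)
  have dU: "d j (Suc i) r = \<alpha> a * d j i (r - int a)" for i j r
    by (induction j arbitrary: i) (simp_all add: d0 dS algebra_simps)
  have "\<exists>g\<ge>0. \<forall>r. 0 \<le> d j i r \<and> ((\<lambda>k. \<alpha> k * d j i (r - int k)) has_sum (d j i r - g)) {1..}" for i j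
  proof (induction j)
    case 0
    have "((\<lambda>k. \<alpha> a ^ i * (\<alpha> k * f (r - int i * int a - int k))) has_sum
        (\<alpha> a ^ i * (f (r - int i * int a) - g))) {1..}" for r
      by (intro has_sum_cmult_right harm)
    then have "((\<lambda>k. \<alpha> k * d 0 i (r - int k)) has_sum (d 0 i r - \<alpha> a ^ i * g)) {1..}" for r
      by (simp add: d0 algebra_simps)
    moreover have "0 \<le> d 0 i r" for r using \<alpha> f0 by (simp add: d0)
    ultimately show ?case using g \<alpha> by (intro exI[of _ "\<alpha> a ^ i * g"]) auto
  next
    case (Suc j)
    then obtain g where g: "g \<ge> 0" "\<And>r. 0 \<le> d j i r"
      "\<And>r. ((\<lambda>k. \<alpha> k * d j i (r - int k)) has_sum (d j i r - g)) {1..}" by blast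
    \<comment> \<open>The summand \<open>k = a\<close> alone is at most the whole nonnegative
      series, which gives positivity of the image under \<open>1 - U\<close>.\<close>
    have "\<alpha> a * d j i (r - int a) \<le> d j i r - g" for r
    proof -
      have "((\<lambda>k. \<alpha> k * d j i (r - int k)) has_sum (\<alpha> a * d j i (r - int a))) {a}"
        by (rule has_sum_finiteI) auto
      then show ?thesis
        by (rule has_sum_mono_neutral[OF _ g(3)]) (use g(2) \<alpha> a in auto)
    qed
    then have "0 \<le> d (Suc j) i r" for r using g(1) by (simp add: dS dU) (smt (verit))
    moreover have "((\<lambda>k. \<alpha> k * d (Suc j) i (r - int k)) has_sum (d (Suc j) i r - (1 - \<alpha> a) * g)) {1..}" for r
    proof -
      have "((\<lambda>k. \<alpha> k * d j i (r - int k) + - \<alpha> a * (\<alpha> k * d j i (r - int a - int k))) has_sum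
         ((d j i r - g) + - \<alpha> a * (d j i (r - int a) - g))) {1..}"
        by (intro has_sum_add has_sum_cmult_right g)
      then show ?thesis by (simp add: dS dU algebra_simps)
    qed
    ultimately show ?case using g(1) a by (intro exI[of _ "(1 - \<alpha> a) * g"]) auto
  qed
  then have nn: "0 \<le> d j i r" for j i by blast
  have "(d 0 1 r)\<^sup>2 \<le> d 0 0 r * d 0 2 r"
    by (rule completely_monotone_log_convex[where d = "\<lambda>j i. d j i r"]) (auto simp: dS nn)
  then have "(\<alpha> a)\<^sup>2 * (f (r - int a))\<^sup>2 \<le> (\<alpha> a)\<^sup>2 * (f r * f (r - 2 * int a))"
    by (simp add: d0 power_mult_distrib mult_ac)
  then show ?thesis using a by (simp add: mult_le_cancel_left)
qed

text \<open>Log-convexity makes the ratio of successive values along \<open>r - n a\<close>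
  nondecreasing in \<open>n\<close>. A first ratio \<open>q > 1\<close> thus forces growth at least
  like \<open>q ^ n\<close>.\<close>

lemma harmonic_increase_unbounded:
  fixes f :: "int \<Rightarrow> real" and \<alpha> :: "nat \<Rightarrow> real"
  assumes \<alpha>: "\<And>k. 0 \<le> \<alpha> k" and a: "1 \<le> a" "\<alpha> a \<le> 1" "0 < \<alpha> a"
    and f0: "\<And>r. 0 \<le> f r" and g: "0 \<le> g"
    and harm: "\<And>r. ((\<lambda>k. \<alpha> k * f (r - int k)) has_sum (f r - g)) {1..}"
    and inc: "f r < f (r - int a)"
  shows "\<exists>N. \<forall>n\<ge>N. c < f (r - int n * int a)"
proof -
  have dom: "\<alpha> a * f (r - int a) \<le> f r - g" for r
  proof -
    have "((\<lambda>k. \<alpha> k * f (r - int k)) has_sum (\<alpha> a * f (r - int a))) {a}"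
      by (rule has_sum_finiteI) auto
    then show ?thesis
      by (rule has_sum_mono_neutral[OF _ harm]) (use f0 \<alpha> a in auto)
  qed
  have fr: "f r > 0"
  proof -
    have "f (r - int a) > 0" using inc f0[of r] by linarith
    then have "\<alpha> a * f (r - int a) > 0" using a by simp
    then show ?thesis using dom[of r] g by linarith
  qed
  define q where "q = f (r - int a) / f r"
  have q: "q > 1" using inc fr by (simp add: q_def)
  have step: "f (r - int n * int a) > 0 \<and> q * f (r - int n * int a) \<le> f (r - int (Suc n) * int a)" for n
  proof (induction n)
    case 0
    then show ?case using fr by (simp add: q_def)
  next
    case (Suc n)
    let ?x = "f (r - int n * int a)" and ?y = "f (r - int (Suc n) * int a)"
      and ?z = "f (r - int (Suc (Suc n)) * int a)"
    have x: "?x > 0" and xy: "q * ?x \<le> ?y" using Suc by auto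
    have y: "?y > 0" using x xy q by (smt (verit) mult_pos_pos)
    have "?y\<^sup>2 \<le> ?x * ?z"
      using harmonic_log_convex[OF \<alpha> a f0 g harm, of "r - int n * int a"] by (simp add: algebra_simps)
    moreover have "q * ?x * ?y \<le> ?y * ?y" using xy y by (intro mult_right_mono) auto
    ultimately have "?x * (q * ?y) \<le> ?x * ?z" by (simp add: power2_eq_square algebra_simps)
    then show ?case using x y by (simp add: mult_le_cancel_left)
  qed
  have geo: "q ^ n * f r \<le> f (r - int n * int a)" for n
  proof (induction n)
    case (Suc n)
    have "q ^ Suc n * f r = q * (q ^ n * f r)" by simp
    also have "\<dots> \<le> q * f (r - int n * int a)" using Suc q by (intro mult_left_mono) auto
    also have "\<dots> \<le> f (r - int (Suc n) * int a)" using step[of n] by simp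
    finally show ?case .
  qed simp
  obtain N where N: "c / f r < q ^ N" using real_arch_pow[OF q] by blast
  have "c < f (r - int n * int a)" if "n \<ge> N" for n
  proof -
    have "q ^ N \<le> q ^ n" using q that by (intro power_increasing) auto
    then have "c / f r < q ^ n" using N by linarith
    then have "c < q ^ n * f r" using fr by (simp add: field_simps)
    then show ?thesis using geo[of n] by linarith
  qed
  then show ?thesis by blast
qed

text \<open>Iterating the one-step bound below on \<open>E exp (- s X\<^sub>r)\<close> produces the nonlinear recursion
  \<open>exponent_weight\<close>; its linearisation at \<open>s = 0\<close> is \<open>s\<close> times the renewal sequence, and the two stay
  comparable.\<close>

fun renewal :: "(nat \<Rightarrow> real) \<Rightarrow> nat \<Rightarrow> real" where
  "renewal \<alpha> n = (if n = 0 then 1 else \<Sum>i<n. \<alpha> (n - i) * renewal \<alpha> i)"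

declare renewal.simps [simp del]

fun exponent_weight :: "(nat \<Rightarrow> real) \<Rightarrow> real \<Rightarrow> nat \<Rightarrow> real" where
  "exponent_weight \<alpha> s n = 1 - exp (- (if n = 0 then s else \<Sum>i<n. \<alpha> (n - i) * exponent_weight \<alpha> s i))"

declare exponent_weight.simps [simp del]

lemma renewal_nonneg:
  assumes "\<And>k. 0 \<le> \<alpha> k"
  shows "0 \<le> renewal \<alpha> n"
proof (induction n rule: less_induct)
  case (less n)
  show ?case unfolding renewal.simps[of \<alpha> n]
    by (auto intro!: sum_nonneg mult_nonneg_nonneg assms less)
qed

text \<open>Summing the renewal equation and exchanging the order of summation gives
  \<open>S \<le> 1 + K * S\<close> for the partial sum \<open>S\<close>. The bound is the mean total
  size of one cluster.\<close>

lemma sum_renewal_le: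
  assumes \<alpha>: "\<And>k. 0 \<le> \<alpha> k" and K: "\<And>N. (\<Sum>k=1..N. \<alpha> k) \<le> K" "K < 1"
  shows "(\<Sum>i\<le>N. renewal \<alpha> i) \<le> 1 / (1 - K)"
proof -
  note G = renewal_nonneg[of \<alpha>, OF \<alpha>]
  have "(\<Sum>i\<le>N. renewal \<alpha> i) = 1 + (\<Sum>n\<in>{1..N}. \<Sum>i<n. \<alpha> (n - i) * renewal \<alpha> i)"
  proof -
    have "{..N} = insert 0 {1..N}" by auto
    then have "(\<Sum>i\<le>N. renewal \<alpha> i) = renewal \<alpha> 0 + (\<Sum>n\<in>{1..N}. renewal \<alpha> n)" by simp
    also have "(\<Sum>n\<in>{1..N}. renewal \<alpha> n) = (\<Sum>n\<in>{1..N}. \<Sum>i<n. \<alpha> (n - i) * renewal \<alpha> i)"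
      by (intro sum.cong refl) (subst renewal.simps, simp)
    finally show ?thesis by (simp add: renewal.simps)
  qed
  also have "(\<Sum>n\<in>{1..N}. \<Sum>i<n. \<alpha> (n - i) * renewal \<alpha> i)
     = (\<Sum>(n, i)\<in>(SIGMA n:{1..N}. {..<n}). \<alpha> (n - i) * renewal \<alpha> i)"
    by (simp add: sum.Sigma)
  also have "\<dots> = (\<Sum>(i, k)\<in>(SIGMA i:{..N}. {1..N-i}). \<alpha> k * renewal \<alpha> i)"
    by (rule sum.reindex_bij_witness[of _ "\<lambda>(i, k). (i + k, i)" "\<lambda>(n, i). (i, n - i)"]) auto
  also have "\<dots> = (\<Sum>i\<le>N. (\<Sum>k\<in>{1..N-i}. \<alpha> k) * renewal \<alpha> i)"
    by (simp add: sum.Sigma[symmetric] sum_distrib_right)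
  also have "\<dots> \<le> (\<Sum>i\<le>N. K * renewal \<alpha> i)"
    by (intro sum_mono mult_right_mono K G)
  also have "\<dots> = K * (\<Sum>i\<le>N. renewal \<alpha> i)" by (simp add: sum_distrib_left)
  finally show ?thesis using K(2) by (simp add: field_simps)
qed

lemma one_minus_exp_ge:
  fixes x :: real
  assumes "0 \<le> x"
  shows "x - x\<^sup>2 / 2 \<le> 1 - exp (- x)"
proof -
  have "1 - exp (- 0) - 0 + 0\<^sup>2 / 2 \<le> 1 - exp (- x) - x + x\<^sup>2 / 2"
  proof (rule DERIV_nonneg_imp_nondecreasing[OF assms])
    fix z :: real assume "0 \<le> z"
    have "((\<lambda>x. 1 - exp (- x) - x + x\<^sup>2 / 2) has_real_derivative (exp (- z) - 1 + z)) (at z)"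
      by (auto intro!: derivative_eq_intros)
    moreover have "0 \<le> exp (- z) - 1 + z" using exp_ge_add_one_self[of "- z"] by simp
    ultimately show "\<exists>y. ((\<lambda>x. 1 - exp (- x) - x + x\<^sup>2 / 2) has_real_derivative y) (at z) \<and> 0 \<le> y"
      by blast
  qed
  then show ?thesis by simp
qed

text \<open>The quadratic errors of \<open>1 - exp (- t)\<close> accumulate to a relative loss of at
  most \<open>s / 2\<close> times the sum of the renewal sequence. That sum is at most
  \<open>1 / (1 - K)\<close>, so \<open>s \<le> 1 - K\<close> keeps the loss below one half.\<close>

lemma exponent_weight_ge:
  assumes \<alpha>: "\<And>k. 0 \<le> \<alpha> k" and K: "\<And>N. (\<Sum>k=1..N. \<alpha> k) \<le> K" "K < 1" and s: "0 \<le> s" "s \<le> 1 - K"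
  shows "s / 2 * renewal \<alpha> n \<le> exponent_weight \<alpha> s n"
proof -
  note G = renewal_nonneg[of \<alpha>, OF \<alpha>]
  define S where "S n = (\<Sum>j\<le>n. renewal \<alpha> j)" for n
  have S: "S n \<le> 1 / (1 - K)" for n unfolding S_def using sum_renewal_le[OF \<alpha> K] .
  have sS: "s / 2 * S n \<le> 1 / 2" for n
  proof -
    have "s * S n \<le> s * (1 / (1 - K))" using S s by (intro mult_left_mono) auto
    also have "\<dots> \<le> 1" using s K(2) by (simp add: field_simps)
    finally show ?thesis by simp
  qed
  have S0: "0 \<le> S n" for n unfolding S_def by (intro sum_nonneg G)
  have Smono: "S m \<le> S n" if "m \<le> n" for m n
    unfolding S_def using that by (intro sum_mono2) (auto intro: G)
  \<comment> \<open>The induction needs the loss factor \<open>1 - s / 2 * S n\<close>, which varies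
    with \<open>n\<close>: passing from \<open>S n - renewal \<alpha> n\<close> to
    \<open>S n\<close> absorbs exactly the new error
    \<open>(s * renewal \<alpha> n)\<^sup>2 / 2\<close>. The upper bound is what controls that
    error.\<close>
  have "0 \<le> exponent_weight \<alpha> s n \<and> exponent_weight \<alpha> s n \<le> s * renewal \<alpha> n \<and>
      s * renewal \<alpha> n * (1 - s / 2 * S n) \<le> exponent_weight \<alpha> s n"
  proof (induction n rule: less_induct)
    case (less n)
    define t where "t = (if n = 0 then s else \<Sum>i<n. \<alpha> (n - i) * exponent_weight \<alpha> s i)"
    have y: "exponent_weight \<alpha> s n = 1 - exp (- t)" unfolding t_def by (rule exponent_weight.simps)
    have t0: "0 \<le> t" unfolding t_def using less s \<alpha> by (auto intro!: sum_nonneg)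
    have tu: "t \<le> s * renewal \<alpha> n"
    proof (cases "n = 0")
      case True then show ?thesis by (simp add: t_def renewal.simps)
    next
      case False
      have "t \<le> (\<Sum>i<n. \<alpha> (n - i) * (s * renewal \<alpha> i))"
        unfolding t_def using False less \<alpha> by (auto intro!: sum_mono mult_left_mono)
      also have "\<dots> = s * renewal \<alpha> n"
        using False by (subst (2) renewal.simps) (simp add: sum_distrib_left mult_ac)
      finally show ?thesis .
    qed
    have tl: "s * renewal \<alpha> n * (1 - s / 2 * (S n - renewal \<alpha> n)) \<le> t"
    proof (cases "n = 0")
      case True then show ?thesis by (simp add: t_def renewal.simps S_def)
    next
      case False
      then obtain m where m: "n = Suc m" by (cases n) auto
      have Sn: "S n - renewal \<alpha> n = S m" by (simp add: S_def m)
      have "s * renewal \<alpha> n * (1 - s / 2 * S m) = (\<Sum>i<n. \<alpha> (n - i) * (s * renewal \<alpha> i * (1 - s / 2 * S m)))"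
        using False by (subst renewal.simps) (simp add: sum_distrib_left sum_distrib_right mult_ac)
      also have "\<dots> \<le> (\<Sum>i<n. \<alpha> (n - i) * exponent_weight \<alpha> s i)"
      proof (intro sum_mono mult_left_mono \<alpha>)
        fix i assume i: "i \<in> {..<n}"
        have "s * renewal \<alpha> i * (1 - s / 2 * S m) \<le> s * renewal \<alpha> i * (1 - s / 2 * S i)"
          using i m s G Smono[of i m] by (intro mult_left_mono) (auto intro!: mult_left_mono)
        then show "s * renewal \<alpha> i * (1 - s / 2 * S m) \<le> exponent_weight \<alpha> s i"
          using less[of i] i by fastforce
      qed
      also have "\<dots> = t" using False by (simp add: t_def)
      finally show ?thesis by (simp add: Sn)
    qed
    have "t - t\<^sup>2 / 2 \<le> exponent_weight \<alpha> s n" using one_minus_exp_ge[OF t0] by (simp add: y)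
    moreover have "t\<^sup>2 \<le> (s * renewal \<alpha> n)\<^sup>2" using tu t0 by (intro power_mono)
    moreover have "s * renewal \<alpha> n * (1 - s / 2 * (S n - renewal \<alpha> n)) - (s * renewal \<alpha> n)\<^sup>2 / 2
        = s * renewal \<alpha> n * (1 - s / 2 * S n)"
      by (simp add: algebra_simps power2_eq_square)
    ultimately have "s * renewal \<alpha> n * (1 - s / 2 * S n) \<le> exponent_weight \<alpha> s n"
      using tl by linarith
    moreover have "0 \<le> exponent_weight \<alpha> s n" using t0 by (simp add: y)
    moreover have "exponent_weight \<alpha> s n \<le> s * renewal \<alpha> n"
      using exp_ge_add_one_self[of "- t"] tu by (simp add: y)
    ultimately show ?case by blast
  qed
  moreover have "s * renewal \<alpha> n * (1 / 2) \<le> s * renewal \<alpha> n * (1 - s / 2 * S n)"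
    using sS[of n] s G by (intro mult_left_mono) auto
  moreover have "s * renewal \<alpha> n * (1 / 2) = s / 2 * renewal \<alpha> n" by simp
  ultimately show ?thesis by linarith
qed

section \<open>Independence and Poisson thinnings\<close>

text \<open>The family \<open>generated_events\<close> packaged as a measure space, so that
  measurability of functions with respect to it can be expressed.\<close>

definition generated_algebra :: "'a measure \<Rightarrow> ('i \<Rightarrow> 'a \<Rightarrow> nat) \<Rightarrow> 'i set \<Rightarrow> 'a measure" where
  "generated_algebra M Z I = sigma (space M) {Z i -` A \<inter> space M | i A. i \<in> I}"

lemma space_generated_algebra [simp]: "space (generated_algebra M Z I) = space M"
  unfolding generated_algebra_def by (rule space_measure_of) auto

lemma sets_generated_algebra: "sets (generated_algebra M Z I) = generated_events M Z I"
  unfolding generated_algebra_def generated_events_def by (rule sets_measure_of) auto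

lemma measurable_generated_algebra:
  assumes "i \<in> I"
  shows "Z i \<in> generated_algebra M Z I \<rightarrow>\<^sub>M count_space UNIV"
proof (rule measurableI)
  fix A :: "nat set"
  have "Z i -` A \<inter> space M \<in> generated_events M Z I"
    unfolding generated_events_def by (rule sigma_sets.Basic) (use assms in blast)
  then show "Z i -` A \<inter> space (generated_algebra M Z I) \<in> sets (generated_algebra M Z I)"
    by (simp add: sets_generated_algebra)
qed simp

lemma generated_algebra_least:
  assumes sp: "space N = space M" and Z: "\<And>i. i \<in> I \<Longrightarrow> Z i \<in> N \<rightarrow>\<^sub>M count_space UNIV"
  shows "subalgebra N (generated_algebra M Z I)"
proof -
  have "{Z i -` A \<inter> space M | i A. i \<in> I} \<subseteq> sets N"
  proof safe
    fix i and A :: "nat set" assume "i \<in> I"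
    show "Z i -` A \<inter> space M \<in> sets N"
      using measurable_sets[OF Z[OF \<open>i \<in> I\<close>], of A] by (simp add: sp)
  qed
  then have "generated_events M Z I \<subseteq> sets N"
    unfolding generated_events_def sp[symmetric] by (rule sets.sigma_sets_subset)
  then show ?thesis by (simp add: subalgebra_def sets_generated_algebra sp)
qed

lemma generated_algebra_mono:
  assumes "I \<subseteq> J"
  shows "subalgebra (generated_algebra M Z J) (generated_algebra M Z I)"
  by (rule generated_algebra_least) (simp, rule measurable_generated_algebra, use assms in blast)

text \<open>Formulated in \<open>ennreal\<close> so that it applies before any integrability is
  known; both sides may be infinite.\<close>

lemma (in prob_space) indep_set_nn_integral_mult:
  fixes f g :: "'a \<Rightarrow> ennreal"
  assumes ind: "indep_set (sets G) (sets F)" and sp: "space G = space M" "space F = space M"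
    and f: "f \<in> borel_measurable G" and g: "g \<in> borel_measurable F"
  shows "(\<integral>\<^sup>+\<omega>. f \<omega> * g \<omega> \<partial>M) = (\<integral>\<^sup>+\<omega>. f \<omega> \<partial>M) * (\<integral>\<^sup>+\<omega>. g \<omega> \<partial>M)"
proof -
  have ev: "sets G \<subseteq> events" "sets F \<subseteq> events"
    using indep_setD_ev1[OF ind] indep_setD_ev2[OF ind] .
  have sub: "subalgebra M G" "subalgebra M F" using sp ev by (auto simp: subalgebra_def)
  have mf: "f \<in> borel_measurable M" and mg: "g \<in> borel_measurable M"
    using measurable_from_subalg[OF sub(1) f] measurable_from_subalg[OF sub(2) g] .
  have "indep_var borel f borel g"
    unfolding indep_var_eq
  proof (intro conjI mf mg)
    have F: "sigma_sets (space M) {f -` A \<inter> space M | A. A \<in> sets borel} \<subseteq> sets G"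
      unfolding sp(1)[symmetric] by (rule sets.sigma_sets_subset) (auto intro!: measurable_sets[OF f])
    have G: "sigma_sets (space M) {g -` A \<inter> space M | A. A \<in> sets borel} \<subseteq> sets F"
      unfolding sp(2)[symmetric] by (rule sets.sigma_sets_subset) (auto intro!: measurable_sets[OF g])
    show "indep_set (sigma_sets (space M) {f -` A \<inter> space M | A. A \<in> sets borel})
      (sigma_sets (space M) {g -` A \<inter> space M | A. A \<in> sets borel})"
      using ind F G ev unfolding indep_sets2_eq by blast
  qed
  then have "indep_vars (\<lambda>_. borel) (case_bool f g) UNIV"
    unfolding indep_var_def by (rule indep_vars_cong[THEN iffD1, rotated -1]) (auto split: bool.split)
  then have "(\<integral>\<^sup>+\<omega>. (\<Prod>b\<in>UNIV. case_bool f g b \<omega>) \<partial>M) = (\<Prod>b\<in>UNIV. \<integral>\<^sup>+\<omega>. case_bool f g b \<omega> \<partial>M)"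
    by (intro indep_vars_nn_integral) auto
  then show ?thesis by (simp add: UNIV_bool mult.commute)
qed

section \<open>Poisson transforms and Wald's identity\<close>

lemma has_law_nn_integral:
  assumes "has_law M Z p"
  shows "(\<integral>\<^sup>+\<omega>. f (Z \<omega>) \<partial>M) = (\<Sum>n. ennreal (pmf p n) * f n)"
proof -
  have Z: "Z \<in> M \<rightarrow>\<^sub>M count_space UNIV" and d: "distr M (count_space UNIV) Z = measure_pmf p"
    using assms by (auto simp: has_law_def)
  have "(\<integral>\<^sup>+\<omega>. f (Z \<omega>) \<partial>M) = (\<integral>\<^sup>+x. f x \<partial>distr M (count_space UNIV) Z)"
    by (rule nn_integral_distr[symmetric, OF Z]) simp
  also have "\<dots> = (\<Sum>n. ennreal (pmf p n) * f n)"
    unfolding d nn_integral_measure_pmf by (simp add: nn_integral_count_space_nat)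
  finally show ?thesis .
qed

lemma pmf_Pois: "0 \<le> r \<Longrightarrow> pmf (Pois r) n = r ^ n / fact n * exp (- r)"
  by (cases "r = 0") (auto simp: Pois_def power_0_left)

lemma Pois_laplace:
  assumes law: "has_law M Z (Pois r)" and r: "0 \<le> r"
  shows "(\<integral>\<^sup>+\<omega>. ennreal (exp (- u * real (Z \<omega>))) \<partial>M) = ennreal (exp (- r * (1 - exp (- u))))"
proof -
  have "(\<lambda>n. (r * exp (- u)) ^ n /\<^sub>R fact n * exp (- r)) sums (exp (r * exp (- u)) * exp (- r))"
    by (intro sums_mult2 exp_converges)
  moreover have "(r * exp (- u)) ^ n /\<^sub>R fact n * exp (- r) = pmf (Pois r) n * exp (- u * real n)" for n
    by (simp add: pmf_Pois r power_mult_distrib exp_of_nat_mult[symmetric] field_simps)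
  moreover have "exp (r * exp (- u)) * exp (- r) = exp (- r * (1 - exp (- u)))"
    by (simp add: exp_add[symmetric] algebra_simps)
  ultimately have "(\<lambda>n. pmf (Pois r) n * exp (- u * real n)) sums exp (- r * (1 - exp (- u)))"
    by simp
  then have "(\<Sum>n. ennreal (pmf (Pois r) n * exp (- u * real n))) = ennreal (exp (- r * (1 - exp (- u))))"
    by (intro suminf_ennreal_eq) auto
  then show ?thesis
    unfolding has_law_nn_integral[OF law, where f = "\<lambda>n. ennreal (exp (- u * real n))"]
    by (simp add: ennreal_mult)
qed

lemma Pois_mean:
  assumes law: "has_law M Z (Pois r)" and r: "0 \<le> r"
  shows "(\<integral>\<^sup>+\<omega>. of_nat (Z \<omega>) \<partial>M) = ennreal r"
proof -
  have "(\<lambda>n. r ^ n /\<^sub>R fact n * (r * exp (- r))) sums (exp r * (r * exp (- r)))"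
    by (intro sums_mult2 exp_converges)
  moreover have "r ^ n /\<^sub>R fact n * (r * exp (- r)) = pmf (Pois r) (Suc n) * real (Suc n)" for n
  proof -
    have "pmf (Pois r) (Suc n) * real (Suc n) = r * r ^ n * exp (- r) * (real (Suc n) / (real (Suc n) * fact n))"
      unfolding pmf_Pois[OF r] fact_Suc by simp
    also have "real (Suc n) / (real (Suc n) * fact n) = 1 / fact n"
      by (rule nonzero_divide_mult_cancel_left) simp
    finally show ?thesis by (simp add: field_simps)
  qed
  moreover have "exp r * (r * exp (- r)) = r" by (simp add: exp_minus)
  ultimately have "(\<lambda>n. pmf (Pois r) (Suc n) * real (Suc n)) sums r" by simp
  then have "(\<lambda>n. pmf (Pois r) n * real n) sums r"
    by (subst (asm) sums_Suc_iff) simp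
  then have "(\<Sum>n. ennreal (pmf (Pois r) n * real n)) = ennreal r"
    by (intro suminf_ennreal_eq) auto
  then show ?thesis
    unfolding has_law_nn_integral[OF law, where f = of_nat]
    by (simp add: ennreal_mult ennreal_of_nat_eq_real_of_nat)
qed

text \<open>The bound of summation moves into an indicator. When \<open>n\<close> is random, each
  term becomes a counting variable times a function of \<open>n\<close>, and independence can be
  used termwise.\<close>

lemma of_nat_sum_as_suminf:
  fixes f :: "nat \<Rightarrow> nat"
  shows "(of_nat (\<Sum>l = 1..n. f l) :: ennreal) = (\<Sum>l. of_nat (f (Suc l)) * indicator {..<n} l)"
proof -
  have "(\<Sum>l. of_nat (f (Suc l)) * indicator {..<n} l) = (\<Sum>l\<in>{..<n}. of_nat (f (Suc l)) * indicator {..<n} l :: ennreal)"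
    by (rule suminf_finite) auto
  also have "\<dots> = (\<Sum>l\<in>{..<n}. of_nat (f (Suc l)))" by (intro sum.cong) auto
  also have "\<dots> = of_nat (\<Sum>l = 1..n. f l)"
    by (simp add: sum.atLeast1_atMost_eq)
  finally show ?thesis by simp
qed

lemma thinning_measurable [measurable (raw)]:
  assumes [measurable]: "\<And>l. 1 \<le> l \<Longrightarrow> \<zeta> l \<in> N \<rightarrow>\<^sub>M count_space UNIV" "Y \<in> N \<rightarrow>\<^sub>M count_space UNIV"
  shows "thinning \<zeta> Y \<in> N \<rightarrow>\<^sub>M count_space UNIV"
proof -
  have m: "(\<lambda>\<omega>. \<Sum>l = 1..n. \<zeta> l \<omega>) \<in> N \<rightarrow>\<^sub>M count_space UNIV" for n :: nat
  proof (induction n)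
    case (Suc n)
    have [measurable]: "\<zeta> (Suc n) \<in> N \<rightarrow>\<^sub>M count_space UNIV" by (rule assms) simp
    show ?case using Suc by simp measurable
  qed simp
  have "(\<lambda>\<omega>. (\<lambda>n \<omega>. \<Sum>l = 1..n. \<zeta> l \<omega>) (Y \<omega>) \<omega>) \<in> N \<rightarrow>\<^sub>M count_space UNIV"
    by (rule measurable_compose_countable[OF m assms(2)])
  then show ?thesis by (simp add: thinning_def[abs_def])
qed

text \<open>Wald's identity with a weight \<open>g\<close>: the indicator of \<open>l < Y\<close>
  times \<open>g\<close> is measurable in \<open>F\<close>, so it factors from the
  \<open>l\<close>-th counting variable.\<close>

lemma (in prob_space) thinning_nn_integral:
  fixes g :: "'a \<Rightarrow> ennreal"
  assumes ind: "indep_set (sets G) (sets F)" and sp: "space G = space M" "space F = space M"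
    and \<zeta>: "\<And>l. 1 \<le> l \<Longrightarrow> \<zeta> l \<in> G \<rightarrow>\<^sub>M count_space UNIV"
    and mean: "\<And>l. 1 \<le> l \<Longrightarrow> (\<integral>\<^sup>+\<omega>. of_nat (\<zeta> l \<omega>) \<partial>M) = a"
    and Y[measurable]: "Y \<in> F \<rightarrow>\<^sub>M count_space UNIV" and g[measurable]: "g \<in> borel_measurable F"
  shows "(\<integral>\<^sup>+\<omega>. of_nat (thinning \<zeta> Y \<omega>) * g \<omega> \<partial>M) = a * (\<integral>\<^sup>+\<omega>. of_nat (Y \<omega>) * g \<omega> \<partial>M)"
proof -
  have ev: "sets G \<subseteq> events" "sets F \<subseteq> events"
    using indep_setD_ev1[OF ind] indep_setD_ev2[OF ind] .
  have sub: "subalgebra M G" "subalgebra M F" using sp ev by (auto simp: subalgebra_def)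
  have zM[measurable]: "\<zeta> (Suc l) \<in> M \<rightarrow>\<^sub>M count_space UNIV" for l
    by (rule measurable_from_subalg[OF sub(1) \<zeta>]) simp
  have zG[measurable]: "\<zeta> (Suc l) \<in> G \<rightarrow>\<^sub>M count_space UNIV" for l
    by (rule \<zeta>) simp
  have YM[measurable]: "Y \<in> M \<rightarrow>\<^sub>M count_space UNIV" and gM[measurable]: "g \<in> borel_measurable M"
    using measurable_from_subalg[OF sub(2) Y] measurable_from_subalg[OF sub(2) g] .
  have hF[measurable]: "(\<lambda>\<omega>. indicator {..<Y \<omega>} l * g \<omega>) \<in> borel_measurable F" for l by measurable
  have hM[measurable]: "(\<lambda>\<omega>. indicator {..<Y \<omega>} l * g \<omega>) \<in> borel_measurable M" for l by measurable
  have "(\<integral>\<^sup>+\<omega>. of_nat (thinning \<zeta> Y \<omega>) * g \<omega> \<partial>M)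
      = (\<integral>\<^sup>+\<omega>. (\<Sum>l. of_nat (\<zeta> (Suc l) \<omega>) * (indicator {..<Y \<omega>} l * g \<omega>)) \<partial>M)"
    unfolding thinning_def of_nat_sum_as_suminf by (simp add: ennreal_suminf_multc[symmetric] mult.assoc)
  also have "\<dots> = (\<Sum>l. \<integral>\<^sup>+\<omega>. of_nat (\<zeta> (Suc l) \<omega>) * (indicator {..<Y \<omega>} l * g \<omega>) \<partial>M)"
    by (rule nn_integral_suminf) measurable
  also have "\<dots> = (\<Sum>l. a * (\<integral>\<^sup>+\<omega>. indicator {..<Y \<omega>} l * g \<omega> \<partial>M))"
    by (subst indep_set_nn_integral_mult[OF ind sp]) (auto simp: mean)
  also have "\<dots> = a * (\<Sum>l. \<integral>\<^sup>+\<omega>. indicator {..<Y \<omega>} l * g \<omega> \<partial>M)"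
    by (rule ennreal_suminf_cmult)
  also have "(\<Sum>l. \<integral>\<^sup>+\<omega>. indicator {..<Y \<omega>} l * g \<omega> \<partial>M) = (\<integral>\<^sup>+\<omega>. (\<Sum>l. indicator {..<Y \<omega>} l * g \<omega>) \<partial>M)"
    by (rule nn_integral_suminf[symmetric]) measurable
  also have "\<dots> = (\<integral>\<^sup>+\<omega>. of_nat (Y \<omega>) * g \<omega> \<partial>M)"
    using of_nat_sum_as_suminf[of "\<lambda>_. 1"] by (simp add: ennreal_suminf_multc)
  finally show ?thesis .
qed

text \<open>Substitute for conditioning on a discrete variable: on a level set of \<open>T\<close>
  everything determined by \<open>T\<close> can be treated as a constant.\<close>

lemma nn_integral_mono_on_levels:
  fixes T :: "'a \<Rightarrow> nat" and f g :: "'a \<Rightarrow> ennreal"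
  assumes T[measurable]: "T \<in> M \<rightarrow>\<^sub>M count_space UNIV"
    and [measurable]: "f \<in> borel_measurable M" "g \<in> borel_measurable M"
    and le: "\<And>i. (\<integral>\<^sup>+\<omega>. f \<omega> * indicator {i} (T \<omega>) \<partial>M) \<le> (\<integral>\<^sup>+\<omega>. g \<omega> * indicator {i} (T \<omega>) \<partial>M)"
  shows "(\<integral>\<^sup>+\<omega>. f \<omega> \<partial>M) \<le> (\<integral>\<^sup>+\<omega>. g \<omega> \<partial>M)"
proof -
  have split: "(\<integral>\<^sup>+\<omega>. h \<omega> \<partial>M) = (\<Sum>i. \<integral>\<^sup>+\<omega>. h \<omega> * indicator {i} (T \<omega>) \<partial>M)"
    if [measurable]: "h \<in> borel_measurable M" for h :: "'a \<Rightarrow> ennreal"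
  proof -
    have "(\<Sum>i. h \<omega> * indicator {i} (T \<omega>)) = (\<Sum>i\<in>{T \<omega>}. h \<omega> * indicator {i} (T \<omega>))" for \<omega>
      by (rule suminf_finite) auto
    then have "h \<omega> = (\<Sum>i. h \<omega> * indicator {i} (T \<omega>))" for \<omega> by simp
    then have "(\<integral>\<^sup>+\<omega>. h \<omega> \<partial>M) = (\<integral>\<^sup>+\<omega>. (\<Sum>i. h \<omega> * indicator {i} (T \<omega>)) \<partial>M)" by simp
    also have "\<dots> = (\<Sum>i. \<integral>\<^sup>+\<omega>. h \<omega> * indicator {i} (T \<omega>) \<partial>M)"
      by (rule nn_integral_suminf) (auto intro!: borel_measurable_times_ennreal measurable_compose[OF T])
    finally show ?thesis .
  qed
  show ?thesis unfolding split[OF assms(2)] split[OF assms(3)]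
    by (intro suminf_le le) auto
qed

section \<open>One-step mean and Laplace transform for the noise\<close>

locale inar = prob_space M for M :: "'a measure" +
  fixes \<alpha> :: "nat \<Rightarrow> real" and K :: real
    and \<epsilon> :: "int \<Rightarrow> 'a \<Rightarrow> nat" and \<xi> :: "int \<Rightarrow> nat \<Rightarrow> nat \<Rightarrow> 'a \<Rightarrow> nat"
  assumes \<alpha>_nonneg: "\<And>k. 0 \<le> \<alpha> k" and \<alpha>_sum: "(\<alpha> has_sum K) {1..}" and K_less: "K < 1"
    and inar_noise: "inar_noise M \<alpha> \<epsilon> \<xi>"
begin

definition noise_at :: "int \<Rightarrow> 'a measure" where
  "noise_at n = generated_algebra M (noise \<epsilon> \<xi>) (noise_indices_at n)"

abbreviation "all_indices \<equiv> (\<Union>n. noise_indices_at n)"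

lemma indep_noise: "indep_vars (\<lambda>_. count_space UNIV) (noise \<epsilon> \<xi>) all_indices"
  and law_eps: "has_law M (\<epsilon> n) (Pois (\<alpha> 0))"
  and law_xi: "1 \<le> k \<Longrightarrow> 1 \<le> l \<Longrightarrow> has_law M (\<xi> n k l) (Pois (\<alpha> k))"
  using inar_noise by (auto simp: inar_noise_def)

lemma space_noise_at [simp]: "space (noise_at n) = space M"
  by (simp add: noise_at_def)

lemma eps_noise_at: "\<epsilon> n \<in> noise_at n \<rightarrow>\<^sub>M count_space UNIV"
proof -
  have "noise \<epsilon> \<xi> (Inl n) \<in> noise_at n \<rightarrow>\<^sub>M count_space UNIV"
    unfolding noise_at_def by (rule measurable_generated_algebra) (simp add: noise_indices_at_def)
  then show ?thesis by (simp add: noise_def)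
qed

lemma xi_noise_at:
  assumes "1 \<le> k" "1 \<le> l"
  shows "\<xi> n k l \<in> noise_at n \<rightarrow>\<^sub>M count_space UNIV"
proof -
  have "noise \<epsilon> \<xi> (Inr (n, k, l)) \<in> noise_at n \<rightarrow>\<^sub>M count_space UNIV"
    unfolding noise_at_def by (rule measurable_generated_algebra) (use assms in \<open>simp add: noise_indices_at_def\<close>)
  then show ?thesis by (simp add: noise_def)
qed

lemma eps_rv [measurable]: "\<epsilon> n \<in> M \<rightarrow>\<^sub>M count_space UNIV"
  using law_eps by (simp add: has_law_def)

lemma xi_rv: "1 \<le> k \<Longrightarrow> 1 \<le> l \<Longrightarrow> \<xi> n k l \<in> M \<rightarrow>\<^sub>M count_space UNIV"
  using law_xi by (simp add: has_law_def)

text \<open>\<open>F\<close> and \<open>Y\<close> stay general because there are two uses: the past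
  of an arbitrary solution, and the past of the noise with truncated Picard iterates.\<close>

lemma one_step_mean:
  fixes g :: "'a \<Rightarrow> ennreal"
  assumes ind: "indep_set (sets (noise_at n)) (sets F)" and sp: "space F = space M"
    and Y: "\<And>k. 1 \<le> k \<Longrightarrow> Y k \<in> F \<rightarrow>\<^sub>M count_space UNIV" and g: "g \<in> borel_measurable F"
  shows "(\<integral>\<^sup>+\<omega>. (of_nat (\<epsilon> n \<omega>) + (\<Sum>k. of_nat (thinning (\<xi> n (Suc k)) (Y (Suc k)) \<omega>))) * g \<omega> \<partial>M)
    = (\<integral>\<^sup>+\<omega>. (ennreal (\<alpha> 0) + (\<Sum>k. ennreal (\<alpha> (Suc k)) * of_nat (Y (Suc k) \<omega>))) * g \<omega> \<partial>M)"
proof -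
  have sub: "subalgebra M F" using sp indep_setD_ev2[OF ind] by (auto simp: subalgebra_def)
  have gM[measurable]: "g \<in> borel_measurable M" by (rule measurable_from_subalg[OF sub g])
  have YF: "Y (Suc k) \<in> F \<rightarrow>\<^sub>M count_space UNIV" for k by (rule Y) simp
  have YM[measurable]: "Y (Suc k) \<in> M \<rightarrow>\<^sub>M count_space UNIV" for k
    by (rule measurable_from_subalg[OF sub YF])
  have TM[measurable]: "thinning (\<xi> n (Suc k)) (Y (Suc k)) \<in> M \<rightarrow>\<^sub>M count_space UNIV" for k
    by (rule thinning_measurable) (auto intro: xi_rv)
  have eps: "(\<integral>\<^sup>+\<omega>. of_nat (\<epsilon> n \<omega>) * g \<omega> \<partial>M) = (\<integral>\<^sup>+\<omega>. ennreal (\<alpha> 0) * g \<omega> \<partial>M)"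
  proof -
    have m: "(\<lambda>\<omega>. of_nat (\<epsilon> n \<omega>) :: ennreal) \<in> borel_measurable (noise_at n)"
      by (rule measurable_compose[OF eps_noise_at]) simp
    have "(\<integral>\<^sup>+\<omega>. of_nat (\<epsilon> n \<omega>) * g \<omega> \<partial>M) = ennreal (\<alpha> 0) * (\<integral>\<^sup>+\<omega>. g \<omega> \<partial>M)"
      by (subst indep_set_nn_integral_mult[OF ind _ sp m g])
         (simp_all add: Pois_mean[OF law_eps \<alpha>_nonneg])
    then show ?thesis by (simp add: nn_integral_cmult)
  qed
  have thin: "(\<integral>\<^sup>+\<omega>. of_nat (thinning (\<xi> n (Suc k)) (Y (Suc k)) \<omega>) * g \<omega> \<partial>M)
     = (\<integral>\<^sup>+\<omega>. ennreal (\<alpha> (Suc k)) * of_nat (Y (Suc k) \<omega>) * g \<omega> \<partial>M)" for k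
  proof -
    have "(\<integral>\<^sup>+\<omega>. of_nat (thinning (\<xi> n (Suc k)) (Y (Suc k)) \<omega>) * g \<omega> \<partial>M)
      = ennreal (\<alpha> (Suc k)) * (\<integral>\<^sup>+\<omega>. of_nat (Y (Suc k) \<omega>) * g \<omega> \<partial>M)"
      by (rule thinning_nn_integral[OF ind _ sp]) (auto intro!: xi_noise_at YF g Pois_mean[OF law_xi \<alpha>_nonneg])
    also have "\<dots> = (\<integral>\<^sup>+\<omega>. ennreal (\<alpha> (Suc k)) * (of_nat (Y (Suc k) \<omega>) * g \<omega>) \<partial>M)"
      by (rule nn_integral_cmult[symmetric]) measurable
    finally show ?thesis by (simp add: mult.assoc)
  qed
  have "(\<integral>\<^sup>+\<omega>. (of_nat (\<epsilon> n \<omega>) + (\<Sum>k. of_nat (thinning (\<xi> n (Suc k)) (Y (Suc k)) \<omega>))) * g \<omega> \<partial>M)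
    = (\<integral>\<^sup>+\<omega>. of_nat (\<epsilon> n \<omega>) * g \<omega> + (\<Sum>k. of_nat (thinning (\<xi> n (Suc k)) (Y (Suc k)) \<omega>) * g \<omega>) \<partial>M)"
    by (simp add: distrib_right ennreal_suminf_multc)
  also have "\<dots> = (\<integral>\<^sup>+\<omega>. of_nat (\<epsilon> n \<omega>) * g \<omega> \<partial>M)
      + (\<Sum>k. \<integral>\<^sup>+\<omega>. of_nat (thinning (\<xi> n (Suc k)) (Y (Suc k)) \<omega>) * g \<omega> \<partial>M)"
    by (subst nn_integral_add) (auto simp: nn_integral_suminf simp del: ennreal_suminf_multc)
  also have "\<dots> = (\<integral>\<^sup>+\<omega>. ennreal (\<alpha> 0) * g \<omega> \<partial>M)
      + (\<Sum>k. \<integral>\<^sup>+\<omega>. ennreal (\<alpha> (Suc k)) * of_nat (Y (Suc k) \<omega>) * g \<omega> \<partial>M)"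
    by (simp only: eps thin)
  also have "\<dots> = (\<integral>\<^sup>+\<omega>. ennreal (\<alpha> 0) * g \<omega> + (\<Sum>k. ennreal (\<alpha> (Suc k)) * of_nat (Y (Suc k) \<omega>) * g \<omega>) \<partial>M)"
    by (subst nn_integral_add) (auto simp: nn_integral_suminf simp del: ennreal_suminf_multc)
  finally show ?thesis by (simp add: distrib_right ennreal_suminf_multc)
qed

text \<open>With deterministic numbers \<open>x k\<close> of summands the exponential is a finite
  product of independent factors, one for each pair \<open>(k, l)\<close>.\<close>

lemma thinnings_laplace:
  "(\<integral>\<^sup>+\<omega>. ennreal (exp (- u * (\<Sum>k = 1..p. real (\<Sum>l = 1..x k. \<xi> n k l \<omega>)))) \<partial>M)
    = ennreal (exp (- (1 - exp (- u)) * (\<Sum>k = 1..p. \<alpha> k * real (x k))))"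
proof -
  let ?J = "SIGMA k:{1..p}. {1..x k}" and ?e = "\<lambda>(k, l). Inr (n, k, l) :: noise_index"
  let ?h = "\<lambda>m. ennreal (exp (- u * real m))"
  have inj: "inj_on ?e ?J" by (auto simp: inj_on_def)
  have sub: "?e ` ?J \<subseteq> all_indices" unfolding noise_indices_at_def by force
  have "indep_vars (\<lambda>_. count_space UNIV) (noise \<epsilon> \<xi>) (?e ` ?J)"
    by (rule indep_vars_subset[OF indep_noise sub])
  then have ind: "indep_vars (\<lambda>_. borel) (\<lambda>i \<omega>. ?h (noise \<epsilon> \<xi> i \<omega>)) (?e ` ?J)"
    by (rule indep_vars_compose2) simp
  have "ennreal (exp (- u * (\<Sum>k = 1..p. real (\<Sum>l = 1..x k. \<xi> n k l \<omega>))))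
      = (\<Prod>i\<in>?e ` ?J. ?h (noise \<epsilon> \<xi> i \<omega>))" for \<omega>
  proof -
    have "(\<Sum>k = 1..p. real (\<Sum>l = 1..x k. \<xi> n k l \<omega>)) = (\<Sum>(k, l)\<in>?J. real (\<xi> n k l \<omega>))"
      by (simp add: sum.Sigma)
    then have "exp (- u * (\<Sum>k = 1..p. real (\<Sum>l = 1..x k. \<xi> n k l \<omega>)))
       = (\<Prod>(k, l)\<in>?J. exp (- u * real (\<xi> n k l \<omega>)))"
      by (simp add: sum_distrib_left exp_sum case_prod_unfold)
    then show ?thesis
      unfolding prod.reindex[OF inj] by (simp add: prod_ennreal case_prod_unfold noise_def)
  qed
  then have "(\<integral>\<^sup>+\<omega>. ennreal (exp (- u * (\<Sum>k = 1..p. real (\<Sum>l = 1..x k. \<xi> n k l \<omega>)))) \<partial>M)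
    = (\<integral>\<^sup>+\<omega>. (\<Prod>i\<in>?e ` ?J. ?h (noise \<epsilon> \<xi> i \<omega>)) \<partial>M)" by simp
  also have "\<dots> = (\<Prod>i\<in>?e ` ?J. \<integral>\<^sup>+\<omega>. ?h (noise \<epsilon> \<xi> i \<omega>) \<partial>M)"
    by (rule indep_vars_nn_integral[OF _ ind]) auto
  also have "\<dots> = (\<Prod>(k, l)\<in>?J. ennreal (exp (- \<alpha> k * (1 - exp (- u)))))"
    unfolding prod.reindex[OF inj]
    by (intro prod.cong refl) (auto simp: noise_def intro!: Pois_laplace[OF law_xi \<alpha>_nonneg, simplified])
  also have "\<dots> = (\<Prod>k = 1..p. \<Prod>l = 1..x k. ennreal (exp (- \<alpha> k * (1 - exp (- u)))))"
    by (rule prod.Sigma[symmetric]) auto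
  also have "\<dots> = (\<Prod>k = 1..p. ennreal (exp (- (1 - exp (- u)) * (\<alpha> k * real (x k)))))"
    by (intro prod.cong refl) (simp add: ennreal_power exp_of_nat_mult[symmetric] algebra_simps)
  also have "\<dots> = ennreal (exp (- (1 - exp (- u)) * (\<Sum>k = 1..p. \<alpha> k * real (x k))))"
    by (simp add: prod_ennreal exp_sum sum_distrib_left)
  finally show ?thesis .
qed

text \<open>On each level set of the history the random numbers \<open>Y k\<close> are constants,
  and \<open>thinnings_laplace\<close> together with independence from \<open>F\<close>
  applies.\<close>

lemma one_step_laplace:
  fixes g :: "'a \<Rightarrow> ennreal"
  assumes ind: "indep_set (sets (noise_at n)) (sets F)" and sp: "space F = space M"
    and Y: "\<And>k. 1 \<le> k \<Longrightarrow> Y k \<in> F \<rightarrow>\<^sub>M count_space UNIV" and g: "g \<in> borel_measurable F"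
  shows "(\<integral>\<^sup>+\<omega>. ennreal (exp (- u * (\<Sum>k = 1..p. real (thinning (\<xi> n k) (Y k) \<omega>)))) * g \<omega> \<partial>M)
    \<le> (\<integral>\<^sup>+\<omega>. ennreal (exp (- (1 - exp (- u)) * (\<Sum>k = 1..p. \<alpha> k * real (Y k \<omega>)))) * g \<omega> \<partial>M)"
proof -
  \<comment> \<open>The history \<open>Y 1, ..., Y p\<close> is coded as one natural number, so that
    its level sets are a countable partition measurable in \<open>F\<close>.\<close>
  define T where "T \<omega> = to_nat (map (\<lambda>k. Y k \<omega>) [1..<Suc p])" for \<omega>
  have sub: "subalgebra M F" using sp indep_setD_ev2[OF ind] by (auto simp: subalgebra_def)
  have gM[measurable]: "g \<in> borel_measurable M" by (rule measurable_from_subalg[OF sub g])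
  have YM: "Y k \<in> M \<rightarrow>\<^sub>M count_space UNIV" if "1 \<le> k" for k
    by (rule measurable_from_subalg[OF sub Y[OF that]])
  have TF: "T \<in> F \<rightarrow>\<^sub>M count_space UNIV"
  proof -
    have "(\<lambda>\<omega>. map (\<lambda>k. Y k \<omega>) ks) \<in> F \<rightarrow>\<^sub>M count_space UNIV" if "\<forall>k\<in>set ks. 1 \<le> k" for ks
      using that
    proof (induction ks)
      case (Cons k ks)
      have m: "Y k \<in> F \<rightarrow>\<^sub>M count_space UNIV"
        "(\<lambda>\<omega>. map (\<lambda>k. Y k \<omega>) ks) \<in> F \<rightarrow>\<^sub>M count_space UNIV"
        using Cons Y by auto
      have "(\<lambda>\<omega>. Y k \<omega> # xs) \<in> F \<rightarrow>\<^sub>M count_space UNIV" for xs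
        by (rule measurable_compose[OF m(1)]) simp
      from measurable_compose_countable[OF this m(2)] show ?case by simp
    qed simp
    from this[of "[1..<Suc p]"] show ?thesis
      unfolding T_def by (rule measurable_compose) auto
  qed
  have TM[measurable]: "T \<in> M \<rightarrow>\<^sub>M count_space UNIV"
    by (rule measurable_from_subalg[OF sub TF])
  have thin[measurable]: "(\<lambda>\<omega>. \<Sum>k = 1..p. real (thinning (\<xi> n k) (Y k) \<omega>)) \<in> borel_measurable M"
  proof (rule borel_measurable_sum)
    fix k assume "k \<in> {1..p}"
    then have "thinning (\<xi> n k) (Y k) \<in> M \<rightarrow>\<^sub>M count_space UNIV"
      by (intro thinning_measurable xi_rv YM) auto
    then show "(\<lambda>\<omega>. real (thinning (\<xi> n k) (Y k) \<omega>)) \<in> borel_measurable M"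
      by (rule measurable_compose) simp
  qed
  have lin[measurable]: "(\<lambda>\<omega>. \<Sum>k = 1..p. \<alpha> k * real (Y k \<omega>)) \<in> borel_measurable M"
  proof (rule borel_measurable_sum)
    fix k assume "k \<in> {1..p}"
    then have "Y k \<in> M \<rightarrow>\<^sub>M count_space UNIV" by (intro YM) auto
    then show "(\<lambda>\<omega>. \<alpha> k * real (Y k \<omega>)) \<in> borel_measurable M"
      by (rule measurable_compose) simp
  qed
  show ?thesis
  proof (rule nn_integral_mono_on_levels[OF TM])
    fix i
    define xs :: "nat list" where "xs = from_nat i"
    \<comment> \<open>The decoded list starts with \<open>Y 1\<close>, hence the shift of the
      index.\<close>
    define x where "x k = xs ! (k - 1)" for k
    have Tx: "Y k \<omega> = x k" if "T \<omega> = i" "k \<in> {1..p}" for k \<omega>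
    proof -
      have "xs = map (\<lambda>k. Y k \<omega>) [1..<Suc p]" using that(1) unfolding T_def xs_def by auto
      then show ?thesis unfolding x_def using that(2) by (auto simp: nth_append simp del: upt_Suc)
    qed
    let ?E = "\<lambda>\<omega>. ennreal (exp (- u * (\<Sum>k = 1..p. real (\<Sum>l = 1..x k. \<xi> n k l \<omega>))))"
    let ?c = "ennreal (exp (- (1 - exp (- u)) * (\<Sum>k = 1..p. \<alpha> k * real (x k))))"
    have EG: "?E \<in> borel_measurable (noise_at n)"
    proof -
      have "(\<lambda>\<omega>. \<Sum>k = 1..p. real (\<Sum>l = 1..x k. \<xi> n k l \<omega>)) \<in> borel_measurable (noise_at n)"
        unfolding of_nat_sum
        by (intro borel_measurable_sum measurable_compose[OF xi_noise_at]) auto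
      then show ?thesis by measurable
    qed
    have "(\<integral>\<^sup>+\<omega>. ennreal (exp (- u * (\<Sum>k = 1..p. real (thinning (\<xi> n k) (Y k) \<omega>)))) * g \<omega>
         * indicator {i} (T \<omega>) \<partial>M) = (\<integral>\<^sup>+\<omega>. ?E \<omega> * (g \<omega> * indicator {i} (T \<omega>)) \<partial>M)"
      by (intro nn_integral_cong) (auto simp: indicator_def thinning_def Tx simp del: of_nat_sum)
    also have "\<dots> = (\<integral>\<^sup>+\<omega>. ?E \<omega> \<partial>M) * (\<integral>\<^sup>+\<omega>. g \<omega> * indicator {i} (T \<omega>) \<partial>M)"
      by (rule indep_set_nn_integral_mult[OF ind _ sp EG])
         (auto intro!: borel_measurable_times_ennreal g measurable_compose[OF TF])
    also have "(\<integral>\<^sup>+\<omega>. ?E \<omega> \<partial>M) = ?c" by (rule thinnings_laplace)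
    also have "?c * (\<integral>\<^sup>+\<omega>. g \<omega> * indicator {i} (T \<omega>) \<partial>M)
       = (\<integral>\<^sup>+\<omega>. ?c * (g \<omega> * indicator {i} (T \<omega>)) \<partial>M)"
      by (rule nn_integral_cmult[symmetric])
         (auto intro!: borel_measurable_times_ennreal measurable_compose[OF TM])
    also have "\<dots> = (\<integral>\<^sup>+\<omega>. ennreal (exp (- (1 - exp (- u)) * (\<Sum>k = 1..p. \<alpha> k * real (Y k \<omega>)))) * g \<omega>
         * indicator {i} (T \<omega>) \<partial>M)"
      by (intro nn_integral_cong) (auto simp: indicator_def Tx)
    finally show "(\<integral>\<^sup>+\<omega>. ennreal (exp (- u * (\<Sum>k = 1..p. real (thinning (\<xi> n k) (Y k) \<omega>)))) * g \<omega>
         * indicator {i} (T \<omega>) \<partial>M)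
      \<le> (\<integral>\<^sup>+\<omega>. ennreal (exp (- (1 - exp (- u)) * (\<Sum>k = 1..p. \<alpha> k * real (Y k \<omega>)))) * g \<omega>
         * indicator {i} (T \<omega>) \<partial>M)" by simp
  qed measurable
qed

end

section \<open>Predictions from the distant past\<close>

text \<open>The coefficient of the value at lag \<open>m\<close> after the values at the lags below
  \<open>n\<close> have been replaced by their conditional means: a direct transition from lag
  \<open>m\<close> to a lag \<open>i < n\<close>, followed by any chain of transitions to lag
  \<open>0\<close>. It is meaningful for \<open>m \<ge> n\<close>; there \<open>m - i\<close> is a
  genuine positive lag and never hits \<open>\<alpha> 0\<close>.\<close>

definition renewal_weight :: "(nat \<Rightarrow> real) \<Rightarrow> nat \<Rightarrow> nat \<Rightarrow> real" where
  "renewal_weight \<alpha> n m = (if m = 0 then 1 else 0) + (\<Sum>i<n. \<alpha> (m - i) * renewal \<alpha> i)"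

lemma renewal_weight_diag: "renewal_weight \<alpha> n n = renewal \<alpha> n"
  by (subst renewal.simps) (simp add: renewal_weight_def)

lemma renewal_weight_Suc: "renewal_weight \<alpha> (Suc n) m = renewal_weight \<alpha> n m + \<alpha> (m - n) * renewal \<alpha> n"
  by (simp add: renewal_weight_def)

section \<open>Conditional means and Laplace bounds along an arbitrary solution\<close>

locale inar_process = inar +
  fixes X :: "int \<Rightarrow> 'a \<Rightarrow> nat"
  assumes X_solution: "inar_solution M \<epsilon> \<xi> X"
begin

definition past :: "int \<Rightarrow> 'a measure" where
  "past n = generated_algebra M X {..<n}"

lemma space_past [simp]: "space (past n) = space M"
  by (simp add: past_def)

lemma X_rv [measurable]: "X n \<in> M \<rightarrow>\<^sub>M count_space UNIV"
  using X_solution by (simp add: inar_solution_def)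

lemma subalgebra_past: "subalgebra M (past n)"
  unfolding past_def by (rule generated_algebra_least) auto

lemma past_mono: "m \<le> n \<Longrightarrow> subalgebra (past n) (past m)"
  unfolding past_def by (rule generated_algebra_mono) auto

lemma X_past: "m < n \<Longrightarrow> X m \<in> past n \<rightarrow>\<^sub>M count_space UNIV"
  unfolding past_def by (rule measurable_generated_algebra) simp

lemma indep_noise_past: "indep_set (sets (noise_at n)) (sets (past n))"
  using X_solution by (simp add: inar_solution_def noise_at_def past_def sets_generated_algebra)

lemma past_measurable_M: "f \<in> borel_measurable (past n) \<Longrightarrow> f \<in> borel_measurable M"
  by (rule measurable_from_subalg[OF subalgebra_past])

lemma thinning_X_rv [measurable]: "thinning (\<xi> n (Suc k)) (X m) \<in> M \<rightarrow>\<^sub>M count_space UNIV"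
  by (rule thinning_measurable) (auto intro: xi_rv)

text \<open>The additive form in \<open>ennreal\<close>: the series can be integrated termwise
  without summability conditions, and one null set serves all times.\<close>

lemma equation:
  "AE \<omega> in M. \<forall>n. (of_nat (X n \<omega>) :: ennreal) =
     of_nat (\<epsilon> n \<omega>) + (\<Sum>k. of_nat (thinning (\<xi> n (Suc k)) (X (n - int (Suc k))) \<omega>))"
proof -
  have "AE \<omega> in M. \<forall>n. (\<lambda>k. real (thinning (\<xi> n k) (X (n - int k)) \<omega>)) summable_on {1..} \<and>
      real (\<epsilon> n \<omega>) = real (X n \<omega>) - (\<Sum>\<^sub>\<infinity>k\<in>{1..}. real (thinning (\<xi> n k) (X (n - int k)) \<omega>))"
    using X_solution by (simp add: inar_solution_def)
  then show ?thesis
  proof (eventually_elim, intro allI)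
    case (elim \<omega>)
    fix n
    let ?t = "\<lambda>k. real (thinning (\<xi> n k) (X (n - int k)) \<omega>)"
    let ?s = "\<Sum>\<^sub>\<infinity>k\<in>{1..}. ?t k"
    have sm: "?t summable_on {1..}" and eq: "real (X n \<omega>) = real (\<epsilon> n \<omega>) + ?s" using elim[rule_format, of n] by auto
    have "((\<lambda>k. ?t (Suc k)) has_sum ?s) UNIV" using has_sum_infsum[OF sm] has_sum_Suc_iff[of ?t ?s] by simp
    then have "(\<lambda>k. ?t (Suc k)) sums ?s" by (rule has_sum_imp_sums)
    then have "(\<Sum>k. ennreal (?t (Suc k))) = ennreal ?s"
      by (intro suminf_ennreal_eq) auto
    moreover have "ennreal (real (X n \<omega>)) = ennreal (real (\<epsilon> n \<omega>)) + ennreal ?s"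
      unfolding eq by (rule ennreal_plus) (auto intro!: infsum_nonneg)
    ultimately show "(of_nat (X n \<omega>) :: ennreal) =
       of_nat (\<epsilon> n \<omega>) + (\<Sum>k. of_nat (thinning (\<xi> n (Suc k)) (X (n - int (Suc k))) \<omega>))"
      by (simp add: ennreal_of_nat_eq_real_of_nat)
  qed
qed

definition intensity :: "int \<Rightarrow> 'a \<Rightarrow> ennreal" where
  "intensity n \<omega> = ennreal (\<alpha> 0) + (\<Sum>k. ennreal (\<alpha> (Suc k)) * of_nat (X (n - int (Suc k)) \<omega>))"

lemma mean_step:
  fixes g :: "'a \<Rightarrow> ennreal"
  assumes g: "g \<in> borel_measurable (past n)"
  shows "(\<integral>\<^sup>+\<omega>. of_nat (X n \<omega>) * g \<omega> \<partial>M) = (\<integral>\<^sup>+\<omega>. intensity n \<omega> * g \<omega> \<partial>M)"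
proof -
  have "(\<integral>\<^sup>+\<omega>. of_nat (X n \<omega>) * g \<omega> \<partial>M) = (\<integral>\<^sup>+\<omega>. (of_nat (\<epsilon> n \<omega>) +
      (\<Sum>k. of_nat (thinning (\<xi> n (Suc k)) (X (n - int (Suc k))) \<omega>))) * g \<omega> \<partial>M)"
    by (intro nn_integral_cong_AE, use equation in eventually_elim) auto
  also have "\<dots> = (\<integral>\<^sup>+\<omega>. intensity n \<omega> * g \<omega> \<partial>M)"
    unfolding intensity_def
    by (rule one_step_mean[OF indep_noise_past, where Y = "\<lambda>k. X (n - int k)"]) (auto intro: X_past g)
  finally show ?thesis .
qed

text \<open>Dropping the immigration and all lags beyond \<open>p\<close> only lowers
  \<open>X n\<close>, hence raises the exponential; what remains are finitely many
  thinnings.\<close>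

lemma laplace_step:
  fixes g :: "'a \<Rightarrow> ennreal"
  assumes u: "0 \<le> u" and g: "g \<in> borel_measurable (past n)"
  shows "(\<integral>\<^sup>+\<omega>. ennreal (exp (- u * real (X n \<omega>))) * g \<omega> \<partial>M)
    \<le> (\<integral>\<^sup>+\<omega>. ennreal (exp (- (1 - exp (- u)) * (\<Sum>k = 1..p. \<alpha> k * real (X (n - int k) \<omega>)))) * g \<omega> \<partial>M)"
proof -
  have "(\<integral>\<^sup>+\<omega>. ennreal (exp (- u * real (X n \<omega>))) * g \<omega> \<partial>M)
    \<le> (\<integral>\<^sup>+\<omega>. ennreal (exp (- u * (\<Sum>k = 1..p. real (thinning (\<xi> n k) (X (n - int k)) \<omega>)))) * g \<omega> \<partial>M)"
  proof (intro nn_integral_mono_AE, use equation in eventually_elim)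
    case (elim \<omega>)
    let ?t = "\<lambda>k. thinning (\<xi> n k) (X (n - int k)) \<omega>"
    have "(of_nat (\<Sum>k = 1..p. ?t k) :: ennreal) = (\<Sum>k<p. of_nat (?t (Suc k)))"
      by (simp add: sum.atLeast1_atMost_eq)
    also have "\<dots> \<le> (\<Sum>k. of_nat (?t (Suc k)))" by (rule sum_le_suminf) auto
    also have "\<dots> \<le> of_nat (X n \<omega>)" using elim[rule_format, of n] by simp
    finally have "(\<Sum>k = 1..p. ?t k) \<le> X n \<omega>" by (simp only: of_nat_le_iff)
    then have "(\<Sum>k = 1..p. real (?t k)) \<le> real (X n \<omega>)" by (simp flip: of_nat_sum)
    then have "exp (- u * real (X n \<omega>)) \<le> exp (- u * (\<Sum>k = 1..p. real (?t k)))"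
      using u by (simp add: mult_left_mono)
    then show ?case by (intro mult_right_mono ennreal_leI) auto
  qed
  also have "\<dots> \<le> (\<integral>\<^sup>+\<omega>. ennreal (exp (- (1 - exp (- u)) * (\<Sum>k = 1..p. \<alpha> k * real (X (n - int k) \<omega>)))) * g \<omega> \<partial>M)"
    by (rule one_step_laplace[OF indep_noise_past, where Y = "\<lambda>k. X (n - int k)"]) (auto intro: X_past g)
  finally show ?thesis .
qed

text \<open>Up to the immigration term, \<open>predictor r n\<close> is the conditional expectation of \<open>X r\<close> given the values
  up to time \<open>r - n\<close>.\<close>

definition predictor :: "int \<Rightarrow> nat \<Rightarrow> 'a \<Rightarrow> ennreal" where
  "predictor r n \<omega> = (\<Sum>j. ennreal (renewal_weight \<alpha> n (n + j)) * of_nat (X (r - int (n + j)) \<omega>))"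

lemma renewal_weight_nonneg: "0 \<le> renewal_weight \<alpha> n m"
  unfolding renewal_weight_def
  by (intro add_nonneg_nonneg sum_nonneg mult_nonneg_nonneg \<alpha>_nonneg renewal_nonneg) auto

lemma of_nat_X_past: "m < n \<Longrightarrow> (\<lambda>\<omega>. of_nat (X m \<omega>) :: ennreal) \<in> borel_measurable (past n)"
  by (rule measurable_compose[OF X_past]) simp_all

text \<open>\<open>past\<close> is strict, so the values up to time \<open>r - n\<close> belong to
  index \<open>r - n + 1\<close>.\<close>

lemma predictor_past: "predictor r n \<in> borel_measurable (past (r - int n + 1))"
  unfolding predictor_def[abs_def]
  by (intro borel_measurable_suminf_order borel_measurable_times_ennreal borel_measurable_const of_nat_X_past) auto

lemma predictor_measurable [measurable]: "predictor r n \<in> borel_measurable M"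
  by (rule past_measurable_M[OF predictor_past])

text \<open>Each step replaces the most recent value \<open>X (r - n)\<close>, whose weight is
  \<open>renewal \<alpha> n\<close>, by its intensity. This adds
  \<open>\<alpha> 0 * renewal \<alpha> n\<close> to the immigration and
  \<open>\<alpha> k * renewal \<alpha> n\<close> to the weight of the value \<open>k\<close> steps
  earlier.\<close>

lemma predictor_mean:
  fixes g :: "'a \<Rightarrow> ennreal"
  assumes g: "g \<in> borel_measurable (past (r - int n + 1))"
  shows "(\<integral>\<^sup>+\<omega>. of_nat (X r \<omega>) * g \<omega> \<partial>M)
    = (\<integral>\<^sup>+\<omega>. (ennreal (\<alpha> 0 * (\<Sum>i<n. renewal \<alpha> i)) + predictor r n \<omega>) * g \<omega> \<partial>M)"
  using g
proof (induction n arbitrary: g)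
  case 0
  have "predictor r 0 \<omega> = of_nat (X r \<omega>)" for \<omega>
  proof -
    have "predictor r 0 \<omega> = (\<Sum>j\<in>{0}. ennreal (renewal_weight \<alpha> 0 (0 + j)) * of_nat (X (r - int (0 + j)) \<omega>))"
      unfolding predictor_def by (rule suminf_finite) (auto simp: renewal_weight_def)
    then show ?thesis by (simp add: renewal_weight_def)
  qed
  then show ?case by simp
next
  case (Suc n)
  let ?G = "renewal \<alpha> n" and ?S = "\<Sum>i<n. renewal \<alpha> i"
  have G: "0 \<le> ?G" by (rule renewal_nonneg[OF \<alpha>_nonneg])
  have S: "0 \<le> ?S" by (intro sum_nonneg renewal_nonneg \<alpha>_nonneg)
  have gn: "g \<in> borel_measurable (past (r - int n))" using Suc.prems by (simp add: algebra_simps)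
  have [measurable]: "g \<in> borel_measurable M" by (rule past_measurable_M[OF gn])
  \<comment> \<open>The part of the prediction that the replacement of \<open>X (r - n)\<close>
    leaves untouched.\<close>
  define R where "R \<omega> = (\<Sum>j. ennreal (renewal_weight \<alpha> n (n + Suc j)) * of_nat (X (r - int (n + Suc j)) \<omega>))" for \<omega>
  have [measurable]: "R \<in> borel_measurable M" unfolding R_def[abs_def] by measurable
  have [measurable]: "intensity m \<in> borel_measurable M" for m unfolding intensity_def[abs_def] by measurable
  have split: "predictor r n \<omega> = ennreal ?G * of_nat (X (r - int n) \<omega>) + R \<omega>" for \<omega>
    unfolding predictor_def R_def
    by (subst suminf_offset[where i = 1]) (auto simp: renewal_weight_diag add.commute)
  have next_eq: "ennreal (\<alpha> 0 * (\<Sum>i<Suc n. renewal \<alpha> i)) + predictor r (Suc n) \<omega>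
     = ennreal ?G * intensity (r - int n) \<omega> + (ennreal (\<alpha> 0 * ?S) + R \<omega>)" for \<omega>
  proof -
    have "predictor r (Suc n) \<omega> = (\<Sum>j. ennreal ?G * (ennreal (\<alpha> (Suc j)) * of_nat (X (r - int n - int (Suc j)) \<omega>))
        + ennreal (renewal_weight \<alpha> n (n + Suc j)) * of_nat (X (r - int (n + Suc j)) \<omega>))"
      unfolding predictor_def
    proof (intro arg_cong[where f = suminf] ext)
      fix j
      have "ennreal (renewal_weight \<alpha> (Suc n) (Suc n + j))
         = ennreal (renewal_weight \<alpha> n (n + Suc j)) + ennreal ?G * ennreal (\<alpha> (Suc j))"
        using G \<alpha>_nonneg renewal_weight_nonneg
        by (simp add: renewal_weight_Suc ennreal_mult[symmetric] mult.commute)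
      moreover have "r - int (Suc n + j) = r - int n - int (Suc j)" "r - int (n + Suc j) = r - int n - int (Suc j)"
        by auto
      ultimately show "ennreal (renewal_weight \<alpha> (Suc n) (Suc n + j)) * of_nat (X (r - int (Suc n + j)) \<omega>)
        = ennreal ?G * (ennreal (\<alpha> (Suc j)) * of_nat (X (r - int n - int (Suc j)) \<omega>))
        + ennreal (renewal_weight \<alpha> n (n + Suc j)) * of_nat (X (r - int (n + Suc j)) \<omega>)"
        by (simp only: distrib_right mult.assoc add.commute)
    qed
    also have "\<dots> = ennreal ?G * (\<Sum>j. ennreal (\<alpha> (Suc j)) * of_nat (X (r - int n - int (Suc j)) \<omega>)) + R \<omega>"
      unfolding R_def by (subst suminf_add[symmetric]) (auto simp: ennreal_suminf_cmult)
    finally have P: "predictor r (Suc n) \<omega> = ennreal ?G * (\<Sum>j. ennreal (\<alpha> (Suc j)) * of_nat (X (r - int n - int (Suc j)) \<omega>)) + R \<omega>" .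
    have "ennreal (\<alpha> 0 * (\<Sum>i<Suc n. renewal \<alpha> i)) = ennreal (\<alpha> 0 * ?S) + ennreal ?G * ennreal (\<alpha> 0)"
      using G S \<alpha>_nonneg[of 0] by (simp add: distrib_left ennreal_mult[symmetric] mult.commute)
    then show ?thesis unfolding P intensity_def by (simp only: distrib_left ac_simps)
  qed
  have "(\<integral>\<^sup>+\<omega>. of_nat (X r \<omega>) * g \<omega> \<partial>M) = (\<integral>\<^sup>+\<omega>. (ennreal (\<alpha> 0 * ?S) + predictor r n \<omega>) * g \<omega> \<partial>M)"
    by (rule Suc.IH) (rule measurable_from_subalg[OF past_mono gn], simp)
  also have "\<dots> = (\<integral>\<^sup>+\<omega>. ennreal ?G * (of_nat (X (r - int n) \<omega>) * g \<omega>) + (ennreal (\<alpha> 0 * ?S) + R \<omega>) * g \<omega> \<partial>M)"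
    by (simp add: split distrib_right mult.assoc add.left_commute)
  also have "\<dots> = ennreal ?G * (\<integral>\<^sup>+\<omega>. of_nat (X (r - int n) \<omega>) * g \<omega> \<partial>M) + (\<integral>\<^sup>+\<omega>. (ennreal (\<alpha> 0 * ?S) + R \<omega>) * g \<omega> \<partial>M)"
    by (subst nn_integral_add) (auto simp: nn_integral_cmult)
  also have "\<dots> = ennreal ?G * (\<integral>\<^sup>+\<omega>. intensity (r - int n) \<omega> * g \<omega> \<partial>M) + (\<integral>\<^sup>+\<omega>. (ennreal (\<alpha> 0 * ?S) + R \<omega>) * g \<omega> \<partial>M)"
    by (simp only: mean_step[OF gn])
  also have "\<dots> = (\<integral>\<^sup>+\<omega>. ennreal ?G * (intensity (r - int n) \<omega> * g \<omega>) + (ennreal (\<alpha> 0 * ?S) + R \<omega>) * g \<omega> \<partial>M)"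
    by (subst nn_integral_add) (auto simp: nn_integral_cmult)
  also have "\<dots> = (\<integral>\<^sup>+\<omega>. (ennreal (\<alpha> 0 * (\<Sum>i<Suc n. renewal \<alpha> i)) + predictor r (Suc n) \<omega>) * g \<omega> \<partial>M)"
    by (simp only: next_eq distrib_right mult.assoc)
  finally show ?case .
qed

lemma partial_sums_le: "(\<Sum>k = 1..N. \<alpha> k) \<le> K"
proof -
  have "(\<alpha> has_sum (\<Sum>k = 1..N. \<alpha> k)) {1..N}" by (rule has_sum_finite) simp
  then show ?thesis by (rule has_sum_mono_neutral[OF _ \<alpha>_sum]) (auto simp: \<alpha>_nonneg)
qed

text \<open>\<open>laplace_step\<close> is applied successively at the times
  \<open>r, r - 1, ..., r - n + 1\<close>; afterwards \<open>exponent_weight_ge\<close> replaces the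
  nonlinear weights by half of the linear ones. \<open>P\<close> cuts off the remote past, so that
  all sums stay finite.\<close>

lemma laplace_predictor:
  assumes s: "0 \<le> s" "s \<le> 1 - K" and n: "1 \<le> n" "n \<le> Suc P"
  shows "(\<integral>\<^sup>+\<omega>. ennreal (exp (- s * real (X r \<omega>))) \<partial>M)
    \<le> (\<integral>\<^sup>+\<omega>. ennreal (exp (- (s / 2) * (\<Sum>m = n..P. renewal_weight \<alpha> n m * real (X (r - int m) \<omega>)))) \<partial>M)"
proof -
  \<comment> \<open>The nonlinear counterpart of \<open>renewal_weight\<close>: the coefficient of
    \<open>X (r - m)\<close> in the exponent after \<open>n\<close> steps. Its diagonal entry
    produces the next \<open>exponent_weight\<close>.\<close>
  define V where "V n m = (if m = 0 then s else 0) + (\<Sum>i<n. \<alpha> (m - i) * exponent_weight \<alpha> s i)" for n m :: nat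
  have V_diag: "1 - exp (- V n n) = exponent_weight \<alpha> s n" for n
    unfolding V_def by (subst (2) exponent_weight.simps) simp
  have W: "s / 2 * renewal \<alpha> i \<le> exponent_weight \<alpha> s i" for i
    by (rule exponent_weight_ge[OF \<alpha>_nonneg partial_sums_le K_less s])
  have y: "0 \<le> exponent_weight \<alpha> s i" for i
    using W[of i] renewal_nonneg[of \<alpha> i, OF \<alpha>_nonneg] s(1)
    by (meson mult_nonneg_nonneg order_trans divide_nonneg_nonneg zero_le_numeral)
  have V0: "0 \<le> V n m" for n m
    unfolding V_def using s by (intro add_nonneg_nonneg sum_nonneg mult_nonneg_nonneg \<alpha>_nonneg y) auto
  have "(\<integral>\<^sup>+\<omega>. ennreal (exp (- s * real (X r \<omega>))) \<partial>M)
    \<le> (\<integral>\<^sup>+\<omega>. ennreal (exp (- (\<Sum>m = n..P. V n m * real (X (r - int m) \<omega>)))) \<partial>M)"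
    using n(2)
  proof (induction n)
    case 0
    have "(\<Sum>m = 0..P. V 0 m * real (X (r - int m) \<omega>)) = s * real (X r \<omega>)" for \<omega>
      by (simp add: V_def if_distrib[of "\<lambda>x. x * _"] sum.delta cong: if_cong)
    then show ?case by simp
  next
    case (Suc n)
    let ?g = "\<lambda>\<omega>. ennreal (exp (- (\<Sum>m = Suc n..P. V n m * real (X (r - int m) \<omega>))))"
    have g: "?g \<in> borel_measurable (past (r - int n))"
    proof -
      have "(\<lambda>\<omega>. \<Sum>m = Suc n..P. V n m * real (X (r - int m) \<omega>)) \<in> borel_measurable (past (r - int n))"
        by (intro borel_measurable_sum measurable_compose[OF X_past]) auto
      then show ?thesis by measurable
    qed
    have shift: "(\<Sum>k = 1..P - n. \<alpha> k * real (X (r - int n - int k) \<omega>))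
       = (\<Sum>m = Suc n..P. \<alpha> (m - n) * real (X (r - int m) \<omega>))" for \<omega>
      by (rule sum.reindex_bij_witness[of _ "\<lambda>m. m - n" "\<lambda>k. k + n"]) (auto simp: algebra_simps)
    have "(\<integral>\<^sup>+\<omega>. ennreal (exp (- s * real (X r \<omega>))) \<partial>M)
      \<le> (\<integral>\<^sup>+\<omega>. ennreal (exp (- (\<Sum>m = n..P. V n m * real (X (r - int m) \<omega>)))) \<partial>M)"
      using Suc by simp
    also have "\<dots> = (\<integral>\<^sup>+\<omega>. ennreal (exp (- V n n * real (X (r - int n) \<omega>))) * ?g \<omega> \<partial>M)"
      using Suc.prems by (simp add: sum.atLeast_Suc_atMost ennreal_mult[symmetric] exp_add[symmetric])
    also have "\<dots> \<le> (\<integral>\<^sup>+\<omega>. ennreal (exp (- (1 - exp (- V n n)) *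
        (\<Sum>k = 1..P - n. \<alpha> k * real (X (r - int n - int k) \<omega>)))) * ?g \<omega> \<partial>M)"
      by (rule laplace_step[OF V0 g])
    also have "\<dots> = (\<integral>\<^sup>+\<omega>. ennreal (exp (- (\<Sum>m = Suc n..P. V (Suc n) m * real (X (r - int m) \<omega>)))) \<partial>M)"
    proof (intro nn_integral_cong)
      fix \<omega>
      have "(\<Sum>m = Suc n..P. V (Suc n) m * real (X (r - int m) \<omega>))
        = exponent_weight \<alpha> s n * (\<Sum>m = Suc n..P. \<alpha> (m - n) * real (X (r - int m) \<omega>))
          + (\<Sum>m = Suc n..P. V n m * real (X (r - int m) \<omega>))"
        unfolding sum_distrib_left sum.distrib[symmetric]
        by (intro sum.cong refl) (simp add: V_def algebra_simps)
      then show "ennreal (exp (- (1 - exp (- V n n)) *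
        (\<Sum>k = 1..P - n. \<alpha> k * real (X (r - int n - int k) \<omega>)))) * ?g \<omega>
        = ennreal (exp (- (\<Sum>m = Suc n..P. V (Suc n) m * real (X (r - int m) \<omega>))))"
        unfolding shift V_diag by (simp add: ennreal_mult[symmetric] exp_add[symmetric])
    qed
    finally show ?case .
  qed
  also have "\<dots> \<le> (\<integral>\<^sup>+\<omega>. ennreal (exp (- (s / 2) * (\<Sum>m = n..P. renewal_weight \<alpha> n m * real (X (r - int m) \<omega>)))) \<partial>M)"
  proof (intro nn_integral_mono ennreal_leI)
    fix \<omega>
    have "s / 2 * renewal_weight \<alpha> n m \<le> V n m" if "m \<in> {n..P}" for m
    proof -
      have "(\<Sum>i<n. \<alpha> (m - i) * (s / 2 * renewal \<alpha> i)) \<le> (\<Sum>i<n. \<alpha> (m - i) * exponent_weight \<alpha> s i)"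
        by (intro sum_mono mult_left_mono W \<alpha>_nonneg)
      then show ?thesis using that n(1)
        by (simp add: V_def renewal_weight_def sum_distrib_left mult_ac)
    qed
    then have "(\<Sum>m = n..P. s / 2 * renewal_weight \<alpha> n m * real (X (r - int m) \<omega>))
       \<le> (\<Sum>m = n..P. V n m * real (X (r - int m) \<omega>))"
      by (intro sum_mono mult_right_mono) auto
    then show "exp (- (\<Sum>m = n..P. V n m * real (X (r - int m) \<omega>)))
      \<le> exp (- (s / 2) * (\<Sum>m = n..P. renewal_weight \<alpha> n m * real (X (r - int m) \<omega>)))"
      by (simp add: sum_distrib_left mult.assoc sum_negf)
  qed
  finally show ?thesis .
qed

text \<open>The transform is split at level \<open>c\<close> of the prediction: the integrand is at
  most \<open>1\<close> below and at most \<open>exp (- (s / 2) * c)\<close> above. As the left side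
  is close to \<open>1\<close> for small \<open>s\<close>, the prediction stays bounded with high
  probability, uniformly in \<open>n\<close>.\<close>

lemma predictor_tight:
  assumes s: "0 \<le> s" "s \<le> 1 - K" and n: "1 \<le> n" and c: "0 \<le> c"
  shows "(\<integral>\<^sup>+\<omega>. ennreal (exp (- s * real (X r \<omega>))) \<partial>M)
    \<le> emeasure M {\<omega>\<in>space M. predictor r n \<omega> \<le> ennreal c} + ennreal (exp (- (s / 2) * c))"
proof -
  let ?L = "\<integral>\<^sup>+\<omega>. ennreal (exp (- s * real (X r \<omega>))) \<partial>M"
  define S where "S p \<omega> = (\<Sum>m = n..n + p. renewal_weight \<alpha> n m * real (X (r - int m) \<omega>))" for p \<omega>
  have Sm[measurable]: "S p \<in> borel_measurable M" for p unfolding S_def[abs_def] by measurable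
  define A where "A p = {\<omega>\<in>space M. S p \<omega> \<le> c}" for p
  have Am[measurable]: "A p \<in> sets M" for p unfolding A_def by measurable
  have bound: "?L \<le> emeasure M (A p) + ennreal (exp (- (s / 2) * c))" for p
  proof -
    have "?L \<le> (\<integral>\<^sup>+\<omega>. ennreal (exp (- (s / 2) * S p \<omega>)) \<partial>M)"
      unfolding S_def by (rule laplace_predictor) (use s n in auto)
    also have "\<dots> \<le> (\<integral>\<^sup>+\<omega>. indicator (A p) \<omega> + ennreal (exp (- (s / 2) * c)) \<partial>M)"
    proof (intro nn_integral_mono)
      fix \<omega> assume w: "\<omega> \<in> space M"
      have "0 \<le> S p \<omega>" unfolding S_def
        by (intro sum_nonneg mult_nonneg_nonneg renewal_weight_nonneg) auto
      then have *: "exp (- (s / 2) * S p \<omega>) \<le> 1" using s by simp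
      show "ennreal (exp (- (s / 2) * S p \<omega>)) \<le> indicator (A p) \<omega> + ennreal (exp (- (s / 2) * c))"
      proof (cases "\<omega> \<in> A p")
        case True
        have "ennreal (exp (- (s / 2) * S p \<omega>)) \<le> 1" using ennreal_leI[OF *] by simp
        also have "\<dots> \<le> 1 + ennreal (exp (- (s / 2) * c))" by simp
        finally show ?thesis using True by simp
      next
        case False
        then have "c \<le> S p \<omega>" using w by (simp add: A_def)
        then have "(s / 2) * c \<le> (s / 2) * S p \<omega>" using s by (intro mult_left_mono) auto
        then show ?thesis using False by (auto intro!: ennreal_leI)
      qed
    qed
    also have "\<dots> = emeasure M (A p) + ennreal (exp (- (s / 2) * c))"
      by (subst nn_integral_add) (auto simp: emeasure_space_1)
    finally show ?thesis .
  qed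
  \<comment> \<open>The truncated predictions increase to the full one, so continuity from above
    removes the cutoff.\<close>
  have "decseq A"
  proof (rule decseq_SucI)
    fix p
    have "S p \<omega> \<le> S (Suc p) \<omega>" for \<omega>
      unfolding S_def by (simp add: renewal_weight_nonneg)
    then show "A (Suc p) \<subseteq> A p" unfolding A_def by (auto intro: order_trans)
  qed
  then have "(\<lambda>p. emeasure M (A p)) \<longlonglongrightarrow> emeasure M (\<Inter>p. A p)"
    by (intro Lim_emeasure_decseq) auto
  then have "(\<lambda>p. emeasure M (A p) + ennreal (exp (- (s / 2) * c)))
      \<longlonglongrightarrow> emeasure M (\<Inter>p. A p) + ennreal (exp (- (s / 2) * c))"
    by (intro tendsto_add tendsto_const)
  then have lim: "?L \<le> emeasure M (\<Inter>p. A p) + ennreal (exp (- (s / 2) * c))"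
    by (rule Lim_bounded2) (use bound in auto)
  have "(\<Inter>p. A p) \<subseteq> {\<omega>\<in>space M. predictor r n \<omega> \<le> ennreal c}"
  proof
    fix \<omega> assume w: "\<omega> \<in> (\<Inter>p. A p)"
    have "(\<Sum>j<p. ennreal (renewal_weight \<alpha> n (n + j)) * of_nat (X (r - int (n + j)) \<omega>)) \<le> ennreal c" for p
    proof -
      have "(\<Sum>j<p. ennreal (renewal_weight \<alpha> n (n + j)) * of_nat (X (r - int (n + j)) \<omega>))
        \<le> (\<Sum>j\<le>p. ennreal (renewal_weight \<alpha> n (n + j)) * of_nat (X (r - int (n + j)) \<omega>))"
        by (rule sum_mono2) auto
      also have "\<dots> = (\<Sum>m = n..n + p. ennreal (renewal_weight \<alpha> n m) * of_nat (X (r - int m) \<omega>))"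
        by (rule sum.reindex_bij_witness[of _ "\<lambda>m. m - n" "\<lambda>j. n + j"]) auto
      also have "\<dots> = ennreal (S p \<omega>)"
        unfolding S_def
        by (subst sum_ennreal[symmetric])
           (auto simp: renewal_weight_nonneg ennreal_mult ennreal_of_nat_eq_real_of_nat)
      also have "\<dots> \<le> ennreal c" using w by (intro ennreal_leI) (auto simp: A_def)
      finally show ?thesis .
    qed
    then have "predictor r n \<omega> \<le> ennreal c"
      unfolding predictor_def by (intro suminf_le_const) auto
    then show "\<omega> \<in> {\<omega>\<in>space M. predictor r n \<omega> \<le> ennreal c}" using w by (auto simp: A_def)
  qed
  then have "emeasure M (\<Inter>p. A p) \<le> emeasure M {\<omega>\<in>space M. predictor r n \<omega> \<le> ennreal c}"
    by (intro emeasure_mono) measurable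
  then show ?thesis using lim by (meson add_right_mono order_trans)
qed

end

section \<open>Conditional means given the tail events\<close>

text \<open>Fatou's lemma for the lower limit of events.\<close>

lemma (in finite_measure) emeasure_eventually_le:
  fixes B :: "nat \<Rightarrow> 'a set"
  assumes [measurable]: "\<And>n. B n \<in> sets M" and le: "\<And>n. emeasure M (B n) \<le> d"
  shows "emeasure M (\<Union>N. \<Inter>n\<in>{N..}. B n) \<le> d"
proof -
  have "emeasure M (\<Union>N. \<Inter>n\<in>{N..}. B n) = (SUP N. emeasure M (\<Inter>n\<in>{N..}. B n))"
  proof (rule SUP_emeasure_incseq[symmetric])
    show "range (\<lambda>N. \<Inter>n\<in>{N..}. B n) \<subseteq> sets M" by (auto intro!: sets.countable_INT)
    show "incseq (\<lambda>N. \<Inter>n\<in>{N..}. B n)" by (rule incseq_SucI) force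
  qed
  also have "\<dots> \<le> d"
  proof (rule SUP_least)
    fix N
    have "emeasure M (\<Inter>n\<in>{N..}. B n) \<le> emeasure M (B N)"
      by (rule emeasure_mono) auto
    also have "\<dots> \<le> d" by (rule le)
    finally show "emeasure M (\<Inter>n\<in>{N..}. B n) \<le> d" .
  qed
  finally show ?thesis .
qed

context inar_process
begin

text \<open>\<open>sigma\<close> only packages the intersection as a measure space; by
  \<open>sets_tail\<close> it adds no sets.\<close>

definition tail :: "'a measure" where
  "tail = sigma (space M) (\<Inter>n. sets (past n))"

lemma Inter_past_Pow: "(\<Inter>n. sets (past n)) \<subseteq> Pow (space M)"
proof -
  have "(\<Inter>n. sets (past n)) \<subseteq> sets (past 0)" by blast
  also have "\<dots> \<subseteq> Pow (space M)" using sets.space_closed[of "past 0"] by simp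
  finally show ?thesis .
qed

lemma space_tail [simp]: "space tail = space M"
  unfolding tail_def by (rule space_measure_of[OF Inter_past_Pow])

lemma sets_tail: "sets tail = (\<Inter>n. sets (past n))"
proof -
  have "sets tail = sigma_sets (space M) (\<Inter>n. sets (past n))"
    unfolding tail_def by (rule sets_measure_of[OF Inter_past_Pow])
  moreover have "sigma_sets (space M) (\<Inter>n. sets (past n)) \<subseteq> sets (past m)" for m
    using sets.sigma_sets_subset[of "\<Inter>n. sets (past n)" "past m"] by auto
  moreover have "(\<Inter>n. sets (past n)) \<subseteq> sigma_sets (space M) (\<Inter>n. sets (past n))"
    by (rule sigma_sets_superset_generator)
  ultimately show ?thesis by blast
qed

lemma subalgebra_tail: "subalgebra M tail"
  using subalgebra_past by (auto simp: subalgebra_def sets_tail)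

lemma tail_subset_past: "B \<in> sets tail \<Longrightarrow> B \<in> sets (past n)"
  by (simp add: sets_tail)

lemma tail_in_events: "B \<in> sets tail \<Longrightarrow> B \<in> sets M"
  using subalgebra_tail by (auto simp: subalgebra_def)

lemma past_in_events: "B \<in> sets (past n) \<Longrightarrow> B \<in> sets M"
  using subalgebra_past by (auto simp: subalgebra_def)

definition small_prediction :: "int \<Rightarrow> real \<Rightarrow> nat \<Rightarrow> 'a set" where
  "small_prediction r c n = {\<omega>\<in>space M. predictor r n \<omega> \<le> ennreal c}"

text \<open>Besides being the claimed mean, this bounds the immigration
  \<open>\<alpha> 0 * (\<Sum>i<n. renewal \<alpha> i)\<close> collected in
  \<open>predictor_mean\<close>, for every \<open>n\<close>.\<close>

definition mean_bound :: real where
  "mean_bound = \<alpha> 0 / (1 - K)"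

lemma mean_bound_nonneg: "0 \<le> mean_bound"
  using \<alpha>_nonneg[of 0] K_less by (simp add: mean_bound_def)

lemma small_prediction_past: "small_prediction r c n \<in> sets (past (r - int n + 1))"
proof -
  have [measurable]: "predictor r n \<in> borel_measurable (past (r - int n + 1))"
    by (rule predictor_past)
  have "{\<omega>\<in>space (past (r - int n + 1)). predictor r n \<omega> \<le> ennreal c} \<in> sets (past (r - int n + 1))"
    by measurable
  then show ?thesis by (simp add: small_prediction_def)
qed

lemma small_prediction_measurable [measurable]: "small_prediction r c n \<in> sets M"
  by (rule past_in_events[OF small_prediction_past])

lemma mean_small_prediction:
  assumes B: "B \<in> sets (past (r - int n + 1))" and c: "0 \<le> c"
  shows "(\<integral>\<^sup>+\<omega>. of_nat (X r \<omega>) * indicator (B \<inter> small_prediction r c n) \<omega> \<partial>M)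
    \<le> ennreal (c + mean_bound) * emeasure M (B \<inter> small_prediction r c n)"
proof -
  let ?D = "B \<inter> small_prediction r c n"
  have D: "?D \<in> sets (past (r - int n + 1))" using B small_prediction_past by blast
  have [measurable]: "?D \<in> sets M" by (rule past_in_events[OF D])
  have "(\<integral>\<^sup>+\<omega>. of_nat (X r \<omega>) * indicator ?D \<omega> \<partial>M)
     = (\<integral>\<^sup>+\<omega>. (ennreal (\<alpha> 0 * (\<Sum>i<n. renewal \<alpha> i)) + predictor r n \<omega>) * indicator ?D \<omega> \<partial>M)"
    by (rule predictor_mean) (use D in simp)
  also have "\<dots> \<le> (\<integral>\<^sup>+\<omega>. ennreal (c + mean_bound) * indicator ?D \<omega> \<partial>M)"
  proof (intro nn_integral_mono)
    fix \<omega>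
    have "(\<Sum>i<n. renewal \<alpha> i) \<le> (\<Sum>i\<le>n. renewal \<alpha> i)"
      by (rule sum_mono2) (auto intro: renewal_nonneg \<alpha>_nonneg)
    also have "\<dots> \<le> 1 / (1 - K)" by (rule sum_renewal_le[OF \<alpha>_nonneg partial_sums_le K_less])
    finally have "\<alpha> 0 * (\<Sum>i<n. renewal \<alpha> i) \<le> \<alpha> 0 * (1 / (1 - K))"
      by (rule mult_left_mono) (rule \<alpha>_nonneg)
    then have le: "ennreal (\<alpha> 0 * (\<Sum>i<n. renewal \<alpha> i)) \<le> ennreal mean_bound"
      by (intro ennreal_leI) (simp add: mean_bound_def)
    show "(ennreal (\<alpha> 0 * (\<Sum>i<n. renewal \<alpha> i)) + predictor r n \<omega>) * indicator ?D \<omega>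
      \<le> ennreal (c + mean_bound) * indicator ?D \<omega>"
    proof (cases "\<omega> \<in> ?D")
      case True
      then have "predictor r n \<omega> \<le> ennreal c" by (simp add: small_prediction_def)
      from add_mono[OF le this] show ?thesis
        using True mean_bound_nonneg c by (simp add: add.commute ennreal_plus[symmetric] del: ennreal_plus)
    qed simp
  qed
  also have "\<dots> = ennreal (c + mean_bound) * emeasure M ?D"
    by (subst nn_integral_cmult) auto
  finally show ?thesis .
qed

text \<open>Splitting according to the largest \<open>n\<close> for which the prediction is small keeps each piece measurable with
  respect to the past that the prediction uses.\<close>

lemma mean_some_small_prediction:
  assumes c: "0 \<le> c" and B: "B \<in> sets (past (r - int (m + N) + 1))"
  shows "(\<integral>\<^sup>+\<omega>. of_nat (X r \<omega>) * indicator (B \<inter> (\<Union>n\<in>{m..<m + N}. small_prediction r c n)) \<omega> \<partial>M)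
    \<le> ennreal (c + mean_bound) * emeasure M (B \<inter> (\<Union>n\<in>{m..<m + N}. small_prediction r c n))"
  using B
proof (induction N arbitrary: B)
  case (Suc N)
  let ?A = "small_prediction r c (m + N)" and ?U = "\<Union>n\<in>{m..<m + N}. small_prediction r c n"
  let ?f = "\<lambda>D. \<integral>\<^sup>+\<omega>. of_nat (X r \<omega>) * indicator D \<omega> \<partial>M"
  have sub: "subalgebra (past (r - int (m + N) + 1)) (past (r - int (m + Suc N) + 1))"
    by (rule past_mono) simp
  have B: "B \<in> sets (past (r - int (m + N) + 1))"
    using sub Suc.prems by (auto simp: subalgebra_def)
  \<comment> \<open>\<open>past\<close> grows as the lag shrinks, so what is left after removing the
    event of the largest lag is admissible in the induction hypothesis.\<close>
  have D: "B - ?A \<in> sets (past (r - int (m + N) + 1))" using B small_prediction_past by blast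
  have [measurable]: "B \<in> sets M" by (rule past_in_events[OF B])
  have split: "B \<inter> (\<Union>n\<in>{m..<m + Suc N}. small_prediction r c n) = (B \<inter> ?A) \<union> ((B - ?A) \<inter> ?U)"
  proof -
    have "{m..<m + Suc N} = insert (m + N) {m..<m + N}" by auto
    then show ?thesis by auto
  qed
  have disj: "(B \<inter> ?A) \<inter> ((B - ?A) \<inter> ?U) = {}" by auto
  have "?f ((B \<inter> ?A) \<union> ((B - ?A) \<inter> ?U)) = ?f (B \<inter> ?A) + ?f ((B - ?A) \<inter> ?U)"
  proof -
    have "?f ((B \<inter> ?A) \<union> ((B - ?A) \<inter> ?U))
      = (\<integral>\<^sup>+\<omega>. of_nat (X r \<omega>) * indicator (B \<inter> ?A) \<omega> + of_nat (X r \<omega>) * indicator ((B - ?A) \<inter> ?U) \<omega> \<partial>M)"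
      by (intro nn_integral_cong) (auto simp: indicator_def)
    also have "\<dots> = ?f (B \<inter> ?A) + ?f ((B - ?A) \<inter> ?U)"
      by (rule nn_integral_add) measurable
    finally show ?thesis .
  qed
  also have "\<dots> \<le> ennreal (c + mean_bound) * emeasure M (B \<inter> ?A)
      + ennreal (c + mean_bound) * emeasure M ((B - ?A) \<inter> ?U)"
    by (intro add_mono mean_small_prediction[OF B c] Suc.IH[OF D])
  also have "\<dots> = ennreal (c + mean_bound) * emeasure M ((B \<inter> ?A) \<union> ((B - ?A) \<inter> ?U))"
    by (subst plus_emeasure[symmetric]) (auto simp: distrib_left disj)
  finally show ?case unfolding split .
qed simp

text \<open>The upper limit of the events is chosen because a lower bound on the probability at each
  lag passes to it, with no convergence of the predictions required.\<close>

definition often_small :: "int \<Rightarrow> real \<Rightarrow> 'a set" where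
  "often_small r c = (\<Inter>m. \<Union>n\<in>{m..}. small_prediction r c n)"

lemma often_small_tail: "often_small r c \<in> sets tail"
  unfolding sets_tail
proof
  fix k :: int
  \<comment> \<open>From this lag on, predictions use only values before time
    \<open>k\<close>.\<close>
  define m0 where "m0 = nat (r + 1 - k)"
  have "often_small r c = (\<Inter>m. \<Union>n\<in>{m + m0..}. small_prediction r c n)"
  proof -
    have "(\<forall>m. \<exists>n\<ge>m. P n) \<longleftrightarrow> (\<forall>m. \<exists>n\<ge>m + m0. P n)" for P :: "nat \<Rightarrow> bool"
      by (meson le_add1 order_trans)
    from this[of "\<lambda>n. _ \<in> small_prediction r c n"] show ?thesis
      unfolding often_small_def by (simp add: set_eq_iff Bex_def)
  qed
  moreover have "small_prediction r c n \<in> sets (past k)" if "n \<ge> m + m0" for n m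
  proof -
    have "subalgebra (past k) (past (r - int n + 1))"
      by (rule past_mono) (use that in \<open>auto simp: m0_def\<close>)
    then show ?thesis using small_prediction_past by (auto simp: subalgebra_def)
  qed
  then have "(\<Inter>m. \<Union>n\<in>{m + m0..}. small_prediction r c n) \<in> sets (past k)"
    by (intro sets.countable_INT) (auto intro!: sets.countable_UN'')
  ultimately show "often_small r c \<in> sets (past k)" by simp
qed

lemma mean_often_small:
  assumes c: "0 \<le> c" and B: "B \<in> sets tail" "B \<subseteq> often_small r c"
  shows "(\<integral>\<^sup>+\<omega>. of_nat (X r \<omega>) * indicator B \<omega> \<partial>M) \<le> ennreal (c + mean_bound) * emeasure M B"
proof -
  let ?U = "\<lambda>N. \<Union>n\<in>{0..<0 + N}. small_prediction r c n"
  \<comment> \<open>Under this measure the passage from finitely many lags to all of them is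
    continuity from below.\<close>
  let ?D = "density M (\<lambda>\<omega>. of_nat (X r \<omega>))"
  have BM[measurable]: "B \<in> sets M" by (rule tail_in_events[OF B(1)])
  have "B = (\<Union>N. B \<inter> ?U N)"
  proof -
    have "\<exists>N. \<omega> \<in> ?U N" if "\<omega> \<in> B" for \<omega>
    proof -
      have "\<omega> \<in> (\<Union>n\<in>{0..}. small_prediction r c n)" using B(2) that by (auto simp: often_small_def)
      then obtain n where "\<omega> \<in> small_prediction r c n" by blast
      then show ?thesis by (intro exI[of _ "Suc n"] UN_I[of n]) auto
    qed
    then show ?thesis by blast
  qed
  then have "emeasure ?D B = emeasure ?D (\<Union>N. B \<inter> ?U N)" by simp
  also have "\<dots> = (SUP N. emeasure ?D (B \<inter> ?U N))"
  proof (rule SUP_emeasure_incseq[symmetric])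
    show "range (\<lambda>N. B \<inter> ?U N) \<subseteq> sets ?D" by auto
    show "incseq (\<lambda>N. B \<inter> ?U N)" by (intro incseq_SucI Int_mono UN_mono) auto
  qed
  also have "\<dots> \<le> ennreal (c + mean_bound) * emeasure M B"
  proof (rule SUP_least)
    fix N
    have "emeasure ?D (B \<inter> ?U N) = (\<integral>\<^sup>+\<omega>. of_nat (X r \<omega>) * indicator (B \<inter> ?U N) \<omega> \<partial>M)"
      by (rule emeasure_density) measurable
    also have "\<dots> \<le> ennreal (c + mean_bound) * emeasure M (B \<inter> ?U N)"
      by (rule mean_some_small_prediction[OF c tail_subset_past[OF B(1)]])
    also have "\<dots> \<le> ennreal (c + mean_bound) * emeasure M B"
      by (intro mult_left_mono emeasure_mono) auto
    finally show "emeasure ?D (B \<inter> ?U N) \<le> ennreal (c + mean_bound) * emeasure M B" .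
  qed
  finally show ?thesis by (simp add: emeasure_density)
qed

lemma often_small_likely:
  assumes s: "0 \<le> s" "s \<le> 1 - K" and c: "0 \<le> c"
  shows "(\<integral>\<^sup>+\<omega>. ennreal (exp (- s * real (X r \<omega>))) \<partial>M)
    \<le> emeasure M (often_small r c) + ennreal (exp (- (s / 2) * c))"
proof -
  let ?L = "\<integral>\<^sup>+\<omega>. ennreal (exp (- s * real (X r \<omega>))) \<partial>M"
  let ?V = "\<lambda>m. \<Union>n\<in>{m..}. small_prediction r c n"
  have le: "?L \<le> emeasure M (?V m) + ennreal (exp (- (s / 2) * c))" for m
  proof -
    \<comment> \<open>\<open>Suc m\<close> rather than \<open>m\<close>, because
      \<open>predictor_tight\<close> requires a positive lag.\<close>
    have "?L \<le> emeasure M (small_prediction r c (Suc m)) + ennreal (exp (- (s / 2) * c))"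
      unfolding small_prediction_def by (rule predictor_tight[OF s _ c]) simp
    also have "\<dots> \<le> emeasure M (?V m) + ennreal (exp (- (s / 2) * c))"
      by (intro add_right_mono emeasure_mono UN_upper) auto
    finally show ?thesis .
  qed
  have "(\<lambda>m. emeasure M (?V m)) \<longlonglongrightarrow> emeasure M (\<Inter>m. ?V m)"
  proof (rule Lim_emeasure_decseq)
    show "decseq ?V" by (intro decseq_SucI UN_mono) auto
  qed auto
  then have "(\<lambda>m. emeasure M (?V m) + ennreal (exp (- (s / 2) * c)))
      \<longlonglongrightarrow> emeasure M (often_small r c) + ennreal (exp (- (s / 2) * c))"
    unfolding often_small_def by (intro tendsto_add tendsto_const)
  then show ?thesis by (rule Lim_bounded2) (use le in auto)
qed

text \<open>The nonnegative extended conditional expectation exists without integrability; that it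
  is finite is proved only in \<open>tail_mean_finite\<close>, with stationarity.\<close>

definition tail_mean :: "int \<Rightarrow> 'a \<Rightarrow> ennreal" where
  "tail_mean r = nn_cond_exp M tail (\<lambda>\<omega>. of_nat (X r \<omega>))"

lemma tail_mean_tail: "tail_mean r \<in> borel_measurable tail"
  unfolding tail_mean_def by (rule borel_measurable_nn_cond_exp)

lemma tail_mean_measurable [measurable]: "tail_mean r \<in> borel_measurable M"
  by (rule measurable_from_subalg[OF subalgebra_tail tail_mean_tail])

lemma finite_measure_subalgebra_tail: "finite_measure_subalgebra M tail"
  by (intro finite_measure_subalgebra.intro finite_measure_subalgebra_axioms.intro subalgebra_tail)
     (rule finite_measure_axioms)

lemma tail_mean_integral:
  assumes "B \<in> sets tail"
  shows "(\<integral>\<^sup>+\<omega>. tail_mean r \<omega> * indicator B \<omega> \<partial>M) = (\<integral>\<^sup>+\<omega>. of_nat (X r \<omega>) * indicator B \<omega> \<partial>M)"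
proof -
  interpret T: finite_measure_subalgebra M tail by (rule finite_measure_subalgebra_tail)
  have "(\<integral>\<^sup>+\<omega>. indicator B \<omega> * nn_cond_exp M tail (\<lambda>\<omega>. of_nat (X r \<omega>)) \<omega> \<partial>M)
     = (\<integral>\<^sup>+\<omega>. indicator B \<omega> * of_nat (X r \<omega>) \<partial>M)"
    by (rule T.nn_cond_exp_intg) (use assms in auto)
  then show ?thesis by (simp add: tail_mean_def mult.commute)
qed

lemma tail_mean_often_small:
  assumes c: "0 \<le> c"
  shows "AE \<omega> in M. \<omega> \<in> often_small r c \<longrightarrow> tail_mean r \<omega> \<le> ennreal (c + mean_bound)"
proof -
  let ?b = "ennreal (c + mean_bound)"
  \<comment> \<open>The exceptional set is itself a tail event, so \<open>mean_often_small\<close>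
    applies to it and contradicts the strict inequality unless it is null.\<close>
  define B where "B = {\<omega>\<in>space tail. ?b < tail_mean r \<omega>} \<inter> often_small r c"
  have Bt: "B \<in> sets tail"
  proof -
    have [measurable]: "tail_mean r \<in> borel_measurable tail" by (rule tail_mean_tail)
    show ?thesis unfolding B_def by (intro sets.Int often_small_tail) measurable
  qed
  have [measurable]: "B \<in> sets M" by (rule tail_in_events[OF Bt])
  have sub: "B \<subseteq> often_small r c" by (auto simp: B_def)
  have bound: "(\<integral>\<^sup>+\<omega>. tail_mean r \<omega> * indicator B \<omega> \<partial>M) \<le> (\<integral>\<^sup>+\<omega>. ?b * indicator B \<omega> \<partial>M)"
    unfolding tail_mean_integral[OF Bt]
    using mean_often_small[OF c Bt sub] by (simp add: nn_integral_cmult)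
  have "AE \<omega> in M. tail_mean r \<omega> * indicator B \<omega> \<le> ?b * indicator B \<omega>"
  proof (rule ccontr)
    assume "\<not> ?thesis"
    then have "(\<integral>\<^sup>+\<omega>. ?b * indicator B \<omega> \<partial>M) < (\<integral>\<^sup>+\<omega>. tail_mean r \<omega> * indicator B \<omega> \<partial>M)"
    proof (intro nn_integral_less)
      show "AE \<omega> in M. ?b * indicator B \<omega> \<le> tail_mean r \<omega> * indicator B \<omega>"
        by (intro AE_I2) (auto simp: B_def indicator_def)
      show "(\<integral>\<^sup>+\<omega>. ?b * indicator B \<omega> \<partial>M) \<noteq> \<infinity>"
        by (simp add: nn_integral_cmult ennreal_mult_eq_top_iff)
    qed auto
    with bound show False by simp
  qed
  then show ?thesis
    by (rule AE_mp) (intro AE_I2, auto simp: B_def indicator_def not_less[symmetric] split: if_splits)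
qed

text \<open>Bounds the probability of a large tail mean by
  \<open>1 - E exp (- s X) + exp (- s c / 2)\<close>, written as a sum to avoid subtraction in
  \<open>ennreal\<close>.\<close>

lemma tail_mean_tight:
  assumes s: "0 \<le> s" "s \<le> 1 - K" and c: "0 \<le> c"
  shows "(\<integral>\<^sup>+\<omega>. ennreal (exp (- s * real (X r \<omega>))) \<partial>M)
      + emeasure M {\<omega>\<in>space M. ennreal (c + mean_bound) < tail_mean r \<omega>}
    \<le> 1 + ennreal (exp (- (s / 2) * c))"
proof -
  let ?Q = "{\<omega>\<in>space M. ennreal (c + mean_bound) < tail_mean r \<omega>}"
  have [measurable]: "often_small r c \<in> sets M" by (rule tail_in_events[OF often_small_tail])
  have "emeasure M ?Q \<le> emeasure M (space M - often_small r c)"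
    by (rule emeasure_mono_AE, use tail_mean_often_small[OF c] in eventually_elim) (auto simp: not_le[symmetric])
  then have "emeasure M (often_small r c) + emeasure M ?Q
    \<le> emeasure M (often_small r c) + emeasure M (space M - often_small r c)"
    by (rule add_left_mono)
  also have "\<dots> = emeasure M (often_small r c \<union> (space M - often_small r c))"
    by (rule plus_emeasure) auto
  also have "often_small r c \<union> (space M - often_small r c) = space M"
    using sets.sets_into_space[OF \<open>often_small r c \<in> sets M\<close>] by auto
  finally have "emeasure M (often_small r c) + emeasure M ?Q \<le> 1" by (simp add: emeasure_space_1)
  then have le1: "(emeasure M (often_small r c) + emeasure M ?Q) + ennreal (exp (- (s / 2) * c))
    \<le> 1 + ennreal (exp (- (s / 2) * c))" by (rule add_right_mono)
  have "(\<integral>\<^sup>+\<omega>. ennreal (exp (- s * real (X r \<omega>))) \<partial>M) + emeasure M ?Q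
    \<le> (emeasure M (often_small r c) + ennreal (exp (- (s / 2) * c))) + emeasure M ?Q"
    by (rule add_right_mono[OF often_small_likely[OF s c]])
  also have "\<dots> = (emeasure M (often_small r c) + emeasure M ?Q) + ennreal (exp (- (s / 2) * c))"
    by (simp only: ac_simps)
  also note le1
  finally show ?thesis .
qed

text \<open>Tail events lie in every \<open>past r\<close>, so \<open>mean_step\<close> may be
  tested on them; there \<open>X\<close> and its tail mean have the same integral at every time.
  Uniqueness of conditional expectations concludes.\<close>

lemma tail_mean_equation:
  "AE \<omega> in M. tail_mean r \<omega> = ennreal (\<alpha> 0) + (\<Sum>k. ennreal (\<alpha> (Suc k)) * tail_mean (r - int (Suc k)) \<omega>)"
proof -
  interpret T: finite_measure_subalgebra M tail by (rule finite_measure_subalgebra_tail)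
  let ?R = "\<lambda>\<omega>. ennreal (\<alpha> 0) + (\<Sum>k. ennreal (\<alpha> (Suc k)) * tail_mean (r - int (Suc k)) \<omega>)"
  have "AE \<omega> in M. ?R \<omega> = nn_cond_exp M tail (\<lambda>\<omega>. of_nat (X r \<omega>)) \<omega>"
  proof (rule T.nn_cond_exp_charact)
    show "?R \<in> borel_measurable tail"
      by (intro borel_measurable_add borel_measurable_const borel_measurable_suminf_order
          borel_measurable_times_ennreal tail_mean_tail)
    fix B assume B: "B \<in> sets tail"
    have [measurable]: "B \<in> sets M" by (rule tail_in_events[OF B])
    have expand: "(\<integral>\<^sup>+\<omega>. (ennreal (\<alpha> 0) + (\<Sum>k. ennreal (\<alpha> (Suc k)) * Z k \<omega>)) * indicator B \<omega> \<partial>M)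
      = ennreal (\<alpha> 0) * emeasure M B + (\<Sum>k. ennreal (\<alpha> (Suc k)) * (\<integral>\<^sup>+\<omega>. Z k \<omega> * indicator B \<omega> \<partial>M))"
      if [measurable]: "\<And>k. Z k \<in> borel_measurable M" for Z :: "nat \<Rightarrow> 'a \<Rightarrow> ennreal"
    proof -
      have "(\<integral>\<^sup>+\<omega>. (ennreal (\<alpha> 0) + (\<Sum>k. ennreal (\<alpha> (Suc k)) * Z k \<omega>)) * indicator B \<omega> \<partial>M)
        = (\<integral>\<^sup>+\<omega>. ennreal (\<alpha> 0) * indicator B \<omega> + (\<Sum>k. ennreal (\<alpha> (Suc k)) * (Z k \<omega> * indicator B \<omega>)) \<partial>M)"
        by (simp add: distrib_right ennreal_suminf_multc[symmetric] mult.assoc del: ennreal_suminf_multc ennreal_suminf_cmult)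
      also have "\<dots> = (\<integral>\<^sup>+\<omega>. ennreal (\<alpha> 0) * indicator B \<omega> \<partial>M)
          + (\<Sum>k. \<integral>\<^sup>+\<omega>. ennreal (\<alpha> (Suc k)) * (Z k \<omega> * indicator B \<omega>) \<partial>M)"
        by (subst nn_integral_add) (auto simp: nn_integral_suminf simp del: ennreal_suminf_multc ennreal_suminf_cmult)
      finally show ?thesis by (simp add: nn_integral_cmult)
    qed
    have "(\<integral>\<^sup>+\<omega>. of_nat (X r \<omega>) * indicator B \<omega> \<partial>M) = (\<integral>\<^sup>+\<omega>. intensity r \<omega> * indicator B \<omega> \<partial>M)"
      by (rule mean_step) (use tail_subset_past[OF B] in simp)
    also have "\<dots> = (\<integral>\<^sup>+\<omega>. ?R \<omega> * indicator B \<omega> \<partial>M)"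
      unfolding intensity_def by (subst (1 2) expand) (auto simp: tail_mean_integral[OF B])
    finally show "(\<integral>\<^sup>+\<omega>\<in>B. of_nat (X r \<omega>) \<partial>M) = (\<integral>\<^sup>+\<omega>\<in>B. ?R \<omega> \<partial>M)" .
  qed auto
  then show ?thesis unfolding tail_mean_def by eventually_elim simp
qed

end

section \<open>The mean of a stationary solution\<close>

lemma strictly_stationary_marginal:
  fixes f :: "nat \<Rightarrow> ennreal"
  assumes st: "strictly_stationary M X" and X: "\<And>n. X n \<in> M \<rightarrow>\<^sub>M count_space UNIV"
  shows "(\<integral>\<^sup>+\<omega>. f (X n \<omega>) \<partial>M) = (\<integral>\<^sup>+\<omega>. f (X 0 \<omega>) \<partial>M)"
proof -
  let ?P = "PiM UNIV (\<lambda>_. count_space UNIV) :: (int \<Rightarrow> nat) measure"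
  have m: "(\<lambda>\<omega> m. X (m + h) \<omega>) \<in> M \<rightarrow>\<^sub>M ?P" for h
    by (rule measurable_PiM_single') (auto intro: X)
  have f: "(\<lambda>x. f (x 0)) \<in> borel_measurable ?P"
    by (rule measurable_compose[OF measurable_component_singleton]) auto
  have "(\<integral>\<^sup>+\<omega>. f (X n \<omega>) \<partial>M) = (\<integral>\<^sup>+x. f (x 0) \<partial>distr M ?P (\<lambda>\<omega> m. X (m + n) \<omega>))"
    by (subst nn_integral_distr[OF m]) (use f in auto)
  also have "\<dots> = (\<integral>\<^sup>+x. f (x 0) \<partial>distr M ?P (\<lambda>\<omega> m. X m \<omega>))"
    using st by (simp add: strictly_stationary_def)
  also have "\<dots> = (\<integral>\<^sup>+\<omega>. f (X 0 \<omega>) \<partial>M)"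
    by (subst nn_integral_distr) (use f m[of 0] in auto)
  finally show ?thesis .
qed

lemma (in inar) suminf_alpha: "(\<Sum>k. ennreal (\<alpha> (Suc k))) = ennreal K"
proof -
  have "((\<lambda>k. \<alpha> (Suc k)) has_sum K) UNIV" using \<alpha>_sum by (simp add: has_sum_Suc_iff)
  then have "(\<lambda>k. \<alpha> (Suc k)) sums K" by (rule has_sum_imp_sums)
  then show ?thesis by (intro suminf_ennreal_eq \<alpha>_nonneg)
qed

lemma (in inar) K_nonneg: "0 \<le> K"
  using \<alpha>_sum by (rule has_sum_nonneg) (rule \<alpha>_nonneg)

lemma (in inar) alpha_le_one:
  assumes "1 \<le> a"
  shows "\<alpha> a \<le> 1"
proof -
  have "(\<alpha> has_sum \<alpha> a) {a}" by (rule has_sum_finiteI) auto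
  then have "\<alpha> a \<le> K"
    by (rule has_sum_mono_neutral[OF _ \<alpha>_sum]) (use \<alpha>_nonneg assms in auto)
  then show ?thesis using K_less by simp
qed

locale stationary_inar_process = inar_process +
  assumes stationary: "strictly_stationary M X"
begin

text \<open>Only the transform of \<open>X r\<close> enters \<open>tail_mean_tight\<close>, and by
  stationarity it does not depend on \<open>r\<close>. Three errors of size
  \<open>\<delta> / 3\<close> are balanced: the event \<open>X 0 > j\<close>, the exponent
  \<open>s * j\<close>, and \<open>exp (- s c / 2)\<close>.\<close>

lemma tail_mean_uniformly_tight:
  assumes \<delta>: "0 < \<delta>" "\<delta> \<le> 1"
  shows "\<exists>c\<ge>0. \<forall>r. emeasure M {\<omega>\<in>space M. ennreal c < tail_mean r \<omega>} \<le> ennreal \<delta>"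
proof -
  define A where "A j = {\<omega>\<in>space M. X 0 \<omega> \<le> j}" for j
  have Am[measurable]: "A j \<in> sets M" for j unfolding A_def by measurable
  have "(\<lambda>j. prob (A j)) \<longlonglongrightarrow> prob (\<Union>j. A j)"
    by (rule finite_Lim_measure_incseq) (auto intro!: incseq_SucI simp: A_def)
  moreover have "(\<Union>j. A j) = space M" by (auto simp: A_def)
  ultimately have "(\<lambda>j. prob (A j)) \<longlonglongrightarrow> 1" by (simp add: prob_space)
  then have "eventually (\<lambda>j. 1 - \<delta> / 3 < prob (A j)) sequentially"
    by (rule order_tendstoD) (use \<delta> in auto)
  then obtain j where j: "1 - \<delta> / 3 < prob (A j)" by (auto simp: eventually_sequentially)
  \<comment> \<open>Adding one avoids a division by zero when \<open>j = 0\<close>.\<close>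
  define w where "w = real j + 1"
  have w: "0 < w" by (simp add: w_def)
  define s where "s = min (1 - K) (\<delta> / 3 / w)"
  have s: "0 < s" "s \<le> 1 - K" using K_less \<delta> w by (auto simp: s_def)
  have sj: "s * real j \<le> \<delta> / 3"
  proof -
    have "s * real j \<le> \<delta> / 3 / w * w"
      using \<delta> w by (intro mult_mono) (auto simp: s_def w_def)
    then show ?thesis using w by simp
  qed
  have L: "ennreal (1 - 2 * \<delta> / 3) \<le> (\<integral>\<^sup>+\<omega>. ennreal (exp (- s * real (X 0 \<omega>))) \<partial>M)"
  proof -
    have "1 - 2 * \<delta> / 3 \<le> (1 - \<delta> / 3) * (1 - \<delta> / 3)" by (simp add: algebra_simps)
    also have "\<dots> \<le> exp (- s * real j) * prob (A j)"
      using sj \<delta> j exp_ge_add_one_self[of "- s * real j"] by (intro mult_mono) auto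
    finally have "ennreal (1 - 2 * \<delta> / 3) \<le> ennreal (exp (- s * real j) * prob (A j))"
      by (rule ennreal_leI)
    also have "\<dots> = (\<integral>\<^sup>+\<omega>. ennreal (exp (- s * real j)) * indicator (A j) \<omega> \<partial>M)"
      by (simp add: nn_integral_cmult ennreal_mult emeasure_eq_measure)
    also have "\<dots> \<le> (\<integral>\<^sup>+\<omega>. ennreal (exp (- s * real (X 0 \<omega>))) \<partial>M)"
      using s by (intro nn_integral_mono) (auto simp: A_def indicator_def intro!: ennreal_leI)
    finally show ?thesis .
  qed
  \<comment> \<open>The solution of \<open>exp (- (s / 2) * c) = \<delta> / 3\<close>.\<close>
  define c where "c = 2 / s * ln (3 / \<delta>)"
  have c: "0 \<le> c" using s \<delta> by (simp add: c_def)
  have ec: "exp (- (s / 2) * c) = \<delta> / 3"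
    using s \<delta> by (simp add: c_def exp_minus)
  have "emeasure M {\<omega>\<in>space M. ennreal (c + mean_bound) < tail_mean r \<omega>} \<le> ennreal \<delta>" for r
  proof -
    let ?Q = "{\<omega>\<in>space M. ennreal (c + mean_bound) < tail_mean r \<omega>}"
    have "(\<integral>\<^sup>+\<omega>. ennreal (exp (- s * real (X r \<omega>))) \<partial>M) = (\<integral>\<^sup>+\<omega>. ennreal (exp (- s * real (X 0 \<omega>))) \<partial>M)"
      by (rule strictly_stationary_marginal[OF stationary X_rv, where f = "\<lambda>x. ennreal (exp (- s * real x))"])
    then have "ennreal (1 - 2 * \<delta> / 3) + emeasure M ?Q
      \<le> (\<integral>\<^sup>+\<omega>. ennreal (exp (- s * real (X r \<omega>))) \<partial>M) + emeasure M ?Q"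
      using L by (intro add_right_mono) simp
    also have "\<dots> \<le> 1 + ennreal (exp (- (s / 2) * c))"
      by (rule tail_mean_tight) (use s c in auto)
    finally have "ennreal (1 - 2 * \<delta> / 3) + emeasure M ?Q \<le> 1 + ennreal (\<delta> / 3)" unfolding ec .
    moreover have "ennreal (1 - 2 * \<delta> / 3) + emeasure M ?Q = ennreal (1 - 2 * \<delta> / 3 + prob ?Q)"
      using \<delta> by (simp add: emeasure_eq_measure)
    moreover have "1 + ennreal (\<delta> / 3) = ennreal (1 + \<delta> / 3)" using \<delta> by simp
    ultimately have "ennreal (1 - 2 * \<delta> / 3 + prob ?Q) \<le> ennreal (1 + \<delta> / 3)" by (simp only:)
    then have "1 - 2 * \<delta> / 3 + prob ?Q \<le> 1 + \<delta> / 3"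
      by (rule ennreal_le_iff[THEN iffD1, rotated]) (use \<delta> in simp)
    then have "prob ?Q \<le> \<delta>" by simp
    then show ?thesis by (simp add: emeasure_eq_measure ennreal_leI)
  qed
  moreover have "0 \<le> c + mean_bound" using c mean_bound_nonneg by simp
  ultimately show ?thesis by blast
qed

lemma emeasure_zero_if_small:
  assumes "\<And>\<delta>. 0 < \<delta> \<Longrightarrow> \<delta> \<le> 1 \<Longrightarrow> emeasure M B \<le> ennreal \<delta>"
  shows "emeasure M B = 0"
proof (rule ccontr)
  assume "emeasure M B \<noteq> 0"
  then have pos: "0 < prob B" by (simp add: emeasure_eq_measure zero_less_measure_iff)
  have "emeasure M B \<le> ennreal (prob B / 2)"
  proof (rule assms)
    show "0 < prob B / 2" using pos by simp
    show "prob B / 2 \<le> 1" using prob_le_1[of B] pos by linarith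
  qed
  then show False using pos by (simp add: emeasure_eq_measure)
qed

lemma tail_mean_finite: "AE \<omega> in M. tail_mean r \<omega> < \<top>"
proof -
  let ?B = "{\<omega>\<in>space M. \<not> tail_mean r \<omega> < \<top>}"
  have "emeasure M ?B = 0"
  proof (rule emeasure_zero_if_small)
    fix \<delta> :: real assume "0 < \<delta>" "\<delta> \<le> 1"
    then obtain c where c: "emeasure M {\<omega>\<in>space M. ennreal c < tail_mean r \<omega>} \<le> ennreal \<delta>"
      using tail_mean_uniformly_tight by blast
    have "emeasure M ?B \<le> emeasure M {\<omega>\<in>space M. ennreal c < tail_mean r \<omega>}"
      by (intro emeasure_mono) (auto simp: not_less top_unique)
    then show "emeasure M ?B \<le> ennreal \<delta>" using c by (rule order_trans)
  qed
  then show ?thesis by (subst AE_iff_measurable[OF _ refl]) auto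
qed

text \<open>Outside one null set, common to all \<open>r\<close>, the tail means form a real
  sequence to which the deterministic lemmas apply with \<open>g = \<alpha> 0\<close>.\<close>

lemma tail_mean_harmonic:
  "AE \<omega> in M. \<forall>r. tail_mean r \<omega> = ennreal (enn2real (tail_mean r \<omega>)) \<and>
     ((\<lambda>k. \<alpha> k * enn2real (tail_mean (r - int k) \<omega>)) has_sum (enn2real (tail_mean r \<omega>) - \<alpha> 0)) {1..}"
proof -
  have "AE \<omega> in M. \<forall>r. tail_mean r \<omega> = ennreal (\<alpha> 0) + (\<Sum>k. ennreal (\<alpha> (Suc k)) * tail_mean (r - int (Suc k)) \<omega>)"
    by (simp only: AE_all_countable) (intro allI tail_mean_equation)
  moreover have "AE \<omega> in M. \<forall>r. tail_mean r \<omega> < \<top>"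
    by (simp only: AE_all_countable) (intro allI tail_mean_finite)
  ultimately show ?thesis
  proof (eventually_elim, intro allI conjI)
    case (elim \<omega>)
    fix r
    define f where "f r = enn2real (tail_mean r \<omega>)" for r
    have f: "tail_mean r \<omega> = ennreal (f r)" for r
      using elim(2)[rule_format, of r] by (simp add: f_def)
    have f0: "0 \<le> f r" for r by (simp add: f_def)
    show "tail_mean r \<omega> = ennreal (enn2real (tail_mean r \<omega>))" using f by (simp add: f_def)
    let ?g = "\<lambda>k. \<alpha> (Suc k) * f (r - int (Suc k))"
    have eq: "ennreal (f r) = ennreal (\<alpha> 0) + (\<Sum>k. ennreal (?g k))"
      using elim(1)[rule_format, of r] unfolding f by (simp add: ennreal_mult \<alpha>_nonneg f0)
    then have "(\<Sum>k. ennreal (?g k)) \<noteq> \<top>" by (metis ennreal_add_eq_top ennreal_neq_top)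
    then have sm: "summable ?g"
      by (intro summable_suminf_not_top mult_nonneg_nonneg \<alpha>_nonneg f0)
    then have "(\<Sum>k. ennreal (?g k)) = ennreal (suminf ?g)"
      by (intro suminf_ennreal2 mult_nonneg_nonneg \<alpha>_nonneg f0)
    moreover have "0 \<le> suminf ?g" using sm by (intro suminf_nonneg mult_nonneg_nonneg \<alpha>_nonneg f0)
    ultimately have "f r = \<alpha> 0 + suminf ?g"
      using eq f0[of r] \<alpha>_nonneg[of 0] by (simp add: ennreal_plus[symmetric] del: ennreal_plus)
    then have "?g sums (f r - \<alpha> 0)" using sm by (simp add: sums_iff)
    then have "(?g has_sum (f r - \<alpha> 0)) UNIV"
      by (intro sums_nonneg_imp_has_sum mult_nonneg_nonneg \<alpha>_nonneg f0)
    then have "((\<lambda>k. \<alpha> k * f (r - int k)) has_sum (f r - \<alpha> 0)) {1..}"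
      using has_sum_Suc_iff[of "\<lambda>k. \<alpha> k * f (r - int k)"] by simp
    then show "((\<lambda>k. \<alpha> k * enn2real (tail_mean (r - int k) \<omega>)) has_sum (enn2real (tail_mean r \<omega>) - \<alpha> 0)) {1..}"
      by (simp add: f_def)
  qed
qed

text \<open>Divergence is a pathwise statement, tightness a bound at single times; the lower limit
  of the events \<open>D n\<close> connects them. Almost every path with an increase lies in all but
  finitely many \<open>D n\<close>, and by Fatou this has probability at most
  \<open>\<delta>\<close>.\<close>

lemma tail_mean_antimono:
  assumes a: "1 \<le> a" "0 < \<alpha> a"
  shows "AE \<omega> in M. tail_mean (r - int a) \<omega> \<le> tail_mean r \<omega>"
proof -
  let ?B = "{\<omega>\<in>space M. \<not> tail_mean (r - int a) \<omega> \<le> tail_mean r \<omega>}"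
  have "emeasure M ?B = 0"
  proof (rule emeasure_zero_if_small)
    fix \<delta> :: real assume "0 < \<delta>" "\<delta> \<le> 1"
    then obtain c where c0: "0 \<le> c"
      and c: "\<And>r. emeasure M {\<omega>\<in>space M. ennreal c < tail_mean r \<omega>} \<le> ennreal \<delta>"
      using tail_mean_uniformly_tight by blast
    define D where "D n = {\<omega>\<in>space M. ennreal c < tail_mean (r - int n * int a) \<omega>}" for n
    have [measurable]: "D n \<in> sets M" for n unfolding D_def by measurable
    have "emeasure M ?B \<le> emeasure M (\<Union>N. \<Inter>n\<in>{N..}. D n)"
    proof (rule emeasure_mono_AE)
      show "AE \<omega> in M. \<omega> \<in> ?B \<longrightarrow> \<omega> \<in> (\<Union>N. \<Inter>n\<in>{N..}. D n)"
        using tail_mean_harmonic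
      proof (eventually_elim, intro impI)
        fix \<omega>
        assume H: "\<forall>r. tail_mean r \<omega> = ennreal (enn2real (tail_mean r \<omega>)) \<and>
          ((\<lambda>k. \<alpha> k * enn2real (tail_mean (r - int k) \<omega>)) has_sum (enn2real (tail_mean r \<omega>) - \<alpha> 0)) {1..}"
          and B: "\<omega> \<in> ?B"
        define f where "f r = enn2real (tail_mean r \<omega>)" for r
        have f: "tail_mean r \<omega> = ennreal (f r)" for r unfolding f_def using H by blast
        have harm: "((\<lambda>k. \<alpha> k * f (r - int k)) has_sum (f r - \<alpha> 0)) {1..}" for r
          unfolding f_def using H by blast
        have w: "\<omega> \<in> space M" and "\<not> tail_mean (r - int a) \<omega> \<le> tail_mean r \<omega>" using B by auto
        then have "f r < f (r - int a)" unfolding f by (metis ennreal_leI not_le)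
        then obtain N where N: "\<forall>n\<ge>N. c < f (r - int n * int a)"
          using harmonic_increase_unbounded[where f = f and g = "\<alpha> 0" and \<alpha> = \<alpha> and a = a and r = r and c = c]
            \<alpha>_nonneg a alpha_le_one[OF a(1)] harm by (auto simp: f_def)
        have "\<omega> \<in> D n" if "n \<ge> N" for n
        proof -
          have "c < f (r - int n * int a)" using N that by blast
          then show ?thesis using w c0 by (simp add: D_def f ennreal_less_iff)
        qed
        then show "\<omega> \<in> (\<Union>N. \<Inter>n\<in>{N..}. D n)" by blast
      qed
      show "(\<Union>N. \<Inter>n\<in>{N..}. D n) \<in> sets M" by (auto intro!: sets.countable_UN sets.countable_INT)
    qed
    also have "\<dots> \<le> ennreal \<delta>"
      by (rule emeasure_eventually_le) (auto simp: D_def c)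
    finally show "emeasure M ?B \<le> ennreal \<delta>" .
  qed
  then show ?thesis by (subst AE_iff_measurable[OF _ refl]) auto
qed

lemma tail_mean_le: "AE \<omega> in M. tail_mean r \<omega> \<le> ennreal mean_bound"
proof -
  have "AE \<omega> in M. \<forall>k. ennreal (\<alpha> (Suc k)) * tail_mean (r - int (Suc k)) \<omega> \<le> ennreal (\<alpha> (Suc k)) * tail_mean r \<omega>"
    unfolding AE_all_countable
  proof
    fix k
    show "AE \<omega> in M. ennreal (\<alpha> (Suc k)) * tail_mean (r - int (Suc k)) \<omega> \<le> ennreal (\<alpha> (Suc k)) * tail_mean r \<omega>"
    \<comment> \<open>For lags of weight zero no comparison of tail means is available, but the
      product vanishes.\<close>
    proof (cases "\<alpha> (Suc k) = 0")
      case False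
      then have "0 < \<alpha> (Suc k)" using \<alpha>_nonneg[of "Suc k"] by simp
      then have "AE \<omega> in M. tail_mean (r - int (Suc k)) \<omega> \<le> tail_mean r \<omega>"
        by (intro tail_mean_antimono) auto
      then show ?thesis by eventually_elim (intro mult_left_mono, auto)
    qed simp
  qed
  with tail_mean_equation[of r] tail_mean_finite[of r] show ?thesis
  proof eventually_elim
    case (elim \<omega>)
    define t where "t = enn2real (tail_mean r \<omega>)"
    have t: "tail_mean r \<omega> = ennreal t" "0 \<le> t" using elim(2) by (auto simp: t_def)
    have "tail_mean r \<omega> \<le> ennreal (\<alpha> 0) + (\<Sum>k. ennreal (\<alpha> (Suc k)) * tail_mean r \<omega>)"
      by (subst (1) elim(1)) (intro add_left_mono suminf_le, use elim(3) in auto)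
    also have "\<dots> = ennreal (\<alpha> 0) + ennreal K * ennreal t"
      by (simp add: suminf_alpha t(1))
    also have "\<dots> = ennreal (\<alpha> 0 + K * t)"
      using K_nonneg t(2) \<alpha>_nonneg[of 0] by (simp add: ennreal_mult)
    finally have "t \<le> \<alpha> 0 + K * t"
      using K_nonneg t(2) \<alpha>_nonneg[of 0] unfolding t(1) by (simp del: ennreal_plus)
    then have "t \<le> mean_bound" using K_less by (simp add: mean_bound_def field_simps)
    then show ?case by (simp add: t ennreal_leI)
  qed
qed

lemma mean_X: "(\<integral>\<^sup>+\<omega>. of_nat (X r \<omega>) \<partial>M) = ennreal mean_bound"
proof -
  define e where "e = (\<integral>\<^sup>+\<omega>. of_nat (X 0 \<omega>) \<partial>M)"
  have e: "(\<integral>\<^sup>+\<omega>. of_nat (X r \<omega>) \<partial>M) = e" for r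
    unfolding e_def by (rule strictly_stationary_marginal[OF stationary X_rv])
  have "space M \<in> sets tail" by (metis sets.top space_tail)
  have "e = (\<integral>\<^sup>+\<omega>. of_nat (X 0 \<omega>) * indicator (space M) \<omega> \<partial>M)"
    unfolding e_def by (intro nn_integral_cong) (simp add: indicator_def)
  also have "\<dots> = (\<integral>\<^sup>+\<omega>. tail_mean 0 \<omega> * indicator (space M) \<omega> \<partial>M)"
    by (rule tail_mean_integral[symmetric]) fact
  also have "\<dots> \<le> (\<integral>\<^sup>+\<omega>. ennreal mean_bound \<partial>M)"
    by (intro nn_integral_mono_AE, use tail_mean_le[of 0] in eventually_elim) (auto simp: indicator_def)
  also have "\<dots> < \<top>" by (simp add: emeasure_space_1)
  finally obtain x where x: "e = ennreal x" "0 \<le> x" by (cases e) auto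
  \<comment> \<open>Now that \<open>e\<close> is finite, the equation
    \<open>e = \<alpha> 0 + K * e\<close> determines it.\<close>
  have "e = (\<integral>\<^sup>+\<omega>. of_nat (X 0 \<omega>) * 1 \<partial>M)" by (simp add: e_def)
  also have "\<dots> = (\<integral>\<^sup>+\<omega>. intensity 0 \<omega> * 1 \<partial>M)" by (rule mean_step) simp
  also have "\<dots> = ennreal (\<alpha> 0) + (\<Sum>k. ennreal (\<alpha> (Suc k)) * e)"
  proof -
    have "(\<integral>\<^sup>+\<omega>. intensity 0 \<omega> * 1 \<partial>M) = (\<integral>\<^sup>+\<omega>. ennreal (\<alpha> 0) \<partial>M)
      + (\<Sum>k. \<integral>\<^sup>+\<omega>. ennreal (\<alpha> (Suc k)) * of_nat (X (0 - int (Suc k)) \<omega>) \<partial>M)"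
      unfolding intensity_def mult_1_right
      by (subst nn_integral_add) (auto simp: nn_integral_suminf)
    then show ?thesis by (simp add: nn_integral_cmult e emeasure_space_1 del: of_nat_Suc)
  qed
  also have "\<dots> = ennreal (\<alpha> 0 + K * x)"
    using K_nonneg x(2) \<alpha>_nonneg[of 0] by (simp add: suminf_alpha x(1) ennreal_mult)
  finally have "x = \<alpha> 0 + K * x"
    using K_nonneg x(2) \<alpha>_nonneg[of 0] unfolding x(1) by (simp del: ennreal_plus)
  then have "x = mean_bound" using K_less by (simp add: mean_bound_def field_simps)
  then show ?thesis using x e by simp
qed

end

section \<open>The minimal solution\<close>

text \<open>A deterministic functional of a noise configuration \<open>v\<close>, so that
  stationarity can be read off from the law of the noise. Step \<open>m\<close> uses only lags up to
  \<open>m\<close>; all iterates are finite sums of naturals.\<close>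

primrec picard :: "nat \<Rightarrow> (noise_index \<Rightarrow> nat) \<Rightarrow> int \<Rightarrow> nat" where
  "picard 0 v n = 0"
| "picard (Suc m) v n = v (Inl n) + (\<Sum>k = 1..m. \<Sum>l = 1..picard m v (n - int k). v (Inr (n, k, l)))"

text \<open>Defined for every configuration to give a measurable function; on \<open>nat\<close> the
  supremum is informative only for bounded iterates, which holds almost surely by
  \<open>picard_bounded\<close>.\<close>

definition picard_limit :: "(noise_index \<Rightarrow> nat) \<Rightarrow> int \<Rightarrow> nat" where
  "picard_limit v n = Sup (range (\<lambda>m. picard m v n))"

definition noise_indices_on :: "int set \<Rightarrow> noise_index set" where
  "noise_indices_on T = (\<Union>n\<in>T. noise_indices_at n)"

definition time_shift :: "int \<Rightarrow> noise_index \<Rightarrow> noise_index" where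
  "time_shift h = map_sum (\<lambda>n. n + h) (\<lambda>(n, k, l). (n + h, k, l))"

lemma picard_Suc_mono: "picard m v n \<le> picard (Suc m) v n"
proof (induction m arbitrary: n)
  case (Suc m)
  have "(\<Sum>k = 1..m. \<Sum>l = 1..picard m v (n - int k). v (Inr (n, k, l)))
    \<le> (\<Sum>k = 1..m. \<Sum>l = 1..picard (Suc m) v (n - int k). v (Inr (n, k, l)))"
    by (intro sum_mono sum_mono2) (use Suc in auto)
  also have "\<dots> \<le> (\<Sum>k = 1..Suc m. \<Sum>l = 1..picard (Suc m) v (n - int k). v (Inr (n, k, l)))"
    by (intro sum_mono2) auto
  finally show ?case by (simp only: picard.simps)
qed simp

lemma picard_mono: "m \<le> m' \<Longrightarrow> picard m v n \<le> picard m' v n"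
  by (rule lift_Suc_mono_le[of "\<lambda>m. picard m v n"]) (rule picard_Suc_mono)

lemma picard_time_shift: "picard m (v \<circ> time_shift h) n = picard m v (n + h)"
proof (induction m arbitrary: n)
  case (Suc m)
  have "picard m (v \<circ> time_shift h) (n - int k) = picard m v (n + h - int k)" for k
    unfolding Suc by (simp add: algebra_simps)
  then show ?case by (simp only: picard.simps) (simp add: time_shift_def)
qed simp

lemma noise_indices_on_mono: "S \<subseteq> T \<Longrightarrow> noise_indices_on S \<subseteq> noise_indices_on T"
  unfolding noise_indices_on_def by (rule UN_mono) auto

lemma picard_cong:
  assumes "\<And>i. i \<in> noise_indices_on {..n} \<Longrightarrow> v i = w i"
  shows "picard m v n = picard m w n"
  using assms
proof (induction m arbitrary: n)
  case (Suc m)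
  have sub: "noise_indices_on {..n - int k} \<subseteq> noise_indices_on {..n}" for k by (rule noise_indices_on_mono) auto
  have IH: "picard m v (n - int k) = picard m w (n - int k)" for k
    by (rule Suc.IH) (use Suc.prems sub in blast)
  have e: "v (Inl n) = w (Inl n)"
    by (rule Suc.prems) (auto simp: noise_indices_on_def noise_indices_at_def)
  have x: "v (Inr (n, k, l)) = w (Inr (n, k, l))" if "1 \<le> k" "1 \<le> l" for k l
    by (rule Suc.prems) (use that in \<open>auto simp: noise_indices_on_def noise_indices_at_def\<close>)
  show ?case by (simp add: IH e) (intro sum.cong refl x, auto)
qed simp

lemma nat_add_measurable:
  fixes f g :: "'a \<Rightarrow> nat"
  assumes [measurable]: "f \<in> N \<rightarrow>\<^sub>M count_space UNIV" "g \<in> N \<rightarrow>\<^sub>M count_space UNIV"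
  shows "(\<lambda>x. f x + g x) \<in> N \<rightarrow>\<^sub>M count_space UNIV"
  by measurable

lemma picard_measurable:
  assumes "\<And>i. i \<in> noise_indices_on {..n} \<Longrightarrow> V i \<in> N \<rightarrow>\<^sub>M count_space UNIV"
  shows "(\<lambda>\<omega>. picard m (\<lambda>i. V i \<omega>) n) \<in> N \<rightarrow>\<^sub>M count_space UNIV"
  using assms
proof (induction m arbitrary: n)
  case (Suc m)
  have sub: "noise_indices_on {..n - int k} \<subseteq> noise_indices_on {..n}" for k by (rule noise_indices_on_mono) auto
  have IH: "(\<lambda>\<omega>. picard m (\<lambda>i. V i \<omega>) (n - int k)) \<in> N \<rightarrow>\<^sub>M count_space UNIV" for k
    by (rule Suc.IH) (use Suc.prems sub in blast)
  have e[measurable]: "V (Inl n) \<in> N \<rightarrow>\<^sub>M count_space UNIV"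
    by (rule Suc.prems) (auto simp: noise_indices_on_def noise_indices_at_def)
  have x: "V (Inr (n, k, l)) \<in> N \<rightarrow>\<^sub>M count_space UNIV" if "1 \<le> k" "1 \<le> l" for k l
    by (rule Suc.prems) (use that in \<open>auto simp: noise_indices_on_def noise_indices_at_def\<close>)
  have t: "(\<lambda>\<omega>. \<Sum>l = 1..picard m (\<lambda>i. V i \<omega>) (n - int k). V (Inr (n, k, l)) \<omega>) \<in> N \<rightarrow>\<^sub>M count_space UNIV"
    if "1 \<le> k" for k
    using thinning_measurable[of "\<lambda>l. V (Inr (n, k, l))", OF x IH] that by (simp add: thinning_def[abs_def])
  have "(\<lambda>\<omega>. \<Sum>k = 1..p. \<Sum>l = 1..picard m (\<lambda>i. V i \<omega>) (n - int k). V (Inr (n, k, l)) \<omega>) \<in> N \<rightarrow>\<^sub>M count_space UNIV"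
    for p
  proof (induction p)
    case (Suc p)
    from nat_add_measurable[OF Suc t[of "Suc p"]] show ?case by simp
  qed simp
  then have [measurable]: "(\<lambda>\<omega>. \<Sum>k = 1..m. \<Sum>l = 1..picard m (\<lambda>i. V i \<omega>) (n - int k). V (Inr (n, k, l)) \<omega>) \<in> N \<rightarrow>\<^sub>M count_space UNIV" .
  show ?case unfolding picard.simps by measurable
qed simp

lemma picard_limit_measurable:
  assumes "\<And>i. i \<in> noise_indices_on {..n} \<Longrightarrow> V i \<in> N \<rightarrow>\<^sub>M count_space UNIV"
  shows "(\<lambda>\<omega>. picard_limit (\<lambda>i. V i \<omega>) n) \<in> N \<rightarrow>\<^sub>M count_space UNIV"
proof -
  have [measurable]: "(\<lambda>\<omega>. picard m (\<lambda>i. V i \<omega>) n) \<in> N \<rightarrow>\<^sub>M count_space UNIV" for m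
    by (rule picard_measurable[OF assms])
  have "(\<lambda>\<omega>. Sup {i. \<exists>m. i = picard m (\<lambda>i. V i \<omega>) n}) \<in> N \<rightarrow>\<^sub>M count_space UNIV"
    by measurable
  then show ?thesis by (simp add: picard_limit_def full_SetCompr_eq)
qed

text \<open>A bounded nondecreasing sequence of naturals is eventually constant.\<close>

lemma picard_limit_attained:
  assumes bdd: "\<And>m. picard m v n \<le> B"
  shows "\<exists>m0. \<forall>m\<ge>m0. picard m v n = picard_limit v n"
proof -
  have fin: "finite (range (\<lambda>m. picard m v n))"
    by (rule finite_subset[of _ "{..B}"]) (use bdd in auto)
  have lim: "picard_limit v n = Max (range (\<lambda>m. picard m v n))"
    by (simp add: picard_limit_def Sup_nat_def)
  have "picard_limit v n \<in> range (\<lambda>m. picard m v n)"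
    unfolding lim by (rule Max_in[OF fin]) simp
  then obtain m0 where m0: "picard_limit v n = picard m0 v n" by blast
  have "picard m v n = picard_limit v n" if "m \<ge> m0" for m
  proof (rule antisym)
    show "picard m v n \<le> picard_limit v n" unfolding lim by (rule Max_ge[OF fin]) simp
    show "picard_limit v n \<le> picard m v n" unfolding m0 by (rule picard_mono[OF that])
  qed
  then show ?thesis by blast
qed

text \<open>Equality for all large \<open>p\<close> contains the convergence of the series: all but
  finitely many lags contribute zero.\<close>

lemma picard_limit_equation:
  assumes bdd: "\<And>n. \<exists>B. \<forall>m. picard m v n \<le> B"
  shows "\<exists>m. \<forall>p\<ge>m. picard_limit v n = v (Inl n) + (\<Sum>k = 1..p. \<Sum>l = 1..picard_limit v (n - int k). v (Inr (n, k, l)))"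
proof -
  let ?Z = "picard_limit v" and ?T = "\<lambda>k. \<Sum>l = 1..picard_limit v (n - int k). v (Inr (n, k, l))"
  have att: "\<exists>m0. \<forall>m\<ge>m0. picard m v n = ?Z n" for n
    using bdd[of n] picard_limit_attained by metis
  then obtain m0 where m0: "\<And>n m. m \<ge> m0 n \<Longrightarrow> picard m v n = ?Z n" by metis
  have le: "picard m v n \<le> ?Z n" for m n
    using picard_mono[of m "max m (m0 n)" v n] m0[of n "max m (m0 n)"] by simp
  have upper: "?Z n \<le> v (Inl n) + (\<Sum>k = 1..p. ?T k)" if "p \<ge> m0 n" for p
  proof -
    have "?Z n = picard (Suc p) v n" using m0[of n "Suc p"] that by simp
    also have "\<dots> \<le> v (Inl n) + (\<Sum>k = 1..p. ?T k)"
      unfolding picard.simps by (intro add_left_mono sum_mono sum_mono2) (use le in auto)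
    finally show ?thesis .
  qed
  have lower: "v (Inl n) + (\<Sum>k = 1..p. ?T k) \<le> ?Z n" for p
  proof -
    \<comment> \<open>The sum dominates each \<open>m0 (n - k)\<close>, so at step \<open>m\<close>
      all the values at lags up to \<open>p\<close> are already stationary.\<close>
    define m where "m = max p (\<Sum>k = 1..p. m0 (n - int k))"
    have "picard m v (n - int k) = ?Z (n - int k)" if "k \<in> {1..p}" for k
    proof -
      have "m0 (n - int k) \<le> (\<Sum>k = 1..p. m0 (n - int k))" using that by (intro member_le_sum) auto
      then show ?thesis by (intro m0) (simp add: m_def)
    qed
    then have "(\<Sum>k = 1..p. ?T k) = (\<Sum>k = 1..p. \<Sum>l = 1..picard m v (n - int k). v (Inr (n, k, l)))"
      by (intro sum.cong refl) auto
    also have "\<dots> \<le> (\<Sum>k = 1..m. \<Sum>l = 1..picard m v (n - int k). v (Inr (n, k, l)))"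
      by (intro sum_mono2) (auto simp: m_def)
    finally have "v (Inl n) + (\<Sum>k = 1..p. ?T k) \<le> picard (Suc m) v n" by simp
    then show ?thesis using le[of "Suc m" n] by simp
  qed
  show ?thesis using upper lower by (intro exI[of _ "m0 n"]) (auto intro: antisym)
qed

section \<open>Almost sure existence of the minimal solution\<close>

context inar
begin

definition minimal_solution :: "int \<Rightarrow> 'a \<Rightarrow> nat" where
  "minimal_solution n \<omega> = picard_limit (\<lambda>i. noise \<epsilon> \<xi> i \<omega>) n"

definition noise_past :: "int \<Rightarrow> 'a measure" where
  "noise_past n = generated_algebra M (noise \<epsilon> \<xi>) (noise_indices_on {..<n})"

lemma space_noise_past [simp]: "space (noise_past n) = space M"
  by (simp add: noise_past_def)

lemma noise_rv: "i \<in> all_indices \<Longrightarrow> noise \<epsilon> \<xi> i \<in> M \<rightarrow>\<^sub>M count_space UNIV"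
  using indep_noise unfolding indep_vars_def by blast

lemma noise_indices_on_subset: "noise_indices_on T \<subseteq> all_indices"
  by (auto simp: noise_indices_on_def)

lemma picard_noise_past:
  assumes "j < n"
  shows "(\<lambda>\<omega>. picard m (\<lambda>i. noise \<epsilon> \<xi> i \<omega>) j) \<in> noise_past n \<rightarrow>\<^sub>M count_space UNIV"
    and "minimal_solution j \<in> noise_past n \<rightarrow>\<^sub>M count_space UNIV"
proof -
  have sub: "noise_indices_on {..j} \<subseteq> noise_indices_on {..<n}" by (rule noise_indices_on_mono) (use assms in auto)
  have V: "noise \<epsilon> \<xi> i \<in> noise_past n \<rightarrow>\<^sub>M count_space UNIV" if "i \<in> noise_indices_on {..j}" for i
    unfolding noise_past_def by (rule measurable_generated_algebra) (use that sub in blast)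
  show "(\<lambda>\<omega>. picard m (\<lambda>i. noise \<epsilon> \<xi> i \<omega>) j) \<in> noise_past n \<rightarrow>\<^sub>M count_space UNIV"
    by (rule picard_measurable[OF V])
  show "minimal_solution j \<in> noise_past n \<rightarrow>\<^sub>M count_space UNIV"
    unfolding minimal_solution_def[abs_def] by (rule picard_limit_measurable[OF V])
qed

lemma subalgebra_noise_past: "subalgebra M (noise_past n)"
  unfolding noise_past_def
  by (rule generated_algebra_least) (simp, rule noise_rv, use noise_indices_on_subset in blast)

lemma picard_rv [measurable]: "(\<lambda>\<omega>. picard m (\<lambda>i. noise \<epsilon> \<xi> i \<omega>) n) \<in> M \<rightarrow>\<^sub>M count_space UNIV"
  by (rule measurable_from_subalg[OF subalgebra_noise_past[of "n + 1"] picard_noise_past(1)]) simp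

lemma minimal_solution_rv [measurable]: "minimal_solution n \<in> M \<rightarrow>\<^sub>M count_space UNIV"
  by (rule measurable_from_subalg[OF subalgebra_noise_past[of "n + 1"] picard_noise_past(2)]) simp

text \<open>The two index blocks differ in their time coordinate, and an independent family may be
  grouped over disjoint blocks.\<close>

lemma indep_noise_at_noise_past: "indep_set (sets (noise_at n)) (sets (noise_past n))"
proof -
  let ?A = "noise_indices_at n" and ?B = "noise_indices_on {..<n}"
  let ?E = "\<lambda>i. {noise \<epsilon> \<xi> i -` C \<inter> space M | C. C \<in> sets (count_space (UNIV :: nat set))}"
  have disj: "?A \<inter> ?B = {}" by (auto simp: noise_indices_on_def noise_indices_at_def)
  have "indep_vars (\<lambda>_. count_space UNIV) (noise \<epsilon> \<xi>) (\<Union>b\<in>UNIV. case_bool ?A ?B b)"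
    by (rule indep_vars_subset[OF indep_noise]) (auto split: bool.splits simp: noise_indices_on_def)
  then have "indep_sets ?E (\<Union>b\<in>UNIV. case_bool ?A ?B b)" by (simp add: indep_vars_def2)
  then have "indep_sets (\<lambda>b. sigma_sets (space M) (\<Union>i\<in>case_bool ?A ?B b. ?E i)) UNIV"
  proof (rule indep_sets_collect_sigma)
    show "Int_stable (?E i)" for i
    proof (rule Int_stableI)
      fix a b assume "a \<in> ?E i" "b \<in> ?E i"
      then obtain C D where "a = noise \<epsilon> \<xi> i -` C \<inter> space M" "b = noise \<epsilon> \<xi> i -` D \<inter> space M" by auto
      then have "a \<inter> b = noise \<epsilon> \<xi> i -` (C \<inter> D) \<inter> space M" by auto
      then show "a \<inter> b \<in> ?E i" by (intro CollectI exI[of _ "C \<inter> D"] conjI) simp_all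
    qed
    show "disjoint_family_on (case_bool ?A ?B) UNIV"
      using disj by (auto simp: disjoint_family_on_def split: bool.splits)
  qed
  moreover have "(\<Union>i\<in>I. ?E i) = {noise \<epsilon> \<xi> i -` C \<inter> space M | i C. i \<in> I}" for I by auto
  ultimately have "indep_sets (\<lambda>b. generated_events M (noise \<epsilon> \<xi>) (case_bool ?A ?B b)) UNIV"
    by (simp add: generated_events_def)
  also have "(\<lambda>b. generated_events M (noise \<epsilon> \<xi>) (case_bool ?A ?B b))
      = case_bool (generated_events M (noise \<epsilon> \<xi>) ?A) (generated_events M (noise \<epsilon> \<xi>) ?B)"
    by (auto split: bool.splits)
  finally show ?thesis
    by (simp add: indep_set_def noise_at_def noise_past_def sets_generated_algebra)
qed

text \<open>The bound is the fixed point of \<open>b = \<alpha> 0 + K * b\<close>, so it reproduces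
  itself under a Picard step.\<close>

lemma picard_mean_le: "(\<integral>\<^sup>+\<omega>. of_nat (picard m (\<lambda>i. noise \<epsilon> \<xi> i \<omega>) n) \<partial>M) \<le> ennreal (\<alpha> 0 / (1 - K))"
proof (induction m arbitrary: n)
  case (Suc m)
  let ?P = "\<lambda>m n \<omega>. picard m (\<lambda>i. noise \<epsilon> \<xi> i \<omega>) n" and ?b = "ennreal (\<alpha> 0 / (1 - K))"
  \<comment> \<open>Setting the lags beyond \<open>m\<close> to zero turns the truncated sum into
    the full series of \<open>one_step_mean\<close>.\<close>
  define Y where "Y k \<omega> = (if k \<le> m then ?P m (n - int k) \<omega> else 0)" for k \<omega>
  have Y: "Y k \<in> noise_past n \<rightarrow>\<^sub>M count_space UNIV" if "1 \<le> k" for k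
    unfolding Y_def[abs_def] using picard_noise_past(1)[of "n - int k" n m] that
    by (cases "k \<le> m") auto
  have YM[measurable]: "Y (Suc k) \<in> M \<rightarrow>\<^sub>M count_space UNIV" for k
    by (rule measurable_from_subalg[OF subalgebra_noise_past Y]) simp
  have Ymean: "(\<integral>\<^sup>+\<omega>. of_nat (Y (Suc k) \<omega>) \<partial>M) \<le> ?b" for k
    unfolding Y_def using Suc.IH by (cases "Suc k \<le> m") auto
  have "(of_nat (?P (Suc m) n \<omega>) :: ennreal)
      = of_nat (\<epsilon> n \<omega>) + (\<Sum>k. of_nat (thinning (\<xi> n (Suc k)) (Y (Suc k)) \<omega>))" for \<omega>
  proof -
    have "(\<Sum>k. of_nat (thinning (\<xi> n (Suc k)) (Y (Suc k)) \<omega>))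
       = (\<Sum>k<m. of_nat (thinning (\<xi> n (Suc k)) (Y (Suc k)) \<omega>) :: ennreal)"
      by (rule suminf_finite) (auto simp: Y_def thinning_def)
    also have "\<dots> = of_nat (\<Sum>k = 1..m. \<Sum>l = 1..?P m (n - int k) \<omega>. \<xi> n k l \<omega>)"
      unfolding of_nat_sum by (simp add: sum.atLeast1_atMost_eq Y_def thinning_def del: of_nat_Suc)
    finally show ?thesis by (simp add: noise_def)
  qed
  then have "(\<integral>\<^sup>+\<omega>. of_nat (?P (Suc m) n \<omega>) \<partial>M)
    = (\<integral>\<^sup>+\<omega>. (of_nat (\<epsilon> n \<omega>) + (\<Sum>k. of_nat (thinning (\<xi> n (Suc k)) (Y (Suc k)) \<omega>))) * 1 \<partial>M)"
    by simp
  also have "\<dots> = (\<integral>\<^sup>+\<omega>. (ennreal (\<alpha> 0) + (\<Sum>k. ennreal (\<alpha> (Suc k)) * of_nat (Y (Suc k) \<omega>))) * 1 \<partial>M)"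
    by (rule one_step_mean[OF indep_noise_at_noise_past, where Y = Y]) (auto intro: Y)
  also have "\<dots> = ennreal (\<alpha> 0) + (\<Sum>k. ennreal (\<alpha> (Suc k)) * (\<integral>\<^sup>+\<omega>. of_nat (Y (Suc k) \<omega>) \<partial>M))"
    unfolding mult_1_right
    by (subst nn_integral_add) (auto simp: nn_integral_suminf nn_integral_cmult emeasure_space_1)
  also have "\<dots> \<le> ennreal (\<alpha> 0) + (\<Sum>k. ennreal (\<alpha> (Suc k)) * ?b)"
    by (intro add_left_mono suminf_le mult_left_mono Ymean) auto
  also have "\<dots> = ennreal (\<alpha> 0) + ennreal K * ?b"
    by (simp add: suminf_alpha)
  also have "ennreal K * ?b = ennreal (K * (\<alpha> 0 / (1 - K)))"
    using K_nonneg K_less \<alpha>_nonneg[of 0] by (intro ennreal_mult[symmetric]) auto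
  also have "ennreal (\<alpha> 0) + \<dots> = ennreal (\<alpha> 0 + K * (\<alpha> 0 / (1 - K)))"
    using K_nonneg K_less \<alpha>_nonneg[of 0] by (intro ennreal_plus[symmetric] mult_nonneg_nonneg divide_nonneg_nonneg) auto
  also have "\<alpha> 0 + K * (\<alpha> 0 / (1 - K)) = \<alpha> 0 / (1 - K)"
    using K_less by (simp add: field_simps)
  finally show ?case .
qed simp

lemma picard_bounded: "AE \<omega> in M. \<forall>n. \<exists>B. \<forall>m. picard m (\<lambda>i. noise \<epsilon> \<xi> i \<omega>) n \<le> B"
  unfolding AE_all_countable
proof
  fix n
  let ?P = "\<lambda>m \<omega>. (of_nat (picard m (\<lambda>i. noise \<epsilon> \<xi> i \<omega>) n) :: ennreal)"
  have "(\<integral>\<^sup>+\<omega>. (SUP m. ?P m \<omega>) \<partial>M) = (SUP m. \<integral>\<^sup>+\<omega>. ?P m \<omega> \<partial>M)"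
    by (rule nn_integral_monotone_convergence_SUP) (auto intro!: incseq_SucI le_funI simp: picard_Suc_mono simp del: picard.simps)
  also have "\<dots> \<le> ennreal (\<alpha> 0 / (1 - K))" by (rule SUP_least) (rule picard_mean_le)
  also have "\<dots> < \<infinity>" by simp
  finally have "(\<integral>\<^sup>+\<omega>. (SUP m. ?P m \<omega>) \<partial>M) \<noteq> \<infinity>" by simp
  then have "AE \<omega> in M. (SUP m. ?P m \<omega>) \<noteq> \<infinity>"
    by (intro nn_integral_PInf_AE) measurable
  then show "AE \<omega> in M. \<exists>B. \<forall>m. picard m (\<lambda>i. noise \<epsilon> \<xi> i \<omega>) n \<le> B"
  proof eventually_elim
    case (elim \<omega>)
    then obtain B where B: "(SUP m. ?P m \<omega>) < of_nat B"
      using ennreal_Ex_less_of_nat by (metis infinity_ennreal_def top.not_eq_extremum)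
    have "?P m \<omega> \<le> of_nat B" for m
      using SUP_upper[of m UNIV "\<lambda>m. ?P m \<omega>"] B by (metis UNIV_I less_imp_le order_trans)
    then show ?case by (intro exI[of _ B]) (simp only: of_nat_le_iff, simp)
  qed
qed

lemma minimal_solution_solves: "inar_solution M \<epsilon> \<xi> minimal_solution"
  unfolding inar_solution_def
proof (intro conjI allI)
  show "minimal_solution n \<in> M \<rightarrow>\<^sub>M count_space UNIV" for n by (rule minimal_solution_rv)
  show "indep_set (generated_events M (noise \<epsilon> \<xi>) (noise_indices_at n)) (generated_events M minimal_solution {..<n})" for n
  proof -
    have "subalgebra (noise_past n) (generated_algebra M minimal_solution {..<n})"
      by (rule generated_algebra_least) (auto intro: picard_noise_past)
    then have "generated_events M minimal_solution {..<n} \<subseteq> sets (noise_past n)"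
      by (simp add: subalgebra_def sets_generated_algebra)
    then show ?thesis
      using indep_noise_at_noise_past[of n]
      unfolding indep_sets2_eq noise_at_def sets_generated_algebra by blast
  qed
  show "AE \<omega> in M. \<forall>n. (\<lambda>k. real (thinning (\<xi> n k) (minimal_solution (n - int k)) \<omega>)) summable_on {1..} \<and>
      real (\<epsilon> n \<omega>) = real (minimal_solution n \<omega>) - (\<Sum>\<^sub>\<infinity>k\<in>{1..}. real (thinning (\<xi> n k) (minimal_solution (n - int k)) \<omega>))"
    using picard_bounded
  proof (eventually_elim, intro allI)
    case (elim \<omega>)
    fix n
    let ?T = "\<lambda>k. thinning (\<xi> n k) (minimal_solution (n - int k)) \<omega>"
    obtain m where m: "\<And>p. p \<ge> m \<Longrightarrow> minimal_solution n \<omega> = \<epsilon> n \<omega> + (\<Sum>k = 1..p. ?T k)"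
      using picard_limit_equation[of "\<lambda>i. noise \<epsilon> \<xi> i \<omega>" n] elim
      by (auto simp: minimal_solution_def thinning_def noise_def)
    \<comment> \<open>Two consecutive partial sums beyond \<open>m\<close> agree, so their
      difference \<open>?T k\<close> vanishes.\<close>
    have zero: "?T k = 0" if "k > m" for k
    proof -
      define p where "p = k - 1"
      have p: "k = Suc p" "p \<ge> m" using that by (auto simp: p_def)
      show ?thesis using m[of p] m[of "Suc p"] p by simp
    qed
    have "((\<lambda>k. real (?T k)) has_sum (\<Sum>k = 1..m. real (?T k))) {1..}"
      by (rule has_sum_finite_neutralI) (auto simp: zero)
    moreover have "(\<Sum>k = 1..m. real (?T k)) = real (minimal_solution n \<omega>) - real (\<epsilon> n \<omega>)"
      using m[of m] by simp
    ultimately have "((\<lambda>k. real (?T k)) has_sum (real (minimal_solution n \<omega>) - real (\<epsilon> n \<omega>))) {1..}" by simp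
    then show "(\<lambda>k. real (?T k)) summable_on {1..} \<and>
       real (\<epsilon> n \<omega>) = real (minimal_solution n \<omega>) - (\<Sum>\<^sub>\<infinity>k\<in>{1..}. real (?T k))"
      by (auto simp: has_sum_imp_summable infsumI)
  qed
qed

section \<open>Shift invariance of the noise and stationarity\<close>

definition noise_law :: "noise_index \<Rightarrow> nat measure" where
  "noise_law i = measure_pmf (case i of Inl n \<Rightarrow> Pois (\<alpha> 0) | Inr (n, k, l) \<Rightarrow> Pois (\<alpha> k))"

lemma distr_noise: "i \<in> all_indices \<Longrightarrow> distr M (count_space UNIV) (noise \<epsilon> \<xi> i) = noise_law i"
  using law_eps law_xi by (auto simp: noise_indices_at_def noise_def noise_law_def has_law_def)

lemma time_shift_index: "time_shift h i \<in> all_indices \<longleftrightarrow> i \<in> all_indices"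
  by (cases i) (auto simp: time_shift_def noise_indices_at_def)

lemma inj_time_shift: "inj (time_shift h)"
  unfolding time_shift_def by (intro sum.inj_map) (auto simp: inj_def)

lemma noise_law_time_shift: "noise_law (time_shift h i) = noise_law i"
  by (cases i) (auto simp: noise_law_def time_shift_def)

text \<open>Independence survives the injective relabelling of indices and the marginals do not
  depend on time; the right side no longer contains \<open>h\<close>.\<close>

lemma distr_shifted_noise:
  "distr M (PiM all_indices (\<lambda>_. count_space UNIV)) (\<lambda>\<omega>. \<lambda>i\<in>all_indices. noise \<epsilon> \<xi> (time_shift h i) \<omega>)
    = PiM all_indices noise_law"
proof -
  let ?C = "\<lambda>_::noise_index. count_space (UNIV :: nat set)"
  have ne: "all_indices \<noteq> {}" by (auto simp: noise_indices_at_def)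
  have rv: "noise \<epsilon> \<xi> (time_shift h i) \<in> M \<rightarrow>\<^sub>M count_space UNIV" if "i \<in> all_indices" for i
    by (rule noise_rv) (use that time_shift_index in blast)
  have "indep_vars ?C (\<lambda>i. noise \<epsilon> \<xi> (time_shift h i)) all_indices"
    unfolding indep_vars_def
  proof (intro conjI ballI)
    show "random_variable (count_space UNIV) (noise \<epsilon> \<xi> (time_shift h i))" if "i \<in> all_indices" for i
      by (rule rv[OF that])
    let ?F = "\<lambda>i. sigma_sets (space M) {noise \<epsilon> \<xi> i -` A \<inter> space M | A. A \<in> sets (?C i)}"
    have F: "indep_sets ?F all_indices" using indep_noise by (simp add: indep_vars_def)
    show "indep_sets (\<lambda>i. sigma_sets (space M)
        {noise \<epsilon> \<xi> (time_shift h i) -` A \<inter> space M | A. A \<in> sets (count_space UNIV)}) all_indices"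
    proof (rule indep_setsI)
      fix i assume "i \<in> all_indices"
      then have "time_shift h i \<in> all_indices" using time_shift_index by blast
      then show "sigma_sets (space M) {noise \<epsilon> \<xi> (time_shift h i) -` A \<inter> space M | A. A \<in> sets (count_space UNIV)} \<subseteq> events"
        using F unfolding indep_sets_def by blast
    next
      fix A J assume J: "J \<noteq> {}" "J \<subseteq> all_indices" "finite J"
        "\<forall>j\<in>J. A j \<in> sigma_sets (space M) {noise \<epsilon> \<xi> (time_shift h j) -` A \<inter> space M | A. A \<in> sets (count_space UNIV)}"
      let ?g = "inv (time_shift h)"
      have g: "?g (time_shift h j) = j" for j by (rule inv_f_f[OF inj_time_shift])
      have "prob (\<Inter>j\<in>time_shift h ` J. A (?g j)) = (\<Prod>j\<in>time_shift h ` J. prob (A (?g j)))"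
        by (rule indep_setsD[OF F]) (use J time_shift_index g in auto)
      then show "prob (\<Inter>j\<in>J. A j) = (\<Prod>j\<in>J. prob (A j))"
        by (simp add: g prod.reindex[OF inj_on_subset[OF inj_time_shift subset_UNIV]])
    qed
  qed
  then have "distr M (PiM all_indices ?C) (\<lambda>\<omega>. \<lambda>i\<in>all_indices. noise \<epsilon> \<xi> (time_shift h i) \<omega>)
    = PiM all_indices (\<lambda>i. distr M (count_space UNIV) (noise \<epsilon> \<xi> (time_shift h i)))"
    using indep_vars_iff_distr_eq_PiM'[OF ne, where M' = ?C and X = "\<lambda>i. noise \<epsilon> \<xi> (time_shift h i)"] rv by simp
  also have "\<dots> = PiM all_indices noise_law"
    by (rule PiM_cong[OF refl]) (metis distr_noise noise_law_time_shift time_shift_index)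
  finally show ?thesis .
qed

lemma minimal_solution_stationary: "strictly_stationary M minimal_solution"
  unfolding strictly_stationary_def
proof
  fix h
  let ?C = "\<lambda>_::noise_index. count_space (UNIV :: nat set)" and ?S = "PiM UNIV (\<lambda>_::int. count_space (UNIV :: nat set))"
  let ?R = "\<lambda>h \<omega>. \<lambda>i\<in>all_indices. noise \<epsilon> \<xi> (time_shift h i) \<omega>"
  have R: "?R h \<in> M \<rightarrow>\<^sub>M PiM all_indices ?C" for h
    by (rule measurable_restrict) (use noise_rv time_shift_index in blast)
  have L: "(\<lambda>v n. picard_limit v n) \<in> PiM all_indices ?C \<rightarrow>\<^sub>M ?S"
  proof (rule measurable_PiM_single')
    show "(\<lambda>v. picard_limit v n) \<in> PiM all_indices ?C \<rightarrow>\<^sub>M count_space UNIV" for n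
      by (rule picard_limit_measurable[where V = "\<lambda>i v. v i"])
         (rule measurable_component_singleton, use noise_indices_on_subset in blast)
  qed auto
  \<comment> \<open>Shifting the solution is evaluating one fixed functional at the shifted noise.
    Restriction to \<open>all_indices\<close> is harmless because the iterates read no other
    index.\<close>
  have shifted: "(\<lambda>n. minimal_solution (n + h) \<omega>) = (\<lambda>n. picard_limit (?R h \<omega>) n)" for h \<omega>
  proof
    fix n
    have "picard m (\<lambda>i. noise \<epsilon> \<xi> i \<omega>) (n + h) = picard m (?R h \<omega>) n" for m
    proof -
      have "picard m (\<lambda>i. noise \<epsilon> \<xi> i \<omega>) (n + h) = picard m ((\<lambda>i. noise \<epsilon> \<xi> i \<omega>) \<circ> time_shift h) n"
        by (rule picard_time_shift[symmetric])
      also have "\<dots> = picard m (?R h \<omega>) n"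
        by (rule picard_cong) (use noise_indices_on_subset in auto)
      finally show ?thesis .
    qed
    then show "minimal_solution (n + h) \<omega> = picard_limit (?R h \<omega>) n" by (simp add: minimal_solution_def picard_limit_def)
  qed
  have "distr M ?S (\<lambda>\<omega> n. minimal_solution (n + h) \<omega>) = distr (PiM all_indices noise_law) ?S (\<lambda>v n. picard_limit v n)" for h
  proof -
    have "distr M ?S (\<lambda>\<omega> n. minimal_solution (n + h) \<omega>) = distr (distr M (PiM all_indices ?C) (?R h)) ?S (\<lambda>v n. picard_limit v n)"
      unfolding shifted by (subst distr_distr[OF L R]) (simp add: comp_def)
    then show ?thesis by (simp only: distr_shifted_noise)
  qed
  from this[of h] this[of 0]
  show "distr M ?S (\<lambda>\<omega> n. minimal_solution (n + h) \<omega>) = distr M ?S (\<lambda>\<omega> n. minimal_solution n \<omega>)" by simp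
qed

end

section \<open>Comparison of solutions\<close>

context inar_process
begin

text \<open>Every iterate stays below \<open>X\<close>: thinnings are monotone in the number of
  summands, and truncating the lags drops nonnegative terms.\<close>

lemma minimal_solution_le: "AE \<omega> in M. \<forall>n. minimal_solution n \<omega> \<le> X n \<omega>"
  using equation picard_bounded
proof (eventually_elim)
  case (elim \<omega>)
  let ?v = "\<lambda>i. noise \<epsilon> \<xi> i \<omega>"
  have v: "?v (Inr (n, k, l)) = \<xi> n k l \<omega>" "?v (Inl n) = \<epsilon> n \<omega>" for n k l
    by (simp_all add: noise_def)
  have le: "picard m ?v n \<le> X n \<omega>" for m n
  proof (induction m arbitrary: n)
    case (Suc m)
    have "(\<Sum>k = 1..m. \<Sum>l = 1..picard m ?v (n - int k). ?v (Inr (n, k, l)))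
      \<le> (\<Sum>k = 1..m. thinning (\<xi> n k) (X (n - int k)) \<omega>)"
      unfolding thinning_def v by (intro sum_mono sum_mono2) (use Suc in auto)
    then have "(of_nat (picard (Suc m) ?v n) :: ennreal)
      \<le> of_nat (\<epsilon> n \<omega> + (\<Sum>k = 1..m. thinning (\<xi> n k) (X (n - int k)) \<omega>))"
      by (intro of_nat_mono) (simp add: v)
    also have "\<dots> = of_nat (\<epsilon> n \<omega>) + (\<Sum>k<m. of_nat (thinning (\<xi> n (Suc k)) (X (n - int (Suc k))) \<omega>))"
      by (simp add: sum.atLeast1_atMost_eq)
    also have "\<dots> \<le> of_nat (\<epsilon> n \<omega>) + (\<Sum>k. of_nat (thinning (\<xi> n (Suc k)) (X (n - int (Suc k))) \<omega>))"
      by (intro add_left_mono sum_le_suminf) auto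
    also have "\<dots> = of_nat (X n \<omega>)" using elim(1) by simp
    finally show ?case by (simp only: of_nat_le_iff)
  qed simp
  show ?case
  proof
    fix n
    obtain m where "picard m ?v n = minimal_solution n \<omega>"
      using picard_limit_attained[of ?v n "X n \<omega>", OF le] by (auto simp: minimal_solution_def)
    then show "minimal_solution n \<omega> \<le> X n \<omega>" using le[of m n] by simp
  qed
qed

end

context stationary_inar_process
begin

lemma integrable_X: "integrable M (\<lambda>\<omega>. real (X n \<omega>))"
  and expectation_X: "(\<integral>\<omega>. real (X n \<omega>) \<partial>M) = mean_bound"
proof -
  have *: "(\<integral>\<^sup>+\<omega>. ennreal (real (X n \<omega>)) \<partial>M) = ennreal mean_bound"
    using mean_X by (simp add: ennreal_of_nat_eq_real_of_nat)
  then show "integrable M (\<lambda>\<omega>. real (X n \<omega>))"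
    by (intro integrableI_nonneg) auto
  show "(\<integral>\<omega>. real (X n \<omega>) \<partial>M) = mean_bound"
    by (rule integral_eq_nn_integral[THEN trans]) (auto simp: * mean_bound_nonneg)
qed

lemma X_eq_minimal_solution: "AE \<omega> in M. \<forall>n. X n \<omega> = minimal_solution n \<omega>"
  unfolding AE_all_countable
proof
  fix n
  \<comment> \<open>The minimal solution is itself a stationary solution, so it has the same finite
    mean as \<open>X\<close>.\<close>
  interpret minimal_solution: stationary_inar_process M \<alpha> K \<epsilon> \<xi> minimal_solution
    by unfold_locales (rule minimal_solution_solves, rule minimal_solution_stationary)
  have le: "AE \<omega> in M. minimal_solution n \<omega> \<le> X n \<omega>" using minimal_solution_le by eventually_elim blast
  have int: "integrable M (\<lambda>\<omega>. real (X n \<omega>) - real (minimal_solution n \<omega>))"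
    by (intro Bochner_Integration.integrable_diff integrable_X minimal_solution.integrable_X)
  have "(\<integral>\<omega>. real (X n \<omega>) - real (minimal_solution n \<omega>) \<partial>M) = 0"
    by (simp add: integrable_X minimal_solution.integrable_X expectation_X minimal_solution.expectation_X)
  then have "AE \<omega> in M. real (X n \<omega>) - real (minimal_solution n \<omega>) = 0"
    by (subst (asm) integral_nonneg_eq_0_iff_AE[OF int]) (use le in \<open>eventually_elim, simp\<close>)
  then show "AE \<omega> in M. X n \<omega> = minimal_solution n \<omega>" by eventually_elim simp
qed

end

theorem theorem1:
  fixes M :: "'a measure"
    and \<alpha> :: "nat \<Rightarrow> real"
    and K :: real
    and \<epsilon> :: "int \<Rightarrow> 'a \<Rightarrow> nat"
    and \<xi> :: "int \<Rightarrow> nat \<Rightarrow> nat \<Rightarrow> 'a \<Rightarrow> nat"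
  assumes "prob_space M"
    and "complete_measure M"
    and "\<And>k. \<alpha> k \<ge> 0"
    and "(\<alpha> has_sum K) {1..}"
    and "K < 1"
    and "inar_noise M \<alpha> \<epsilon> \<xi>"
  shows "(\<exists>X. stationary_inar_solution M \<epsilon> \<xi> X) \<and>
    (\<forall>X Y. stationary_inar_solution M \<epsilon> \<xi> X \<longrightarrow> stationary_inar_solution M \<epsilon> \<xi> Y \<longrightarrow>
       (AE \<omega> in M. \<forall>n. X n \<omega> = Y n \<omega>)) \<and>
    (\<forall>X. stationary_inar_solution M \<epsilon> \<xi> X \<longrightarrow>
       (\<forall>n. integrable M (\<lambda>\<omega>. real (X n \<omega>)) \<and>
            (\<integral>\<omega>. real (X n \<omega>) \<partial>M) = \<alpha> 0 / (1 - K)))"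
proof -
  interpret inar M \<alpha> K \<epsilon> \<xi>
    using assms by (intro inar.intro inar_axioms.intro)
  have proc: "stationary_inar_process M \<alpha> K \<epsilon> \<xi> X" if "stationary_inar_solution M \<epsilon> \<xi> X" for X
    using that by unfold_locales (auto simp: stationary_inar_solution_def)
  show ?thesis
  proof (intro conjI allI impI)
    show "\<exists>X. stationary_inar_solution M \<epsilon> \<xi> X"
      using minimal_solution_solves minimal_solution_stationary by (auto simp: stationary_inar_solution_def)
  next
    fix X Y
    assume "stationary_inar_solution M \<epsilon> \<xi> X" "stationary_inar_solution M \<epsilon> \<xi> Y"
    then have "AE \<omega> in M. \<forall>n. X n \<omega> = minimal_solution n \<omega>" "AE \<omega> in M. \<forall>n. Y n \<omega> = minimal_solution n \<omega>"
      by (auto intro: stationary_inar_process.X_eq_minimal_solution proc)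
    then show "AE \<omega> in M. \<forall>n. X n \<omega> = Y n \<omega>" by eventually_elim simp
  next
    fix X n
    assume X: "stationary_inar_solution M \<epsilon> \<xi> X"
    interpret X: stationary_inar_process M \<alpha> K \<epsilon> \<xi> X by (rule proc[OF X])
    show "integrable M (\<lambda>\<omega>. real (X n \<omega>))" by (rule X.integrable_X)
    show "(\<integral>\<omega>. real (X n \<omega>) \<partial>M) = \<alpha> 0 / (1 - K)"
      using X.expectation_X by (simp add: X.mean_bound_def)
  qed
qed

end
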